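(* There is a universal constant $C>0$ such that the following holds. Let $n\ge 1$, let $T\subseteq\mathbb{R}^n$ be nonempty and bounded, and let $\varepsilon>0$. Then there exist a finite nonempty subset $S\subseteq T$ and non-negative constants $\{c_s\ge 0\}_{s\in S}$ such that $$|S|\le \exp\left(\frac{C}{\varepsilon^2}\right)\qquad\text{and}\qquad \left\|\sup_{t\in T} g\cdot t-\max_{s\in S}\{g\cdot s+c_s\}\right\|_{L^2}\le \varepsilon\, w(T).$$
   Context: Here $g\sim N(0,I_n)$ is a standard Gaussian vector in $\mathbb{R}^n$, $\|F\|_{L^2}=\mathbb{E}_{g\sim N(0,I_n)}[|F(g)|^2]^{1/2}$, and $w(T)=\mathbb{E}_{g\sim N(0,I_n)}[\sup_{t\in T}g\cdot t]$ is the Gaussian width of $T$. *)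

theory Defs
  imports "HOL-Probability.Probability"
begin

text \<open>
  The dimension \<open>n\<close> is an ordinary natural number, so that a constant can be chosen before it. A
  vector of \<open>\<real>\<^sup>n\<close> is a function on \<open>{..<n}\<close>, made extensional (value \<open>undefined\<close> outside \<open>{..<n}\<close>)
  so that distinct functions are distinct vectors. This matters when counting finite sets of vectors.
\<close>

definition Rn :: "nat \<Rightarrow> (nat \<Rightarrow> real) set" where
  "Rn n = (\<Pi>\<^sub>E i\<in>{..<n}. UNIV)"

definition dot :: "nat \<Rightarrow> (nat \<Rightarrow> real) \<Rightarrow> (nat \<Rightarrow> real) \<Rightarrow> real" where
  "dot n x y = (\<Sum>i<n. x i * y i)"

text \<open>
  Boundedness in the Euclidean norm. The library's \<open>bounded\<close> would be wrong here: the
  library's metric on \<open>nat \<Rightarrow> real\<close> is itself bounded, so every set of functions would qualify.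
\<close>

definition bounded_Rn :: "nat \<Rightarrow> (nat \<Rightarrow> real) set \<Rightarrow> bool" where
  "bounded_Rn n T \<longleftrightarrow> (\<exists>B. \<forall>t\<in>T. L2_set t {..<n} \<le> B)"

definition std_gaussian :: "nat \<Rightarrow> (nat \<Rightarrow> real) measure" where
  "std_gaussian n = (\<Pi>\<^sub>M i\<in>{..<n}. density lborel std_normal_density)"

definition gaussian_width :: "nat \<Rightarrow> (nat \<Rightarrow> real) set \<Rightarrow> real" where
  "gaussian_width n T = (\<integral>g. (SUP t\<in>T. dot n g t) \<partial>std_gaussian n)"

text \<open>
  The norm takes values in \<open>[0, \<infinity>]\<close>, so that a function that is not square integrable has norm
  \<open>\<infinity>\<close> instead of the default value \<open>0\<close> of the Bochner integral.
\<close>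

definition L2_norm :: "'a measure \<Rightarrow> ('a \<Rightarrow> real) \<Rightarrow> ennreal" where
  "L2_norm M F =
     (let I = (\<integral>\<^sup>+x. ennreal (\<bar>F x\<bar>\<^sup>2) \<partial>M)
      in if I = \<infinity> then \<infinity> else ennreal (sqrt (enn2real I)))"

lemma L2_norm_eq_integral:
  assumes "integrable M (\<lambda>x. \<bar>F x\<bar>\<^sup>2)"
  shows "L2_norm M F = ennreal (sqrt (\<integral>x. \<bar>F x\<bar>\<^sup>2 \<partial>M))"
proof -
  have "(\<integral>\<^sup>+x. ennreal (\<bar>F x\<bar>\<^sup>2) \<partial>M) = ennreal (\<integral>x. \<bar>F x\<bar>\<^sup>2 \<partial>M)"
    by (rule nn_integral_eq_integral[OF assms]) simp
  then show ?thesis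
    by (simp add: L2_norm_def)
qed

lemma space_std_gaussian: "space (std_gaussian n) = Rn n"
  by (simp add: std_gaussian_def Rn_def space_PiM)

lemma prob_space_std_gaussian: "prob_space (std_gaussian n)"
  unfolding std_gaussian_def
  by (intro prob_space_PiM prob_space_normal_density) simp

end

theory Submission
  imports Defs
begin

text \<open>
  Replace the supremum \<open>F\<close> by the soft maximum \<open>lse\<close> at inverse temperature \<open>l\<close> with weights \<open>b\<close>. The Gibbs
  weights \<open>gibbs g s\<close> sum to 1 over \<open>s\<close>, and for fixed \<open>s\<close> they are log-concave in \<open>g\<close>. They thus write the
  Gaussian measure as a mixture of log-concave measures, each satisfying the Poincare inequality with
  constant 1 (proved from the Prekopa--Leindler inequality). Gaussian integration by parts bounds the
  mean Gibbs variance \<open>spread\<close> by \<open>W / l\<close>, where \<open>W\<close> is the width.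

  Moving \<open>l\<close> while adjusting \<open>b\<close> so that each gap \<open>lse g - dot n g s\<close> stays centred under its component
  changes \<open>lse\<close> at \<open>L\<^sup>2\<close> speed at most \<open>sqrt (W / l) / l\<close>. This is integrable at infinity, so a hard maximum
  and a soft maximum at inverse temperature \<open>l\<close> can be transformed into each other at \<open>L\<^sup>2\<close> cost of
  order \<open>sqrt (W / l)\<close>. For error \<open>\<epsilon> W\<close>, take \<open>l\<close> of order \<open>1 / (\<epsilon>\<^sup>2 W)\<close>. There the component densities are at most
  \<open>exp (3 l W)\<close> where \<open>F\<close> is close to \<open>lse\<close>, hence \<open>exp (O (1 / \<epsilon>\<^sup>2))\<close> random samples of \<open>s\<close> suffice to
  approximate \<open>lse\<close>: the gradients agree in \<open>L\<^sup>2\<close>, and the Gaussian Poincare inequality gives the rest.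
  Finally the sampled soft maximum is transformed back into a hard one.
\<close>

section \<open>The Prekopa--Leindler inequality for Gaussian measure\<close>

text \<open>Comparing \<open>hmax\<close> with \<open>lse\<close> directly costs
  \<open>ln (card S) / l\<close>, which the width does not control at the \<open>l\<close> of
  interest. So they are compared only at an inverse temperature so large that this cost is
  negligible, and the flow in \<open>l\<close> carries the estimate down. Its speed involves neither
  the cardinality nor the dimension, because a component has Poincare constant 1 however small its
  mass is. The weights \<open>b\<close> drift in an uncontrolled way along the flow; hence the error
  constants of a single step have to be uniform in \<open>b\<close>.

  Sampling is done at the soft level because only there are the component densities bounded; for a
  hard maximum they are normalized indicators of cells, of height 1 over the mass of the cell. The
  choice of \<open>l\<close> balances the errors: \<open>sqrt (W / l)\<close> is then of order
  \<open>\<epsilon> * W\<close>. Sampling controls gradients only, so a constant has to be adjusted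
  afterwards. The signs of the constants are repaired at the very end. A large
  \<open>\<epsilon>\<close> needs its own argument, because the bound on the cardinality eventually
  leaves room for one point only.\<close>

lemma emeasure_lborel_midpoint_image:
  fixes A :: "real set"
  assumes [measurable]: "A \<in> sets borel"
  shows "emeasure lborel A = 2 * emeasure lborel {z. 2 * z - b \<in> A}"
proof -
  have "emeasure lborel A = (\<integral>\<^sup>+x. indicator A x \<partial>lborel)" by simp
  also have "\<dots> = 2 * (\<integral>\<^sup>+x. indicator A (-b + 2 * x) \<partial>lborel)"
    by (subst nn_integral_real_affine[where c=2 and t="-b"]) auto
  also have "(\<integral>\<^sup>+x. indicator A (-b + 2 * x) \<partial>lborel) = (\<integral>\<^sup>+x. indicator {z. 2 * z - b \<in> A} x \<partial>lborel)"
    by (intro nn_integral_cong) (auto simp: indicator_def)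
  also have "\<dots> = emeasure lborel {z. 2 * z - b \<in> A}"
    by (subst nn_integral_indicator) auto
  finally show ?thesis .
qed

text \<open>The copies \<open>(A + min B) / 2\<close> and \<open>(max A + B) / 2\<close> both lie in
  \<open>C\<close>, on different sides of \<open>(max A + min B) / 2\<close>, so their measures add
  up. Admitting any Borel \<open>C\<close> that contains the midpoints avoids the question whether
  the set of midpoints is itself measurable.\<close>

lemma brunn_minkowski_real_compact:
  fixes A B C :: "real set"
  assumes "compact A" "compact B" "A \<noteq> {}" "B \<noteq> {}" and [measurable]: "C \<in> sets borel"
    and C: "\<And>a b. a \<in> A \<Longrightarrow> b \<in> B \<Longrightarrow> (a + b) / 2 \<in> C"
  shows "emeasure lborel A + emeasure lborel B \<le> 2 * emeasure lborel C"
proof -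
  obtain a where a: "a \<in> A" "\<And>x. x \<in> A \<Longrightarrow> x \<le> a"
    using compact_attains_sup[OF \<open>compact A\<close> \<open>A \<noteq> {}\<close>] by auto
  obtain b where b: "b \<in> B" "\<And>x. x \<in> B \<Longrightarrow> b \<le> x"
    using compact_attains_inf[OF \<open>compact B\<close> \<open>B \<noteq> {}\<close>] by auto
  have [measurable]: "A \<in> sets borel" "B \<in> sets borel"
    using assms by (auto intro: borel_compact)
  let ?A = "{z. 2 * z - b \<in> A}" and ?B = "{z. 2 * z - a \<in> B}"
  have C': "?A \<union> ?B \<subseteq> C"
  proof
    fix z assume "z \<in> ?A \<union> ?B"
    then show "z \<in> C" using C[of "2 * z - b" b] C[of a "2 * z - a"] a b by auto
  qed
  have "?A \<inter> ?B \<subseteq> {(a + b) / 2}"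
    using a(2) b(2) by force
  then have null: "?A \<inter> ?B \<in> null_sets lborel"
    by (meson finite.emptyI finite.insertI finite_imp_null_set_lborel finite_subset)
  have "emeasure lborel A + emeasure lborel B = 2 * (emeasure lborel ?A + emeasure lborel ?B)"
    using emeasure_lborel_midpoint_image[of A b] emeasure_lborel_midpoint_image[of B a]
    by (simp add: distrib_left)
  also have "emeasure lborel ?A + emeasure lborel ?B = emeasure lborel (?A \<union> ?B)"
    by (rule emeasure_Un'[symmetric]) (use null in auto)
  also have "\<dots> \<le> emeasure lborel C"
    by (intro emeasure_mono C') auto
  finally show ?thesis by (simp add: mult_left_mono)
qed

text \<open>Inner regularity yields a closed set, and the cut to \<open>{-k..k}\<close> makes it
  compact. The point \<open>a\<close> is added to keep \<open>K\<close> nonempty, as the compact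
  case demands.\<close>

lemma compact_inner_approx:
  fixes A :: "real set" and k e :: real
  assumes A: "A \<in> sets borel" and "a \<in> A" "e > 0"
  obtains K where "compact K" "K \<subseteq> A" "a \<in> K"
    "emeasure lborel (A \<inter> {-k..k}) \<le> emeasure lborel K + ennreal e"
proof -
  have "A \<inter> {-k..k} \<in> sets lebesgue" using A by auto
  from sets_lebesgue_inner_closed[OF this \<open>e > 0\<close>]
  obtain T where T: "closed T" "T \<subseteq> A \<inter> {-k..k}" "A \<inter> {-k..k} - T \<in> lmeasurable"
      "emeasure lebesgue (A \<inter> {-k..k} - T) < ennreal e" by blast
  have Tc: "compact T"
    using T(1,2) by (metis Int_absorb2 compact_Icc compact_Int_closed inf.bounded_iff inf_commute)
  have Tb: "T \<in> sets borel" using Tc by (rule borel_compact)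
  show ?thesis
  proof
    show "compact (insert a T)" using Tc by simp
    show "insert a T \<subseteq> A" "a \<in> insert a T" using T \<open>a \<in> A\<close> by auto
    have "emeasure lborel (A \<inter> {-k..k}) \<le> emeasure lborel (insert a T \<union> (A \<inter> {-k..k} - T))"
      using A Tb by (intro emeasure_mono) auto
    also have "\<dots> \<le> emeasure lborel (insert a T) + emeasure lborel (A \<inter> {-k..k} - T)"
      using A Tb by (intro emeasure_subadditive) auto
    also have "emeasure lborel (A \<inter> {-k..k} - T) = emeasure lebesgue (A \<inter> {-k..k} - T)"
      using A Tb by simp
    finally show "emeasure lborel (A \<inter> {-k..k}) \<le> emeasure lborel (insert a T) + ennreal e"
      using T(4) by (meson add_left_mono dual_order.trans less_imp_le)
  qed
qed

lemma brunn_minkowski_real: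
  fixes A B C :: "real set"
  assumes A: "A \<in> sets borel" and B: "B \<in> sets borel" and Cb: "C \<in> sets borel"
    and "A \<noteq> {}" "B \<noteq> {}"
    and C: "\<And>a b. a \<in> A \<Longrightarrow> b \<in> B \<Longrightarrow> (a + b) / 2 \<in> C"
  shows "emeasure lborel A + emeasure lborel B \<le> 2 * emeasure lborel C"
proof -
  obtain a b where ab: "a \<in> A" "b \<in> B" using assms by auto
  let ?A = "\<lambda>k::nat. A \<inter> {- real k..real k}" and ?B = "\<lambda>k::nat. B \<inter> {- real k..real k}"
  have step: "emeasure lborel (?A k) + emeasure lborel (?B k) \<le> 2 * emeasure lborel C" for k
  proof (rule ennreal_le_epsilon)
    fix e :: real assume e: "e > 0"
    then have e2: "e / 2 > 0" by simp
    obtain K where K: "compact K" "K \<subseteq> A" "a \<in> K"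
      "emeasure lborel (?A k) \<le> emeasure lborel K + ennreal (e/2)"
      using compact_inner_approx[OF A ab(1) e2] by blast
    obtain L where L: "compact L" "L \<subseteq> B" "b \<in> L"
      "emeasure lborel (?B k) \<le> emeasure lborel L + ennreal (e/2)"
      using compact_inner_approx[OF B ab(2) e2] by blast
    have "emeasure lborel K + emeasure lborel L \<le> 2 * emeasure lborel C"
      by (rule brunn_minkowski_real_compact) (use K L C Cb in auto)
    have "emeasure lborel (?A k) + emeasure lborel (?B k)
        \<le> (emeasure lborel K + ennreal (e/2)) + (emeasure lborel L + ennreal (e/2))"
      using K L by (intro add_mono) auto
    also have "\<dots> = (emeasure lborel K + emeasure lborel L) + (ennreal (e/2) + ennreal (e/2))"
      by (simp add: ac_simps)
    also have "ennreal (e/2) + ennreal (e/2) = ennreal e"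
      using e by (simp add: ennreal_plus[symmetric] del: ennreal_plus)
    finally show "emeasure lborel (?A k) + emeasure lborel (?B k) \<le> 2 * emeasure lborel C + ennreal e"
      using \<open>emeasure lborel K + emeasure lborel L \<le> 2 * emeasure lborel C\<close>
      by (meson add_right_mono order_trans)
  qed
  have lim: "(\<lambda>k. emeasure lborel (X \<inter> {- real k..real k})) \<longlonglongrightarrow> emeasure lborel X"
    if X: "X \<in> sets borel" for X :: "real set"
  proof -
    have "(\<lambda>k. emeasure lborel (X \<inter> {- real k..real k})) \<longlonglongrightarrow> emeasure lborel (\<Union>k. X \<inter> {- real k..real k})"
      using X by (intro Lim_emeasure_incseq) (auto simp: incseq_def)
    also have "(\<Union>k. X \<inter> {- real k..real k}) = X"
    proof -
      have "\<exists>k. x \<in> {- real k..real k}" for x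
        using real_arch_simple[of "\<bar>x\<bar>"] by (auto simp: abs_le_iff) (metis minus_le_iff)
      then show ?thesis by blast
    qed
    finally show ?thesis .
  qed
  show ?thesis
    by (rule LIMSEQ_le_const2[OF tendsto_add[OF lim[OF A] lim[OF B]]]) (use step in auto)
qed

lemma ennreal_four_mult_le_power2_add:
  fixes x y :: ennreal
  shows "4 * (x * y) \<le> (x + y)\<^sup>2"
proof (cases "x = top \<or> y = top")
  case True
  then show ?thesis by (auto simp: power2_eq_square ennreal_top_mult ennreal_mult_top)
next
  case False
  then obtain a b where ab: "x = ennreal a" "y = ennreal b" "a \<ge> 0" "b \<ge> 0"
    by (metis ennreal_cases)
  have "4 * (a * b) \<le> (a + b)\<^sup>2"
    using sum_squares_bound[of a b] by (simp add: power2_eq_square algebra_simps)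
  then have "ennreal (4 * (a * b)) \<le> ennreal ((a + b)\<^sup>2)"
    using ennreal_leI by blast
  then show ?thesis using ab
    by (simp add: ennreal_mult ennreal_power[symmetric] ennreal_plus[symmetric] del: ennreal_plus)
qed

lemma nn_integral_indicator_unit_level:
  fixes r :: real
  assumes "0 \<le> r" "r \<le> 1"
  shows "(\<integral>\<^sup>+t. indicator {t. 0 < t \<and> t < 1 \<and> t < r} t \<partial>lborel) = ennreal r"
proof -
  have "{t. 0 < t \<and> t < 1 \<and> t < r} = {0<..<r}" using assms by auto
  then show ?thesis using assms by simp
qed

lemma layer_cake_le_one:
  fixes f :: "real \<Rightarrow> real"
  assumes [measurable]: "f \<in> borel_measurable borel" and f: "\<And>x. 0 \<le> f x" "\<And>x. f x \<le> 1"
  shows "(\<integral>\<^sup>+x. ennreal (f x) \<partial>lborel)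
       = (\<integral>\<^sup>+t. emeasure lborel {x. t < f x} * indicator {0<..<1} t \<partial>lborel)"
proof -
  have "(\<integral>\<^sup>+x. ennreal (f x) \<partial>lborel)
      = (\<integral>\<^sup>+x. (\<integral>\<^sup>+t. indicator {t. 0 < t \<and> t < 1 \<and> t < f x} t \<partial>lborel) \<partial>lborel)"
    using f by (intro nn_integral_cong nn_integral_indicator_unit_level[symmetric]) auto
  also have "\<dots> = (\<integral>\<^sup>+x. (\<integral>\<^sup>+t. indicator {p. 0 < snd p \<and> snd p < 1 \<and> snd p < f (fst p)} (x, t) \<partial>lborel) \<partial>lborel)"
    by (intro nn_integral_cong) (auto simp: indicator_def)
  also have "\<dots> = (\<integral>\<^sup>+t. (\<integral>\<^sup>+x. indicator {p. 0 < snd p \<and> snd p < 1 \<and> snd p < f (fst p)} (x, t) \<partial>lborel) \<partial>lborel)"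
    by (rule lborel_pair.Fubini'[symmetric]) measurable
  also have "\<dots> = (\<integral>\<^sup>+t. (\<integral>\<^sup>+x. indicator {x. t < f x} x * indicator {0<..<1} t \<partial>lborel) \<partial>lborel)"
    by (intro nn_integral_cong) (auto simp: indicator_def)
  also have "\<dots> = (\<integral>\<^sup>+t. emeasure lborel {x. t < f x} * indicator {0<..<1} t \<partial>lborel)"
    by (intro nn_integral_cong) (simp add: nn_integral_multc)
  finally show ?thesis .
qed

text \<open>The normalization \<open>sup f = sup g = 1\<close> makes all level sets below height 1 nonempty, so that
  the Brunn--Minkowski inequality can be integrated over the levels.\<close>

lemma prekopa_leindler_normalized:
  fixes f g h :: "real \<Rightarrow> real"
  assumes [measurable]: "f \<in> borel_measurable borel" "g \<in> borel_measurable borel" "h \<in> borel_measurable borel"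
    and f: "\<And>x. 0 \<le> f x" "\<And>x. f x \<le> 1" "\<And>t. t < 1 \<Longrightarrow> \<exists>x. t < f x"
    and g: "\<And>x. 0 \<le> g x" "\<And>x. g x \<le> 1" "\<And>t. t < 1 \<Longrightarrow> \<exists>x. t < g x"
    and h: "\<And>x. 0 \<le> h x" "\<And>x y. f x * g y \<le> (h ((x + y) / 2))\<^sup>2"
  shows "(\<integral>\<^sup>+x. ennreal (f x) \<partial>lborel) + (\<integral>\<^sup>+x. ennreal (g x) \<partial>lborel)
       \<le> 2 * (\<integral>\<^sup>+x. ennreal (h x) \<partial>lborel)"
proof -
  \<comment> \<open>Cutting \<open>h\<close> at 1 makes the layer-cake formula applicable and is
    invisible at levels below 1.\<close>
  have lev: "emeasure lborel {x. t < f x} + emeasure lborel {x. t < g x} \<le> 2 * emeasure lborel {x. t < min 1 (h x)}"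
    if t: "0 < t" "t < 1" for t
  proof (rule brunn_minkowski_real)
    fix a b assume "a \<in> {x. t < f x}" "b \<in> {x. t < g x}"
    then have "t * t < f a * g b" using t by (intro mult_strict_mono) auto
    also have "\<dots> \<le> (h ((a + b) / 2))\<^sup>2" by (rule h)
    finally have "t < h ((a + b) / 2)"
      using h(1) t by (metis power2_eq_square power_less_imp_less_base)
    then show "(a + b) / 2 \<in> {x. t < min 1 (h x)}" using t by simp
  qed (use f(3)[OF t(2)] g(3)[OF t(2)] in auto)
  have "(\<integral>\<^sup>+x. ennreal (f x) \<partial>lborel) + (\<integral>\<^sup>+x. ennreal (g x) \<partial>lborel)
     = (\<integral>\<^sup>+t. emeasure lborel {x. t < f x} * indicator {0<..<1} t
          + emeasure lborel {x. t < g x} * indicator {0<..<1} t \<partial>lborel)"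
    unfolding layer_cake_le_one[OF assms(1) f(1,2)] layer_cake_le_one[OF assms(2) g(1,2)]
    by (rule nn_integral_add[symmetric]) measurable
  also have "\<dots> \<le> (\<integral>\<^sup>+t. 2 * (emeasure lborel {x. t < min 1 (h x)} * indicator {0<..<1} t) \<partial>lborel)"
    by (intro nn_integral_mono) (use lev in \<open>auto simp: indicator_def\<close>)
  also have "\<dots> = 2 * (\<integral>\<^sup>+t. emeasure lborel {x. t < min 1 (h x)} * indicator {0<..<1} t \<partial>lborel)"
    by (rule nn_integral_cmult) measurable
  also have "\<dots> = 2 * (\<integral>\<^sup>+x. ennreal (min 1 (h x)) \<partial>lborel)"
    by (subst layer_cake_le_one) (use h in auto)
  also have "\<dots> \<le> 2 * (\<integral>\<^sup>+x. ennreal (h x) \<partial>lborel)"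
    by (intro mult_left_mono nn_integral_mono ennreal_leI) auto
  finally show ?thesis .
qed

text \<open>Dividing \<open>f\<close>, \<open>g\<close> and \<open>h\<close> by
  \<open>A = sup f\<close>, \<open>B = sup g\<close> and \<open>sqrt (A * B)\<close> normalizes them
  and respects the hypothesis. The additive conclusion of the normalized case gives the product form
  by the arithmetic-geometric mean inequality, and the product form is invariant under the
  scaling.\<close>

lemma prekopa_leindler_bounded:
  fixes f g :: "real \<Rightarrow> real" and h :: "real \<Rightarrow> ennreal"
  assumes [measurable]: "f \<in> borel_measurable borel" "g \<in> borel_measurable borel" "h \<in> borel_measurable borel"
    and f: "\<And>x. 0 \<le> f x" "\<And>x. f x \<le> K" and g: "\<And>x. 0 \<le> g x" "\<And>x. g x \<le> K"
    and h: "\<And>x y. ennreal (f x * g y) \<le> (h ((x + y) / 2))\<^sup>2"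
  shows "(\<integral>\<^sup>+x. ennreal (f x) \<partial>lborel) * (\<integral>\<^sup>+x. ennreal (g x) \<partial>lborel) \<le> (\<integral>\<^sup>+x. h x \<partial>lborel)\<^sup>2"
proof -
  define A B where "A = (SUP x. f x)" and "B = (SUP x. g x)"
  have bf: "bdd_above (range f)" and bg: "bdd_above (range g)" using f g by (auto intro!: bdd_aboveI)
  have fA: "f x \<le> A" and gB: "g x \<le> B" for x
    unfolding A_def B_def using bf bg by (auto intro: cSUP_upper)
  have A0: "A \<ge> 0" "B \<ge> 0" using f(1)[of 0] fA[of 0] g(1)[of 0] gB[of 0] by auto
  show ?thesis
  proof (cases "A = 0 \<or> B = 0")
    case True
    then have "(\<forall>x. f x = 0) \<or> (\<forall>x. g x = 0)"
      using fA gB f g by (meson order_antisym_conv order_trans)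
    then show ?thesis by auto
  next
    case False
    then have A: "A > 0" "B > 0" using A0 by auto
    define c where "c = sqrt (A * B)"
    have c: "c > 0" "c * c = A * B" using A by (auto simp: c_def)
    \<comment> \<open>Cutting \<open>h\<close> at \<open>c\<close> makes it finite and preserves the
      hypothesis, because \<open>f x * g y\<close> is at most \<open>A * B = c * c\<close>.\<close>
    define k where "k x = enn2real (min (h x) (ennreal c)) / c" for x
    have [measurable]: "k \<in> borel_measurable borel" unfolding k_def by measurable
    have fin: "min (h x) (ennreal c) < top" for x by (simp add: min_less_iff_disj)
    have k: "ennreal (c * k x) = min (h x) (ennreal c)" for x
      using c fin[of x] by (simp add: k_def)
    have k0: "k x \<ge> 0" for x using c by (simp add: k_def)
    have ex: "\<exists>x. t < F x / M" if "t < 1" "M = (SUP x. F x)" "M > 0" for t M :: real and F :: "real \<Rightarrow> real"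
    proof -
      have "t * M < (SUP x. F x)" using that by simp
      then obtain x where "t * M < F x" using less_cSupD[of "range F" "t * M"] by auto
      then show ?thesis using that by (auto simp: field_simps)
    qed
    have "(\<integral>\<^sup>+x. ennreal (f x / A) \<partial>lborel) + (\<integral>\<^sup>+x. ennreal (g x / B) \<partial>lborel)
       \<le> 2 * (\<integral>\<^sup>+x. ennreal (k x) \<partial>lborel)"
    proof (rule prekopa_leindler_normalized)
      fix x y :: real
      let ?z = "(x + y) / 2"
      have "ennreal (f x * g y) \<le> (ennreal (c * k ?z))\<^sup>2"
      proof (cases "h ?z \<le> ennreal c")
        case True
        then show ?thesis using h[of x y] by (simp add: k)
      next
        case False
        have "f x * g y \<le> A * B" using fA gB f g A by (intro mult_mono) auto
        then have "ennreal (f x * g y) \<le> ennreal (c * c)" using c by (simp add: ennreal_leI)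
        then show ?thesis using False c
          by (simp add: k power2_eq_square ennreal_mult[symmetric] min_def)
      qed
      then have "f x * g y \<le> (c * k ?z)\<^sup>2"
        using c k0[of ?z] by (simp add: ennreal_power)
      also have "\<dots> = (A * B) * (k ?z)\<^sup>2"
        using c by (simp add: power_mult_distrib power2_eq_square)
      finally show "f x / A * (g y / B) \<le> (k ?z)\<^sup>2"
        using A by (simp add: field_simps)
    qed (use f g fA gB A k0 ex[of _ A f] ex[of _ B g] in \<open>auto simp: A_def B_def\<close>)
    moreover have "(\<integral>\<^sup>+x. ennreal (F x) \<partial>lborel) = ennreal M * (\<integral>\<^sup>+x. ennreal (F x / M) \<partial>lborel)"
      if [measurable]: "F \<in> borel_measurable borel" and "M > 0" "\<And>x. F x \<ge> 0" for F :: "real \<Rightarrow> real" and M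
      using that by (subst nn_integral_cmult[symmetric]) (auto simp: ennreal_mult[symmetric])
    note this[OF assms(1) A(1) f(1)] this[OF assms(2) A(2) g(1)]
    moreover have "ennreal c * (\<integral>\<^sup>+x. ennreal (k x) \<partial>lborel) \<le> (\<integral>\<^sup>+x. h x \<partial>lborel)"
    proof -
      have "ennreal c * (\<integral>\<^sup>+x. ennreal (k x) \<partial>lborel) = (\<integral>\<^sup>+x. ennreal (c * k x) \<partial>lborel)"
        using c by (subst nn_integral_cmult[symmetric]) (auto simp: ennreal_mult k0)
      also have "\<dots> \<le> (\<integral>\<^sup>+x. h x \<partial>lborel)"
        by (intro nn_integral_mono) (simp add: k)
      finally show ?thesis .
    qed
    moreover define F G K where "F = (\<integral>\<^sup>+x. ennreal (f x / A) \<partial>lborel)"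
      and "G = (\<integral>\<^sup>+x. ennreal (g x / B) \<partial>lborel)" and "K = (\<integral>\<^sup>+x. ennreal (k x) \<partial>lborel)"
    ultimately have FG: "F + G \<le> 2 * K" and "ennreal c * K \<le> (\<integral>\<^sup>+x. h x \<partial>lborel)"
      and eq: "(\<integral>\<^sup>+x. ennreal (f x) \<partial>lborel) = ennreal A * F" "(\<integral>\<^sup>+x. ennreal (g x) \<partial>lborel) = ennreal B * G"
      by simp_all
    have "4 * (F * G) \<le> (F + G)\<^sup>2" by (rule ennreal_four_mult_le_power2_add)
    also have "\<dots> \<le> (2 * K)\<^sup>2" by (intro power_mono FG) auto
    also have "\<dots> = 4 * (K * K)" by (simp add: power2_eq_square mult.assoc mult.left_commute[of K])
    finally have "F * G \<le> K * K"
      using ennreal_mult_le_mult_iff[of 4 "F * G" "K * K"] by simp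
    have "(\<integral>\<^sup>+x. ennreal (f x) \<partial>lborel) * (\<integral>\<^sup>+x. ennreal (g x) \<partial>lborel) = ennreal (c * c) * (F * G)"
      using A by (simp add: eq c ennreal_mult ac_simps)
    also have "\<dots> \<le> ennreal (c * c) * (K * K)" by (intro mult_left_mono) (use \<open>F * G \<le> K * K\<close> in auto)
    also have "\<dots> = (ennreal c * K)\<^sup>2" using c(1) by (simp add: ennreal_mult power2_eq_square ac_simps)
    also have "\<dots> \<le> (\<integral>\<^sup>+x. h x \<partial>lborel)\<^sup>2"
      by (intro power_mono) (use \<open>ennreal c * K \<le> _\<close> in auto)
    finally show ?thesis .
  qed
qed

lemma prekopa_leindler_real:
  fixes f g h :: "real \<Rightarrow> ennreal"
  assumes [measurable]: "f \<in> borel_measurable borel" "g \<in> borel_measurable borel" "h \<in> borel_measurable borel"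
    and h: "\<And>x y. f x * g y \<le> (h ((x + y) / 2))\<^sup>2"
  shows "(\<integral>\<^sup>+x. f x \<partial>lborel) * (\<integral>\<^sup>+x. g x \<partial>lborel) \<le> (\<integral>\<^sup>+x. h x \<partial>lborel)\<^sup>2"
proof -
  define cut where "cut F k x = min (F x) (of_nat k)" for F :: "real \<Rightarrow> ennreal" and k :: nat and x
  have [measurable]: "cut F k \<in> borel_measurable borel" if "F \<in> borel_measurable borel" for F k
    unfolding cut_def using that by measurable
  have fin: "cut F k x < top" for F k x by (simp add: cut_def min_less_iff_disj of_nat_less_top)
  have lim: "(\<lambda>k. \<integral>\<^sup>+x. cut F k x \<partial>lborel) \<longlonglongrightarrow> (\<integral>\<^sup>+x. F x \<partial>lborel)"
    if [measurable]: "F \<in> borel_measurable borel" for F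
  proof (rule nn_integral_LIMSEQ)
    show "incseq (cut F)"
      by (auto simp: incseq_def le_fun_def cut_def min_le_iff_disj) 
    show "(\<lambda>k. cut F k x) \<longlonglongrightarrow> F x" for x
    proof (cases "F x = top")
      case True
      then show ?thesis using of_nat_tendsto_top_ennreal by (simp add: cut_def)
    next
      case False
      then obtain m :: nat where "F x < of_nat m"
        by (metis ennreal_Ex_less_of_nat top.not_eq_extremum)
      then have "\<forall>\<^sub>F k in sequentially. cut F k x = F x"
        unfolding eventually_sequentially cut_def
        by (intro exI[of _ m]) (auto simp: min_def dest: order.strict_trans2 intro: order_antisym
            order_trans[OF less_imp_le])
      then show ?thesis by (rule tendsto_eventually)
    qed
  qed measurable
  have le: "(\<integral>\<^sup>+x. cut f k x \<partial>lborel) * (\<integral>\<^sup>+x. cut g k x \<partial>lborel) \<le> (\<integral>\<^sup>+x. h x \<partial>lborel)\<^sup>2" for k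
  proof -
    have "(\<integral>\<^sup>+x. ennreal (enn2real (cut f k x)) \<partial>lborel) * (\<integral>\<^sup>+x. ennreal (enn2real (cut g k x)) \<partial>lborel)
        \<le> (\<integral>\<^sup>+x. h x \<partial>lborel)\<^sup>2"
    proof (rule prekopa_leindler_bounded[where K = "real k"])
      show "enn2real (cut F k x) \<le> real k" for F x
        by (rule enn2real_leI) (auto simp: cut_def ennreal_of_nat_eq_real_of_nat)
      then show "enn2real (cut F k x) \<le> real k" for F x .
      fix x y :: real
      have "ennreal (enn2real (cut f k x) * enn2real (cut g k y)) = cut f k x * cut g k y"
        using fin by (simp add: ennreal_mult)
      also have "\<dots> \<le> f x * g y" by (intro mult_mono) (auto simp: cut_def)
      also have "\<dots> \<le> (h ((x + y) / 2))\<^sup>2" by (rule h)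
      finally show "ennreal (enn2real (cut f k x) * enn2real (cut g k y)) \<le> (h ((x + y) / 2))\<^sup>2" .
    qed auto
    then show ?thesis using fin by simp
  qed
  have inc: "incseq (\<lambda>k. \<integral>\<^sup>+x. cut F k x \<partial>lborel)" for F
    by (auto simp: incseq_def cut_def intro!: nn_integral_mono min.mono)
  note sup = LIMSEQ_unique[OF LIMSEQ_SUP[OF inc] lim]
  have "(\<integral>\<^sup>+x. f x \<partial>lborel) * (\<integral>\<^sup>+x. g x \<partial>lborel)
      = (SUP j. SUP i. (\<integral>\<^sup>+x. cut f i x \<partial>lborel) * (\<integral>\<^sup>+x. cut g j x \<partial>lborel))"
    by (simp add: sup[OF assms(1), symmetric] sup[OF assms(2), symmetric] SUP_mult_left_ennreal SUP_mult_right_ennreal)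
  also have "\<dots> \<le> (\<integral>\<^sup>+x. h x \<partial>lborel)\<^sup>2"
  \<comment> \<open>The two factors come with different truncation levels; raising both to
    \<open>max i j\<close> reduces to a common level.\<close>
  proof (intro SUP_least)
    fix i j
    have "(\<integral>\<^sup>+x. cut f i x \<partial>lborel) * (\<integral>\<^sup>+x. cut g j x \<partial>lborel)
        \<le> (\<integral>\<^sup>+x. cut f (max i j) x \<partial>lborel) * (\<integral>\<^sup>+x. cut g (max i j) x \<partial>lborel)"
      by (intro mult_mono nn_integral_mono) (auto simp: cut_def min.coboundedI2 of_nat_mono)
    also have "\<dots> \<le> (\<integral>\<^sup>+x. h x \<partial>lborel)\<^sup>2" by (rule le)
    finally show "(\<integral>\<^sup>+x. cut f i x \<partial>lborel) * (\<integral>\<^sup>+x. cut g j x \<partial>lborel) \<le> (\<integral>\<^sup>+x. h x \<partial>lborel)\<^sup>2" .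
  qed
  finally show ?thesis .
qed

text \<open>By the parallelogram identity, \<open>x\<^sup>2 / 2 + y\<^sup>2 / 2\<close> exceeds its
  value with both points moved to the midpoint by \<open>(x - y)\<^sup>2 / 4\<close>. The Gaussian
  density thus pays for the factor \<open>exp ((x - y)\<^sup>2 / 4)\<close>, and this surplus is
  what the Poincare inequality is made from.\<close>

lemma prekopa_leindler_std_normal:
  fixes f g h :: "real \<Rightarrow> ennreal"
  assumes [measurable]: "f \<in> borel_measurable borel" "g \<in> borel_measurable borel" "h \<in> borel_measurable borel"
    and h: "\<And>x y. f x * g y \<le> ennreal (exp ((x - y)\<^sup>2 / 4)) * (h ((x + y) / 2))\<^sup>2"
  shows "(\<integral>\<^sup>+x. f x \<partial>density lborel std_normal_density) * (\<integral>\<^sup>+x. g x \<partial>density lborel std_normal_density)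
      \<le> (\<integral>\<^sup>+x. h x \<partial>density lborel std_normal_density)\<^sup>2"
proof -
  let ?d = "\<lambda>x. ennreal (std_normal_density x)"
  have "(\<integral>\<^sup>+x. ?d x * f x \<partial>lborel) * (\<integral>\<^sup>+x. ?d x * g x \<partial>lborel) \<le> (\<integral>\<^sup>+x. ?d x * h x \<partial>lborel)\<^sup>2"
  proof (rule prekopa_leindler_real)
    fix x y :: real
    let ?z = "(x + y) / 2"
    have "exp (- x\<^sup>2 / 2) * exp (- y\<^sup>2 / 2) * exp ((x - y)\<^sup>2 / 4) = exp (- ?z\<^sup>2 / 2) * exp (- ?z\<^sup>2 / 2)"
      by (simp only: exp_add[symmetric]) (simp add: power2_eq_square field_simps)
    then have dens: "std_normal_density x * std_normal_density y * exp ((x - y)\<^sup>2 / 4) = (std_normal_density ?z)\<^sup>2"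
      by (simp add: std_normal_density_def power2_eq_square)
    have "(?d x * f x) * (?d y * g y) = ennreal (std_normal_density x * std_normal_density y) * (f x * g y)"
      by (simp add: ennreal_mult ac_simps)
    also have "\<dots> \<le> ennreal (std_normal_density x * std_normal_density y)
        * (ennreal (exp ((x - y)\<^sup>2 / 4)) * (h ?z)\<^sup>2)"
      by (intro mult_left_mono h) auto
    also have "\<dots> = ennreal (std_normal_density x * std_normal_density y * exp ((x - y)\<^sup>2 / 4)) * (h ?z)\<^sup>2"
      by (simp add: ennreal_mult ac_simps)
    also have "\<dots> = (?d ?z * h ?z)\<^sup>2"
      unfolding dens by (simp add: power_mult_distrib ennreal_power)
    finally show "(?d x * f x) * (?d y * g y) \<le> (?d ?z * h ?z)\<^sup>2" .
  qed measurable
  then show ?thesis by (simp add: nn_integral_density)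
qed


text \<open>Tensorization: for fixed last coordinates \<open>a\<close> and \<open>b\<close> the
  induction hypothesis integrates out the first \<open>n\<close> coordinates, and the resulting
  section integrals satisfy the hypothesis of the one-dimensional case.\<close>

lemma prekopa_leindler_std_gaussian:
  fixes u v w :: "(nat \<Rightarrow> real) \<Rightarrow> ennreal"
  assumes "u \<in> borel_measurable (std_gaussian n)" "v \<in> borel_measurable (std_gaussian n)"
    "w \<in> borel_measurable (std_gaussian n)"
    and "\<And>x y. x \<in> Rn n \<Longrightarrow> y \<in> Rn n \<Longrightarrow>
      u x * v y \<le> ennreal (exp ((\<Sum>i<n. (x i - y i)\<^sup>2) / 4)) * (w (\<lambda>i\<in>{..<n}. (x i + y i) / 2))\<^sup>2"
  shows "(\<integral>\<^sup>+x. u x \<partial>std_gaussian n) * (\<integral>\<^sup>+x. v x \<partial>std_gaussian n) \<le> (\<integral>\<^sup>+x. w x \<partial>std_gaussian n)\<^sup>2"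
  using assms
proof (induction n arbitrary: u v w)
  case 0
  have "(\<lambda>i\<in>{..<0::nat}. f i) = (\<lambda>_. undefined)" for f :: "nat \<Rightarrow> real" by auto
  with 0(4)[of "\<lambda>_. undefined" "\<lambda>_. undefined"] show ?case
    by (simp add: std_gaussian_def PiM_empty nn_integral_count_space_finite Rn_def)
next
  case (Suc n)
  let ?N = "density lborel std_normal_density"
  interpret product_sigma_finite "\<lambda>_::nat. ?N"
    by (intro product_sigma_finite.intro prob_space_imp_sigma_finite prob_space_normal_density) simp
  have ins: "{..<Suc n} = insert n {..<n}" by auto
  note meas [measurable] = Suc.prems(1-3)[unfolded std_gaussian_def ins]
  define sec where "sec f a = (\<integral>\<^sup>+x. f (x(n := a)) \<partial>std_gaussian n)"
    for f :: "(nat \<Rightarrow> real) \<Rightarrow> ennreal" and a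
  have sec_eq: "(\<integral>\<^sup>+x. f x \<partial>std_gaussian (Suc n)) = (\<integral>\<^sup>+a. sec f a \<partial>?N)"
    if "f \<in> borel_measurable (PiM (insert n {..<n}) (\<lambda>_. ?N))" for f
    using product_nn_integral_insert_rev[OF _ _ that] by (simp add: std_gaussian_def sec_def ins)
  have upd [measurable]: "(\<lambda>x. f (x(n := a))) \<in> borel_measurable (std_gaussian n)"
    if [measurable]: "f \<in> borel_measurable (PiM (insert n {..<n}) (\<lambda>_. ?N))"
    for f :: "(nat \<Rightarrow> real) \<Rightarrow> ennreal" and a
    unfolding std_gaussian_def by measurable
  interpret G: sigma_finite_measure "std_gaussian n"
    by (rule prob_space_imp_sigma_finite[OF prob_space_std_gaussian])
  have [measurable]: "sec f \<in> borel_measurable borel"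
    if [measurable]: "f \<in> borel_measurable (PiM (insert n {..<n}) (\<lambda>_. ?N))" for f
  proof -
    have "(\<lambda>(a, x). f (x(n := a))) \<in> borel_measurable (?N \<Otimes>\<^sub>M std_gaussian n)"
      unfolding std_gaussian_def by measurable
    from G.borel_measurable_nn_integral[OF this]
    show ?thesis by (simp add: sec_def[abs_def])
  qed
  have "(\<integral>\<^sup>+a. sec u a \<partial>?N) * (\<integral>\<^sup>+a. sec v a \<partial>?N) \<le> (\<integral>\<^sup>+a. sec w a \<partial>?N)\<^sup>2"
  proof (rule prekopa_leindler_std_normal)
    fix a b :: real
    \<comment> \<open>Half of the exponent \<open>(a - b)\<^sup>2 / 4\<close>, since this factor is
      placed inside the square.\<close>
    let ?e = "ennreal (exp ((a - b)\<^sup>2 / 8))"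
    have "sec u a * sec v b \<le> (\<integral>\<^sup>+x. ?e * w (x(n := (a + b) / 2)) \<partial>std_gaussian n)\<^sup>2"
      unfolding sec_def
    proof (rule Suc.IH)
      fix x y assume "x \<in> Rn n" "y \<in> Rn n"
      then have xy: "x(n := a) \<in> Rn (Suc n)" "y(n := b) \<in> Rn (Suc n)"
        by (auto simp: Rn_def PiE_iff extensional_def)
      have mid: "(\<lambda>i\<in>{..<Suc n}. ((x(n := a)) i + (y(n := b)) i) / 2) = (\<lambda>i\<in>{..<n}. (x i + y i) / 2)(n := (a + b) / 2)"
        by (rule ext) (auto simp: restrict_def less_Suc_eq)
      have sm: "(\<Sum>i<Suc n. ((x(n := a)) i - (y(n := b)) i)\<^sup>2) = (\<Sum>i<n. (x i - y i)\<^sup>2) + (a - b)\<^sup>2"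
        by simp
      have ex: "exp (((\<Sum>i<n. (x i - y i)\<^sup>2) + (a - b)\<^sup>2) / 4)
          = exp ((\<Sum>i<n. (x i - y i)\<^sup>2) / 4) * (exp ((a - b)\<^sup>2 / 8) * exp ((a - b)\<^sup>2 / 8))"
        by (simp only: exp_add[symmetric]) (simp add: field_simps)
      show "u (x(n := a)) * v (y(n := b)) \<le> ennreal (exp ((\<Sum>i<n. (x i - y i)\<^sup>2) / 4))
          * (?e * w ((\<lambda>i\<in>{..<n}. (x i + y i) / 2)(n := (a + b) / 2)))\<^sup>2"
        using Suc.prems(4)[OF xy]
        unfolding mid sm ex by (simp only: ennreal_mult exp_ge_zero mult_nonneg_nonneg power2_eq_square ac_simps)
    qed measurable
    also have "\<dots> = (?e * sec w ((a + b) / 2))\<^sup>2"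
      by (subst nn_integral_cmult) (simp_all add: sec_def upd)
    also have "\<dots> = ennreal (exp ((a - b)\<^sup>2 / 4)) * (sec w ((a + b) / 2))\<^sup>2"
    proof -
      have "(exp ((a - b)\<^sup>2 / 8))\<^sup>2 = exp ((a - b)\<^sup>2 / 4)"
        by (simp add: power2_eq_square exp_add[symmetric] del: exp_add) 
      then show ?thesis by (simp add: power_mult_distrib ennreal_power)
    qed
    finally show "sec u a * sec v b \<le> ennreal (exp ((a - b)\<^sup>2 / 4)) * (sec w ((a + b) / 2))\<^sup>2" .
  qed measurable
  then show ?case by (simp add: sec_eq)
qed

section \<open>The Poincare inequality for log-concave weights\<close>

definition l1 :: "nat \<Rightarrow> (nat \<Rightarrow> real) \<Rightarrow> real" where
  "l1 n x = (\<Sum>i<n. \<bar>x i\<bar>)"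

text \<open>A class of integrable functions that is closed under the operations used here. The l1
  norm is chosen because \<open>exp (a * l1 n x)\<close> factorizes over the coordinates. The bound
  is required for all \<open>x\<close>, not only on \<open>Rn n\<close>, so that it can be used at
  points such as \<open>\<lambda>_. 0\<close> and \<open>x(i := t)\<close>.\<close>

definition tame :: "nat \<Rightarrow> ((nat \<Rightarrow> real) \<Rightarrow> real) \<Rightarrow> bool" where
  "tame n f \<longleftrightarrow> f \<in> borel_measurable (std_gaussian n) \<and> (\<exists>C a. \<forall>x. \<bar>f x\<bar> \<le> C * exp (a * l1 n x))"

lemma l1_nonneg: "l1 n x \<ge> 0"
  by (simp add: l1_def sum_nonneg)

lemma measurable_std_gaussian_coord [measurable]:
  "i < n \<Longrightarrow> (\<lambda>x. x i) \<in> borel_measurable (std_gaussian n)"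
  unfolding std_gaussian_def
  using measurable_component_singleton[of i "{..<n}" "\<lambda>_. density lborel std_normal_density"]
  by simp

lemma measurable_l1 [measurable]: "l1 n \<in> borel_measurable (std_gaussian n)"
  unfolding l1_def[abs_def] by (intro borel_measurable_sum borel_measurable_abs measurable_std_gaussian_coord) auto

lemma measurable_dot [measurable]: "(\<lambda>x. dot n x t) \<in> borel_measurable (std_gaussian n)"
  unfolding dot_def by (intro borel_measurable_sum borel_measurable_times measurable_std_gaussian_coord) auto

lemma tameI:
  assumes "f \<in> borel_measurable (std_gaussian n)" "\<And>x. \<bar>f x\<bar> \<le> C * exp (a * l1 n x)"
  shows "tame n f"
  using assms unfolding tame_def by blast

lemma tameE:
  assumes "tame n f"
  obtains C a where "C \<ge> 0" "a \<ge> 0" "\<And>x. \<bar>f x\<bar> \<le> C * exp (a * l1 n x)"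
proof -
  obtain C a where Ca: "\<And>x. \<bar>f x\<bar> \<le> C * exp (a * l1 n x)" using assms unfolding tame_def by blast
  have "\<bar>f x\<bar> \<le> max C 0 * exp (max a 0 * l1 n x)" for x
    by (rule order_trans[OF Ca]) (intro mult_mono, auto intro!: mult_right_mono l1_nonneg)
  then show thesis using that[of "max C 0" "max a 0"] by simp
qed

lemma tame_measurable: "tame n f \<Longrightarrow> f \<in> borel_measurable (std_gaussian n)"
  by (simp add: tame_def)

lemma integrable_exp_abs_std_normal: "integrable (density lborel std_normal_density) (\<lambda>x. exp (a * \<bar>x\<bar>))"
proof -
  have eq: "std_normal_density x * exp (b * x) = exp (b\<^sup>2 / 2) * normal_density b 1 x" for b x :: real
    by (simp add: std_normal_density_def normal_density_def exp_add[symmetric] power2_eq_square field_simps)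
  have "integrable lborel (\<lambda>x. std_normal_density x * exp (b * x))" for b
    unfolding eq by simp
  then have int: "integrable (density lborel std_normal_density) (\<lambda>x. exp (b * x))" for b
    by (simp add: integrable_density)
  show ?thesis
  proof (rule Bochner_Integration.integrable_bound[OF Bochner_Integration.integrable_add[OF int[of a] int[of "-a"]]])
    show "AE x in density lborel std_normal_density. norm (exp (a * \<bar>x\<bar>)) \<le> norm (exp (a * x) + exp (- a * x))"
    proof (rule AE_I2)
      fix x
      have "\<bar>exp (a * x) + exp (- a * x)\<bar> = exp (a * x) + exp (- a * x)"
        by (intro abs_of_nonneg add_nonneg_nonneg) auto
      then show "norm (exp (a * \<bar>x\<bar>)) \<le> norm (exp (a * x) + exp (- a * x))"
        by (cases "x \<ge> 0") auto
    qed
  qed auto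
qed

lemma product_sigma_finite_std_normal:
  "product_sigma_finite (\<lambda>_::nat. density lborel std_normal_density)"
  by (intro product_sigma_finite.intro prob_space_imp_sigma_finite prob_space_normal_density) simp

lemma integrable_exp_l1: "integrable (std_gaussian n) (\<lambda>x. exp (a * l1 n x))"
proof -
  interpret product_sigma_finite "\<lambda>_::nat. density lborel std_normal_density"
    by (rule product_sigma_finite_std_normal)
  have "integrable (std_gaussian n) (\<lambda>x. \<Prod>i<n. exp (a * \<bar>x i\<bar>))"
    unfolding std_gaussian_def
    by (rule product_integrable_prod) (simp_all add: integrable_exp_abs_std_normal)
  then show ?thesis by (simp add: l1_def sum_distrib_left exp_sum)
qed

lemma tame_integrable: "tame n f \<Longrightarrow> integrable (std_gaussian n) f"
proof -
  assume f: "tame n f"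
  then obtain C a where C: "C \<ge> 0" "\<And>x. \<bar>f x\<bar> \<le> C * exp (a * l1 n x)" by (metis tameE)
  show ?thesis
  proof (rule Bochner_Integration.integrable_bound)
    show "integrable (std_gaussian n) (\<lambda>x. C * exp (a * l1 n x))"
      using integrable_exp_l1 by simp
    show "AE x in std_gaussian n. norm (f x) \<le> norm (C * exp (a * l1 n x))"
      using C by (intro AE_I2) simp
  qed (rule tame_measurable[OF f])
qed

lemma tame_mono:
  assumes "tame n g" "f \<in> borel_measurable (std_gaussian n)" "\<And>x. \<bar>f x\<bar> \<le> \<bar>g x\<bar>"
  shows "tame n f"
  using assms unfolding tame_def by (meson order_trans)

lemma tame_const [simp]: "tame n (\<lambda>x. c)"
  by (rule tameI[where C="\<bar>c\<bar>" and a=0]) auto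

lemma integrable_std_gaussian_const [simp]: "integrable (std_gaussian n) (\<lambda>x. c :: real)"
  by (rule tame_integrable) simp

lemma tame_add [intro]:
  assumes "tame n f" "tame n g"
  shows "tame n (\<lambda>x. f x + g x)"
proof -
  obtain C a where C: "C \<ge> 0" "a \<ge> 0" "\<And>x. \<bar>f x\<bar> \<le> C * exp (a * l1 n x)" using assms(1) by (metis tameE)
  obtain D b where D: "D \<ge> 0" "b \<ge> 0" "\<And>x. \<bar>g x\<bar> \<le> D * exp (b * l1 n x)" using assms(2) by (metis tameE)
  show ?thesis
  proof (rule tameI[where C="C + D" and a="a + b"])
    fix x
    have "C * exp (a * l1 n x) \<le> C * exp ((a + b) * l1 n x)" "D * exp (b * l1 n x) \<le> D * exp ((a + b) * l1 n x)"
      using C D l1_nonneg[of n x] by (auto intro!: mult_left_mono mult_right_mono)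
    then show "\<bar>f x + g x\<bar> \<le> (C + D) * exp ((a + b) * l1 n x)"
      using C(3)[of x] D(3)[of x] by (simp add: algebra_simps)
  qed (use assms in \<open>auto simp: tame_def\<close>)
qed

lemma tame_mult [intro]:
  assumes "tame n f" "tame n g"
  shows "tame n (\<lambda>x. f x * g x)"
proof -
  obtain C a where C: "C \<ge> 0" "a \<ge> 0" "\<And>x. \<bar>f x\<bar> \<le> C * exp (a * l1 n x)" using assms(1) by (metis tameE)
  obtain D b where D: "D \<ge> 0" "b \<ge> 0" "\<And>x. \<bar>g x\<bar> \<le> D * exp (b * l1 n x)" using assms(2) by (metis tameE)
  show ?thesis
  proof (rule tameI[where C="C * D" and a="a + b"])
    fix x
    have "\<bar>f x * g x\<bar> \<le> (C * exp (a * l1 n x)) * (D * exp (b * l1 n x))"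
      unfolding abs_mult using C D by (intro mult_mono) auto
    then show "\<bar>f x * g x\<bar> \<le> (C * D) * exp ((a + b) * l1 n x)"
      by (simp add: distrib_right exp_add mult.assoc mult.left_commute)
  qed (use assms in \<open>auto simp: tame_def\<close>)
qed

lemma tame_uminus [intro]: "tame n f \<Longrightarrow> tame n (\<lambda>x. - f x)"
  using tame_mult[OF tame_const[of n "-1"]] by simp

lemma tame_diff [intro]: "tame n f \<Longrightarrow> tame n g \<Longrightarrow> tame n (\<lambda>x. f x - g x)"
  using tame_add[OF _ tame_uminus] by simp

lemma tame_divide [intro]: "tame n f \<Longrightarrow> tame n (\<lambda>x. f x / c)"
  using tame_mult[OF tame_const[of n "1 / c"]] by simp

lemma tame_power [intro]: "tame n f \<Longrightarrow> tame n (\<lambda>x. f x ^ k)"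
  by (induction k) (auto intro: tame_mult)

lemma tame_sum [intro]: "(\<And>i. i \<in> I \<Longrightarrow> tame n (f i)) \<Longrightarrow> tame n (\<lambda>x. \<Sum>i\<in>I. f i x)"
  by (induction I rule: infinite_finite_induct) (auto intro: tame_add)

lemma tame_abs [intro]: "tame n f \<Longrightarrow> tame n (\<lambda>x. \<bar>f x\<bar>)"
  by (rule tame_mono[of n f]) (auto simp: tame_def)

lemma tame_l1 [intro, simp]: "tame n (l1 n)"
proof (rule tameI[where C=1 and a=1])
  show "\<bar>l1 n x\<bar> \<le> 1 * exp (1 * l1 n x)" for x
    using exp_ge_add_one_self[of "l1 n x"] l1_nonneg[of n x] by (simp only: abs_of_nonneg mult_1)
qed measurable

lemma tame_exp_l1 [intro, simp]: "tame n (\<lambda>x. exp (a * l1 n x))"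
  by (rule tameI[where C=1 and a=a]) auto

lemma abs_coord_le_l1: "i < n \<Longrightarrow> \<bar>x i\<bar> \<le> l1 n x"
  unfolding l1_def by (rule member_le_sum) auto

lemma tame_coord [intro]: "i < n \<Longrightarrow> tame n (\<lambda>x. x i)"
  by (rule tame_mono[OF tame_l1]) (auto simp: abs_coord_le_l1 l1_nonneg)

lemma tame_dot [intro, simp]: "tame n (\<lambda>x. dot n x t)"
  unfolding dot_def by (intro tame_sum tame_mult tame_coord) auto

section \<open>The L2 norm of tame functions\<close>

text \<open>Real-valued companion of \<open>L2_norm\<close>, open to linear arithmetic. A function
  that is not square integrable would get the value 0, hence the comparisons of norms assume
  \<open>tame\<close>. \<open>L2_norm_eq_l2\<close> translates back at the end.\<close>

definition l2 :: "nat \<Rightarrow> ((nat \<Rightarrow> real) \<Rightarrow> real) \<Rightarrow> real" where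
  "l2 n f = sqrt (\<integral>x. (f x)\<^sup>2 \<partial>std_gaussian n)"

lemma integral_mono_tame:
  "tame n f \<Longrightarrow> tame n g \<Longrightarrow> (\<And>x. f x \<le> g x) \<Longrightarrow>
    (\<integral>x. f x \<partial>std_gaussian n) \<le> (\<integral>x. g x \<partial>std_gaussian n)"
  by (intro integral_mono tame_integrable)

lemma l2_nonneg: "l2 n f \<ge> 0"
  by (simp add: l2_def)

lemma l2_power2: "(l2 n f)\<^sup>2 = (\<integral>x. (f x)\<^sup>2 \<partial>std_gaussian n)"
  by (simp add: l2_def)

lemma l2_leI: "(\<integral>x. (f x)\<^sup>2 \<partial>std_gaussian n) \<le> r\<^sup>2 \<Longrightarrow> r \<ge> 0 \<Longrightarrow> l2 n f \<le> r"
  unfolding l2_def by (rule real_le_lsqrt) auto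

lemma l2_mono:
  assumes "tame n f" "tame n g" "\<And>x. \<bar>f x\<bar> \<le> \<bar>g x\<bar>"
  shows "l2 n f \<le> l2 n g"
  unfolding l2_def using assms
  by (intro real_sqrt_le_mono integral_mono_tame tame_power) (auto simp: abs_le_square_iff)

lemma std_gaussian_prob [simp]: "measure (std_gaussian n) (space (std_gaussian n)) = 1"
  using prob_space.prob_space[OF prob_space_std_gaussian] .

lemma l2_const [simp]: "l2 n (\<lambda>x. c) = \<bar>c\<bar>"
  by (simp add: l2_def)

lemma l2_cmult: "l2 n (\<lambda>x. c * f x) = \<bar>c\<bar> * l2 n f"
  by (simp add: l2_def power_mult_distrib real_sqrt_mult)

lemma l2_triangle:
  assumes f: "tame n f" and g: "tame n g"
  shows "l2 n (\<lambda>x. f x + g x) \<le> l2 n f + l2 n g"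
proof (rule l2_leI)
  let ?A = "l2 n f" and ?B = "l2 n g"
  have A: "?A \<ge> 0" "?B \<ge> 0" by (simp_all add: l2_nonneg)
  show "(\<integral>x. (f x + g x)\<^sup>2 \<partial>std_gaussian n) \<le> (?A + ?B)\<^sup>2"
  proof (rule field_le_epsilon)
    fix e :: real assume e: "e > 0"
    define d where "d = e / (?A + ?B + 1)"
    have d: "d > 0" "d * (?A + ?B) \<le> e" using e A by (auto simp: d_def field_simps)
    \<comment> \<open>The optimal \<open>t\<close> in the weighted inequality below is the ratio of
      the two norms. Adding \<open>d\<close> to both keeps it positive and finite even when a norm
      is 0, and costs at most \<open>e\<close>.\<close>
    define t where "t = (?B + d) / (?A + d)"
    have t: "t > 0" using d A by (simp add: t_def)
    have pt: "(f x + g x)\<^sup>2 \<le> (1 + t) * (f x)\<^sup>2 + (1 + 1 / t) * (g x)\<^sup>2" for x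
    proof -
      have "0 \<le> (t * f x - g x)\<^sup>2 / t" using t by simp
      also have "\<dots> = t * (f x)\<^sup>2 + (1 / t) * (g x)\<^sup>2 - 2 * f x * g x"
        using t by (simp add: power2_eq_square field_simps)
      finally show ?thesis by (simp add: power2_eq_square algebra_simps)
    qed
    have "(\<integral>x. (f x + g x)\<^sup>2 \<partial>std_gaussian n) \<le> (\<integral>x. (1 + t) * (f x)\<^sup>2 + (1 + 1 / t) * (g x)\<^sup>2 \<partial>std_gaussian n)"
      by (intro integral_mono_tame tame_add tame_mult tame_power tame_const f g pt)
    also have "\<dots> = (1 + t) * ?A\<^sup>2 + (1 + 1 / t) * ?B\<^sup>2"
      by (simp add: l2_power2 tame_integrable tame_power f g)
    also have "t * ?A\<^sup>2 \<le> ?A * (?B + d)"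
    proof -
      have "t * ?A\<^sup>2 = ?A * (?B + d) * (?A / (?A + d))" by (simp add: t_def power2_eq_square)
      also have "\<dots> \<le> ?A * (?B + d) * 1" using A d by (intro mult_left_mono) auto
      finally show ?thesis by simp
    qed
    moreover have "(1 / t) * ?B\<^sup>2 \<le> ?B * (?A + d)"
    proof -
      have "(1 / t) * ?B\<^sup>2 = ?B * (?A + d) * (?B / (?B + d))" by (simp add: t_def power2_eq_square)
      also have "\<dots> \<le> ?B * (?A + d) * 1" using A d by (intro mult_left_mono) auto
      finally show ?thesis by simp
    qed
    ultimately show "(\<integral>x. (f x + g x)\<^sup>2 \<partial>std_gaussian n) \<le> (?A + ?B)\<^sup>2 + e"
      using d(2) by (simp add: power2_eq_square algebra_simps)
  qed
qed (simp add: l2_nonneg)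

lemma l2_diff_triangle:
  assumes "tame n f" "tame n g" "tame n h"
  shows "l2 n (\<lambda>x. f x - h x) \<le> l2 n (\<lambda>x. f x - g x) + l2 n (\<lambda>x. g x - h x)"
  using l2_triangle[of n "\<lambda>x. f x - g x" "\<lambda>x. g x - h x"] assms by (simp add: tame_diff)

lemma l2_diff_commute: "l2 n (\<lambda>x. f x - g x) = l2 n (\<lambda>x. g x - f x)"
  by (simp add: l2_def power2_commute)

lemma abs_integral_le_l2:
  assumes f: "tame n f"
  shows "\<bar>\<integral>x. f x \<partial>std_gaussian n\<bar> \<le> l2 n f"
proof -
  let ?m = "\<integral>x. f x \<partial>std_gaussian n"
  have "0 \<le> (\<integral>x. (f x - ?m)\<^sup>2 \<partial>std_gaussian n)" by simp
  also have "\<dots> = (\<integral>x. (f x)\<^sup>2 + (?m\<^sup>2 - 2 * ?m * f x) \<partial>std_gaussian n)"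
    by (intro Bochner_Integration.integral_cong) (auto simp: power2_eq_square algebra_simps)
  also have "\<dots> = (l2 n f)\<^sup>2 - ?m\<^sup>2"
    using tame_integrable[OF tame_power[OF f, of 2]] tame_integrable[OF f]
    by (simp add: l2_power2) (simp add: power2_eq_square)
  finally show ?thesis using l2_nonneg[of n f] by (simp add: abs_le_square_iff[symmetric])
qed

section \<open>Second-order expansion of the Prekopa--Leindler inequality\<close>

text \<open>The Taylor remainder after an odd degree is an even power times a positive factor, so
  the bound holds for both signs of \<open>y\<close>.\<close>

lemma exp_lower_cubic: "1 + y + y\<^sup>2 / 2 + y ^ 3 / 6 \<le> exp (y::real)"
proof -
  obtain t where "exp y = (\<Sum>m<4. (y ^ m) / fact m) + (exp t / fact 4) * y ^ 4"
    using Maclaurin_exp_le[of y 4] by blast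
  moreover have "(exp t / fact 4) * y ^ 4 \<ge> 0" by simp
  moreover have "(\<Sum>m<4. (y ^ m) / fact m) = 1 + y + y\<^sup>2 / 2 + y ^ 3 / 6"
    by (simp add: numeral_eq_Suc fact_numeral)
  ultimately show ?thesis by linarith
qed

text \<open>\<open>ennreal\<close> sends negative values to 0, which can only raise the right-hand
  side. It is applied to polynomial lower bounds of exponentials, which may be negative.\<close>

lemma ennreal_integral_le_nn_integral:
  assumes "integrable M f"
  shows "ennreal (\<integral>x. f x \<partial>M) \<le> (\<integral>\<^sup>+x. ennreal (f x) \<partial>M)"
proof -
  have i: "integrable M (\<lambda>x. max 0 (f x))" using assms by simp
  have "(\<integral>x. f x \<partial>M) \<le> (\<integral>x. max 0 (f x) \<partial>M)"
    by (intro integral_mono assms i) auto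
  then have "ennreal (\<integral>x. f x \<partial>M) \<le> ennreal (\<integral>x. max 0 (f x) \<partial>M)" by (rule ennreal_leI)
  also have "\<dots> = (\<integral>\<^sup>+x. ennreal (max 0 (f x)) \<partial>M)"
    by (rule nn_integral_eq_integral[symmetric, OF i]) simp
  also have "\<dots> = (\<integral>\<^sup>+x. ennreal (f x) \<partial>M)"
    by (intro nn_integral_cong) (simp add: max_def ennreal_neg)
  finally show ?thesis .
qed

text \<open>The error is polynomial in \<open>h\<close> and \<open>q\<close> and so tame whenever
  they are, whereas \<open>exp (\<theta> * h)\<close> need not be integrable for a tame
  \<open>h\<close>. A lower bound is the right direction, because Prekopa--Leindler bounds the
  integrals of the perturbed weights from above.\<close>

lemma exp_perturbation_lower:
  fixes h q \<kappa> \<theta> :: real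
  assumes "q \<ge> 0" "\<kappa> \<ge> 0" "0 < \<theta>" "\<theta> \<le> 1"
  shows "1 + \<theta> * h + \<theta>\<^sup>2 * (h\<^sup>2 / 2 - \<kappa> * q) - \<theta> ^ 3 * ((\<bar>h\<bar> + \<kappa> * q)\<^sup>2 + (\<bar>h\<bar> + \<kappa> * q) ^ 3)
      \<le> exp (\<theta> * h - \<kappa> * \<theta>\<^sup>2 * q)"
proof -
  define k where "k = \<bar>h\<bar> + \<kappa> * q"
  define y where "y = \<theta> * h - \<kappa> * \<theta>\<^sup>2 * q"
  have k0: "k \<ge> 0" "\<kappa> * q \<ge> 0" using assms by (auto simp: k_def)
  have "\<bar>y\<bar> \<le> \<theta> * k"
  proof -
    have "\<bar>y\<bar> \<le> \<bar>\<theta> * h\<bar> + \<bar>\<kappa> * \<theta>\<^sup>2 * q\<bar>" unfolding y_def by (rule abs_triangle_ineq4)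
    also have "\<dots> = \<theta> * \<bar>h\<bar> + \<theta>\<^sup>2 * (\<kappa> * q)" using assms by (simp add: abs_mult ac_simps)
    also have "\<theta>\<^sup>2 * (\<kappa> * q) \<le> \<theta> * (\<kappa> * q)"
      using assms k0 by (intro mult_right_mono) (auto simp: power2_eq_square mult_left_le)
    finally show ?thesis by (simp add: k_def distrib_left)
  qed
  then have "\<bar>y\<bar> ^ 3 \<le> (\<theta> * k) ^ 3" by (intro power_mono) auto
  moreover have "- (\<bar>y\<bar> ^ 3) \<le> y ^ 3"
    by (metis abs_ge_minus_self minus_le_iff power_abs)
  ultimately have y3: "- (\<theta> ^ 3 * k ^ 3) \<le> y ^ 3" by (simp add: power_mult_distrib)
  have hq: "h * (\<kappa> * q) \<le> k\<^sup>2"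
  proof -
    have "h * (\<kappa> * q) \<le> k * k" using k0 abs_ge_self[of h] by (intro mult_mono) (auto simp: k_def simp del: abs_ge_self)
    then show ?thesis by (simp add: power2_eq_square)
  qed
  have y2_eq: "y\<^sup>2 = \<theta>\<^sup>2 * h\<^sup>2 - 2 * (\<theta> ^ 3 * (h * (\<kappa> * q))) + (\<kappa> * \<theta>\<^sup>2 * q)\<^sup>2"
    by (simp add: y_def power2_eq_square power3_eq_cube algebra_simps)
  moreover have "\<theta> ^ 3 * (h * (\<kappa> * q)) \<le> \<theta> ^ 3 * k\<^sup>2"
    using hq assms by (intro mult_left_mono) auto
  ultimately have y2: "y\<^sup>2 / 2 \<ge> \<theta>\<^sup>2 * h\<^sup>2 / 2 - \<theta> ^ 3 * k\<^sup>2"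
    using zero_le_power2[of "\<kappa> * \<theta>\<^sup>2 * q"] by linarith
  have "\<theta> ^ 3 * k ^ 3 \<ge> 0" using assms k0 by simp
  then have "1 + \<theta> * h + \<theta>\<^sup>2 * (h\<^sup>2 / 2 - \<kappa> * q) - \<theta> ^ 3 * (k\<^sup>2 + k ^ 3) \<le> 1 + y + y\<^sup>2 / 2 + y ^ 3 / 6"
    using y2 y3 by (simp add: y_def algebra_simps)
  also have "\<dots> \<le> exp y" by (rule exp_lower_cubic)
  finally show ?thesis by (simp add: k_def y_def)
qed


text \<open>The first-order terms have opposite signs, so orders 0 and 1 cancel. The leading
  coefficient \<open>(m + d) * Z - a\<^sup>2\<close> becomes the deficit in the Poincare
  inequality.\<close>

lemma second_order_product:
  fixes Z t a m E d :: real
  shows "(Z + t * a + t\<^sup>2 * m - t ^ 3 * E) * (Z - t * a + t\<^sup>2 * d - t ^ 3 * E) - Z\<^sup>2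
    = t\<^sup>2 * ((m + d) * Z - a\<^sup>2 + t * (a * d - a * m - 2 * Z * E) + t\<^sup>2 * (m * d)
        - t ^ 3 * ((m + d) * E) + t ^ 4 * E\<^sup>2)"
  by algebra

text \<open>Prekopa--Leindler is applied to \<open>\<rho> * exp (\<theta> * h - \<kappa> *
  \<theta>\<^sup>2 * q)\<close>, \<open>\<rho> * exp (- (\<theta> * h))\<close> and
  \<open>\<rho>\<close>, and the result is compared to second order as \<open>\<theta>\<close> tends
  to 0. By \<open>sc\<close>, \<open>h\<close> is convex up to a quadratic with \<open>D\<close> as
  generalized gradient; this is what admits differences of soft maxima.\<close>

lemma poincare_ineq_aux:
  fixes \<rho> h q :: "(nat \<Rightarrow> real) \<Rightarrow> real" and D :: "(nat \<Rightarrow> real) \<Rightarrow> nat \<Rightarrow> real"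
  assumes \<rho>: "tame n \<rho>" "\<And>x. \<rho> x \<ge> 0" "(\<integral>x. \<rho> x \<partial>std_gaussian n) > 0"
    and lc: "\<And>x y. \<rho> x * \<rho> y \<le> (\<rho> (\<lambda>i\<in>{..<n}. (x i + y i) / 2))\<^sup>2"
    and h: "tame n h" and q: "tame n (\<lambda>x. \<Sum>i<n. (D x i)\<^sup>2)"
    and sc: "\<And>x y. h x + (\<Sum>i<n. D x i * (y i - x i)) - L * (\<Sum>i<n. (y i - x i)\<^sup>2) \<le> h y"
    and L: "L \<ge> 0" and \<kappa>: "\<kappa> > 1"
  shows "(\<integral>x. \<rho> x \<partial>std_gaussian n) * (\<integral>x. \<rho> x * (h x)\<^sup>2 \<partial>std_gaussian n) - (\<integral>x. \<rho> x * h x \<partial>std_gaussian n)\<^sup>2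
    \<le> \<kappa> * ((\<integral>x. \<rho> x \<partial>std_gaussian n) * (\<integral>x. \<rho> x * (\<Sum>i<n. (D x i)\<^sup>2) \<partial>std_gaussian n))"
proof -
  let ?M = "std_gaussian n"
  define q where "q x = (\<Sum>i<n. (D x i)\<^sup>2)" for x
  have q0: "q x \<ge> 0" for x by (simp add: q_def sum_nonneg)
  have qt: "tame n q" using q by (simp add: q_def[abs_def])
  note [measurable] = tame_measurable[OF \<rho>(1)] tame_measurable[OF h] tame_measurable[OF qt]
  define R where "R x = (\<bar>h x\<bar> + \<kappa> * q x)\<^sup>2 + (\<bar>h x\<bar> + \<kappa> * q x) ^ 3" for x
  have Rt: "tame n R" unfolding R_def[abs_def] by (intro tame_add tame_power tame_abs tame_mult tame_const h qt)
  define Z a c Q E where "Z = (\<integral>x. \<rho> x \<partial>?M)" and "a = (\<integral>x. \<rho> x * h x \<partial>?M)"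
    and "c = (\<integral>x. \<rho> x * (h x)\<^sup>2 \<partial>?M)" and "Q = (\<integral>x. \<rho> x * q x \<partial>?M)"
    and "E = (\<integral>x. \<rho> x * R x \<partial>?M)"
  have ints [simp]: "integrable ?M \<rho>" "integrable ?M (\<lambda>x. \<rho> x * h x)" "integrable ?M (\<lambda>x. \<rho> x * (h x)\<^sup>2)"
    "integrable ?M (\<lambda>x. \<rho> x * q x)" "integrable ?M (\<lambda>x. \<rho> x * R x)"
    using \<rho>(1) h qt Rt by (auto intro!: tame_integrable tame_mult tame_power)
  define \<alpha> \<beta> where "\<alpha> \<theta> = Z + \<theta> * a + \<theta>\<^sup>2 * (c / 2 - \<kappa> * Q) - \<theta> ^ 3 * E"
    and "\<beta> \<theta> = Z - \<theta> * a + \<theta>\<^sup>2 * (c / 2) - \<theta> ^ 3 * E" for \<theta>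
  have main: "\<alpha> \<theta> * \<beta> \<theta> \<le> Z\<^sup>2"
    if \<theta>: "0 < \<theta>" "\<theta> \<le> 1" "\<theta> * L + 1 / (4 * \<kappa>) \<le> 1 / 4" and pos: "\<alpha> \<theta> > 0" "\<beta> \<theta> > 0" for \<theta>
  proof -
    define u v where "u x = ennreal (\<rho> x * exp (\<theta> * h x - \<kappa> * \<theta>\<^sup>2 * q x))"
      and "v x = ennreal (\<rho> x * exp (- (\<theta> * h x)))" for x
    have [measurable]: "u \<in> borel_measurable ?M" "v \<in> borel_measurable ?M"
      unfolding u_def v_def by measurable
    have "(\<integral>\<^sup>+x. u x \<partial>?M) * (\<integral>\<^sup>+x. v x \<partial>?M) \<le> (\<integral>\<^sup>+x. ennreal (\<rho> x) \<partial>?M)\<^sup>2"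
    proof (rule prekopa_leindler_std_gaussian)
      fix x y :: "nat \<Rightarrow> real"
      let ?d = "\<Sum>i<n. (y i - x i)\<^sup>2"
      \<comment> \<open>Young's inequality with parameter \<open>\<kappa> > 1\<close> uses only
        \<open>?d / (4 * \<kappa>)\<close> of the available \<open>?d / 4\<close>. The remainder
        absorbs \<open>\<theta> * L * ?d\<close> once \<open>\<theta>\<close> is small.\<close>
      have "- (\<theta> * (\<Sum>i<n. D x i * (y i - x i))) \<le> (\<Sum>i<n. \<kappa> * \<theta>\<^sup>2 * (D x i)\<^sup>2 + (y i - x i)\<^sup>2 / (4 * \<kappa>))"
        unfolding sum_distrib_left sum_negf[symmetric]
      proof (rule sum_mono)
        fix i
        have "0 \<le> \<kappa> * (\<theta> * D x i + (y i - x i) / (2 * \<kappa>))\<^sup>2" using \<kappa> by simp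
        also have "\<dots> = \<kappa> * \<theta>\<^sup>2 * (D x i)\<^sup>2 + (y i - x i)\<^sup>2 / (4 * \<kappa>) + \<theta> * (D x i * (y i - x i))"
          using \<kappa> by (simp add: power2_eq_square field_simps)
        finally show "- (\<theta> * (D x i * (y i - x i))) \<le> \<kappa> * \<theta>\<^sup>2 * (D x i)\<^sup>2 + (y i - x i)\<^sup>2 / (4 * \<kappa>)" by simp
      qed
      also have "\<dots> = \<kappa> * \<theta>\<^sup>2 * q x + ?d / (4 * \<kappa>)"
        by (simp add: q_def sum.distrib sum_distrib_left sum_divide_distrib)
      finally have "- (\<theta> * (\<Sum>i<n. D x i * (y i - x i))) \<le> \<kappa> * \<theta>\<^sup>2 * q x + ?d / (4 * \<kappa>)" .
      moreover have "\<theta> * (h x - h y) \<le> \<theta> * (L * ?d - (\<Sum>i<n. D x i * (y i - x i)))"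
        using sc[of x y] \<theta> by (intro mult_left_mono) auto
      moreover have "(\<theta> * L + 1 / (4 * \<kappa>)) * ?d \<le> 1 / 4 * ?d"
        using \<theta> by (intro mult_right_mono) (auto intro: sum_nonneg)
      ultimately have "\<theta> * h x - \<kappa> * \<theta>\<^sup>2 * q x - \<theta> * h y \<le> ?d / 4"
        by (simp add: algebra_simps)
      then have ex: "exp (\<theta> * h x - \<kappa> * \<theta>\<^sup>2 * q x) * exp (- (\<theta> * h y)) \<le> exp ((\<Sum>i<n. (x i - y i)\<^sup>2) / 4)"
        by (simp add: exp_add[symmetric] power2_commute)
      have "u x * v y = ennreal ((\<rho> x * \<rho> y) * (exp (\<theta> * h x - \<kappa> * \<theta>\<^sup>2 * q x) * exp (- (\<theta> * h y))))"
        using \<rho>(2) by (simp add: u_def v_def ennreal_mult[symmetric] ac_simps)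
      also have "\<dots> \<le> ennreal ((\<rho> (\<lambda>i\<in>{..<n}. (x i + y i) / 2))\<^sup>2 * exp ((\<Sum>i<n. (x i - y i)\<^sup>2) / 4))"
        by (intro ennreal_leI mult_mono lc ex) auto
      also have "\<dots> = ennreal (exp ((\<Sum>i<n. (x i - y i)\<^sup>2) / 4)) * (ennreal (\<rho> (\<lambda>i\<in>{..<n}. (x i + y i) / 2)))\<^sup>2"
        using \<rho>(2) by (simp add: ennreal_mult ennreal_power mult.commute)
      finally show "u x * v y \<le> \<dots>" .
    qed measurable
    also have "(\<integral>\<^sup>+x. ennreal (\<rho> x) \<partial>?M) = ennreal Z"
      unfolding Z_def by (rule nn_integral_eq_integral) (use \<rho> in auto)
    finally have uv: "(\<integral>\<^sup>+x. u x \<partial>?M) * (\<integral>\<^sup>+x. v x \<partial>?M) \<le> (ennreal Z)\<^sup>2" .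
    have "ennreal (\<alpha> \<theta>) \<le> (\<integral>\<^sup>+x. u x \<partial>?M)"
    proof -
      define f where "f x = \<rho> x + \<theta> * (\<rho> x * h x) + (\<theta>\<^sup>2 / 2) * (\<rho> x * (h x)\<^sup>2)
        - (\<theta>\<^sup>2 * \<kappa>) * (\<rho> x * q x) - \<theta> ^ 3 * (\<rho> x * R x)" for x
      have int: "integrable ?M f"
        unfolding f_def by (intro Bochner_Integration.integrable_add
            Bochner_Integration.integrable_diff integrable_mult_right ints)
      have "(\<integral>x. f x \<partial>?M) = Z + \<theta> * a + (\<theta>\<^sup>2 / 2) * c - (\<theta>\<^sup>2 * \<kappa>) * Q - \<theta> ^ 3 * E"
        unfolding f_def Z_def a_def c_def Q_def E_def
        by (simp only: ints Bochner_Integration.integral_add Bochner_Integration.integral_diff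
            Bochner_Integration.integrable_add Bochner_Integration.integrable_diff
            integrable_mult_right integral_mult_right_zero)
      also have "\<dots> = \<alpha> \<theta>" by (simp add: \<alpha>_def algebra_simps)
      finally have "\<alpha> \<theta> = (\<integral>x. f x \<partial>?M)" ..
      also have "ennreal \<dots> \<le> (\<integral>\<^sup>+x. ennreal (f x) \<partial>?M)"
        by (rule ennreal_integral_le_nn_integral[OF int])
      also have "\<dots> \<le> (\<integral>\<^sup>+x. u x \<partial>?M)"
      proof (rule nn_integral_mono)
        fix x
        have "f x = \<rho> x * (1 + \<theta> * h x + \<theta>\<^sup>2 * ((h x)\<^sup>2 / 2 - \<kappa> * q x) - \<theta> ^ 3 * R x)"
          by (simp add: f_def algebra_simps)
        also have "\<dots> \<le> \<rho> x * exp (\<theta> * h x - \<kappa> * \<theta>\<^sup>2 * q x)"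
          using exp_perturbation_lower[OF q0, of \<kappa> \<theta> "h x" x] \<theta> \<kappa>
          by (intro mult_left_mono \<rho>(2)) (simp add: R_def)
        finally show "ennreal (f x) \<le> u x" unfolding u_def by (rule ennreal_leI)
      qed
      finally show ?thesis .
    qed
    moreover have "ennreal (\<beta> \<theta>) \<le> (\<integral>\<^sup>+x. v x \<partial>?M)"
    proof -
      define f where "f x = \<rho> x - \<theta> * (\<rho> x * h x) + (\<theta>\<^sup>2 / 2) * (\<rho> x * (h x)\<^sup>2) - \<theta> ^ 3 * (\<rho> x * R x)" for x
      have int: "integrable ?M f"
        unfolding f_def by (intro Bochner_Integration.integrable_add
            Bochner_Integration.integrable_diff integrable_mult_right ints)
      have "(\<integral>x. f x \<partial>?M) = Z - \<theta> * a + (\<theta>\<^sup>2 / 2) * c - \<theta> ^ 3 * E"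
        unfolding f_def Z_def a_def c_def Q_def E_def
        by (simp only: ints Bochner_Integration.integral_add Bochner_Integration.integral_diff
            Bochner_Integration.integrable_add Bochner_Integration.integrable_diff
            integrable_mult_right integral_mult_right_zero)
      also have "\<dots> = \<beta> \<theta>" by (simp add: \<beta>_def)
      finally have "\<beta> \<theta> = (\<integral>x. f x \<partial>?M)" ..
      also have "ennreal \<dots> \<le> (\<integral>\<^sup>+x. ennreal (f x) \<partial>?M)"
        by (rule ennreal_integral_le_nn_integral[OF int])
      also have "\<dots> \<le> (\<integral>\<^sup>+x. v x \<partial>?M)"
      proof (rule nn_integral_mono)
        fix x
        have "\<bar>h x\<bar>\<^sup>2 + \<bar>h x\<bar> ^ 3 \<le> R x"
          unfolding R_def using q0[of x] \<kappa> by (intro add_mono power_mono) auto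
        then have R3: "\<theta> ^ 3 * (\<bar>h x\<bar>\<^sup>2 + \<bar>h x\<bar> ^ 3) \<le> \<theta> ^ 3 * R x"
          using \<theta> by (intro mult_left_mono) auto
        have "1 - \<theta> * h x + \<theta>\<^sup>2 * ((h x)\<^sup>2 / 2) - \<theta> ^ 3 * (\<bar>h x\<bar>\<^sup>2 + \<bar>h x\<bar> ^ 3) \<le> exp (- (\<theta> * h x))"
          using exp_perturbation_lower[of 0 \<kappa> \<theta> "- h x"] \<theta> \<kappa> by simp
        with R3 have le: "1 - \<theta> * h x + \<theta>\<^sup>2 * ((h x)\<^sup>2 / 2) - \<theta> ^ 3 * R x \<le> exp (- (\<theta> * h x))"
          by linarith
        have "f x = \<rho> x * (1 - \<theta> * h x + \<theta>\<^sup>2 * ((h x)\<^sup>2 / 2) - \<theta> ^ 3 * R x)"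
          by (simp add: f_def algebra_simps)
        also have "\<dots> \<le> \<rho> x * exp (- (\<theta> * h x))"
          by (intro mult_left_mono \<rho>(2) le)
        finally show "ennreal (f x) \<le> v x" unfolding v_def by (rule ennreal_leI)
      qed
      finally show ?thesis .
    qed
    ultimately have "ennreal (\<alpha> \<theta>) * ennreal (\<beta> \<theta>) \<le> (ennreal Z)\<^sup>2"
      using uv by (meson mult_mono' order_trans zero_le)
    then show ?thesis using pos \<rho>(3) by (simp add: ennreal_mult[symmetric] ennreal_power Z_def)
  qed
  define m c2 where "m = c / 2 - \<kappa> * Q" and "c2 = c / 2"
  define X where "X = (m + c2) * Z - a\<^sup>2"
  define P where "P \<theta> = X + \<theta> * (a * c2 - a * m - 2 * Z * E) + \<theta>\<^sup>2 * (m * c2)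
      - \<theta> ^ 3 * ((m + c2) * E) + \<theta> ^ 4 * E\<^sup>2" for \<theta>
  have P: "\<alpha> \<theta> * \<beta> \<theta> - Z\<^sup>2 = \<theta>\<^sup>2 * P \<theta>" for \<theta>
    using second_order_product[of Z \<theta> a m E c2] unfolding \<alpha>_def \<beta>_def P_def X_def m_def c2_def .
  have Z: "Z > 0" using \<rho>(3) by (simp add: Z_def)
  have lim\<alpha>: "(\<alpha> \<longlongrightarrow> Z + 0 * a + 0\<^sup>2 * (c / 2 - \<kappa> * Q) - 0 ^ 3 * E) (at_right 0)"
    unfolding \<alpha>_def[abs_def] by (intro tendsto_intros)
  have lim\<beta>: "(\<beta> \<longlongrightarrow> Z - 0 * a + 0\<^sup>2 * (c / 2) - 0 ^ 3 * E) (at_right 0)"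
    unfolding \<beta>_def[abs_def] by (intro tendsto_intros)
  have ev1: "\<forall>\<^sub>F \<theta> in at_right 0. \<alpha> \<theta> > 0" "\<forall>\<^sub>F \<theta> in at_right 0. \<beta> \<theta> > 0"
    using order_tendstoD(1)[OF lim\<alpha>, of 0] order_tendstoD(1)[OF lim\<beta>, of 0] Z by auto
  have "((\<lambda>\<theta>. \<theta> * L + 1 / (4 * \<kappa>)) \<longlongrightarrow> 0 * L + 1 / (4 * \<kappa>)) (at_right 0)"
    by (intro tendsto_intros)
  from order_tendstoD(2)[OF this, of "1 / 4"] \<kappa>
  have ev2: "\<forall>\<^sub>F \<theta> in at_right 0. \<theta> * L + 1 / (4 * \<kappa>) < 1 / 4" by simp
  have ev3: "\<forall>\<^sub>F \<theta> in at_right 0. 0 < \<theta> \<and> \<theta> < (1::real)"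
    by (rule eventually_at_right_real[THEN eventually_mono, of 0 1]) auto
  have "\<forall>\<^sub>F \<theta> in at_right 0. P \<theta> \<le> 0"
    using ev1 ev2 ev3
  proof eventually_elim
    case (elim \<theta>)
    then have "\<theta>\<^sup>2 * P \<theta> \<le> 0" using main[of \<theta>] P[of \<theta>] by simp
    then show ?case using elim by (simp add: mult_le_0_iff)
  qed
  moreover have "(P \<longlongrightarrow> X + 0 * (a * c2 - a * m - 2 * Z * E) + 0\<^sup>2 * (m * c2)
      - 0 ^ 3 * ((m + c2) * E) + 0 ^ 4 * E\<^sup>2) (at_right 0)"
    unfolding P_def[abs_def] by (intro tendsto_intros)
  ultimately have "X \<le> 0"
    using tendsto_upperbound[of P _ "at_right 0" 0] by simp
  moreover have "X = Z * c - a\<^sup>2 - \<kappa> * (Z * Q)" by (simp add: X_def m_def c2_def algebra_simps)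
  ultimately have "Z * c - a\<^sup>2 \<le> \<kappa> * (Z * Q)" by simp
  then show ?thesis unfolding Z_def a_def c_def Q_def q_def .
qed

text \<open>The gradient term carries the sharp constant 1; the auxiliary factor \<open>\<kappa> > 1\<close> pays for the
  lack of convexity of \<open>h\<close>.\<close>

theorem poincare_ineq_logconcave:
  fixes \<rho> h :: "(nat \<Rightarrow> real) \<Rightarrow> real" and D :: "(nat \<Rightarrow> real) \<Rightarrow> nat \<Rightarrow> real"
  assumes "tame n \<rho>" "\<And>x. \<rho> x \<ge> 0" "(\<integral>x. \<rho> x \<partial>std_gaussian n) > 0"
    and "\<And>x y. \<rho> x * \<rho> y \<le> (\<rho> (\<lambda>i\<in>{..<n}. (x i + y i) / 2))\<^sup>2"
    and "tame n h" "tame n (\<lambda>x. \<Sum>i<n. (D x i)\<^sup>2)"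
    and "\<And>x y. h x + (\<Sum>i<n. D x i * (y i - x i)) - L * (\<Sum>i<n. (y i - x i)\<^sup>2) \<le> h y"
    and "L \<ge> 0"
  shows "(\<integral>x. \<rho> x * (h x)\<^sup>2 \<partial>std_gaussian n)
      - (\<integral>x. \<rho> x * h x \<partial>std_gaussian n)\<^sup>2 / (\<integral>x. \<rho> x \<partial>std_gaussian n)
    \<le> (\<integral>x. \<rho> x * (\<Sum>i<n. (D x i)\<^sup>2) \<partial>std_gaussian n)"
proof -
  define Z a c Q where "Z = (\<integral>x. \<rho> x \<partial>std_gaussian n)" and "a = (\<integral>x. \<rho> x * h x \<partial>std_gaussian n)"
    and "c = (\<integral>x. \<rho> x * (h x)\<^sup>2 \<partial>std_gaussian n)"
    and "Q = (\<integral>x. \<rho> x * (\<Sum>i<n. (D x i)\<^sup>2) \<partial>std_gaussian n)"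
  have "Z * c - a\<^sup>2 \<le> \<kappa> * (Z * Q)" if "\<kappa> > 1" for \<kappa>
    unfolding Z_def a_def c_def Q_def by (rule poincare_ineq_aux[OF assms that])
  then have "\<forall>\<^sub>F \<kappa> in at_right 1. Z * c - a\<^sup>2 \<le> \<kappa> * (Z * Q)"
    by (auto simp: eventually_at_filter)
  moreover have "((\<lambda>\<kappa>. \<kappa> * (Z * Q)) \<longlongrightarrow> 1 * (Z * Q)) (at_right 1)"
    by (intro tendsto_intros)
  ultimately have "Z * c - a\<^sup>2 \<le> Z * Q"
    using tendsto_lowerbound[of "\<lambda>\<kappa>. \<kappa> * (Z * Q)" _ "at_right 1"] by simp
  moreover have "Z > 0" using assms(3) by (simp add: Z_def)
  ultimately have "c - a\<^sup>2 / Z \<le> Q" by (simp add: field_simps)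
  then show ?thesis by (simp add: Z_def a_def c_def Q_def)
qed

corollary gaussian_poincare:
  fixes h :: "(nat \<Rightarrow> real) \<Rightarrow> real" and D :: "(nat \<Rightarrow> real) \<Rightarrow> nat \<Rightarrow> real"
  assumes "tame n h" "tame n (\<lambda>x. \<Sum>i<n. (D x i)\<^sup>2)"
    and "\<And>x y. h x + (\<Sum>i<n. D x i * (y i - x i)) - L * (\<Sum>i<n. (y i - x i)\<^sup>2) \<le> h y"
    and "L \<ge> 0"
  shows "(l2 n (\<lambda>x. h x - (\<integral>y. h y \<partial>std_gaussian n)))\<^sup>2 \<le> (\<integral>x. (\<Sum>i<n. (D x i)\<^sup>2) \<partial>std_gaussian n)"
proof -
  let ?m = "\<integral>y. h y \<partial>std_gaussian n"
  have "(l2 n (\<lambda>x. h x - ?m))\<^sup>2 = (\<integral>x. (h x)\<^sup>2 + (?m\<^sup>2 - 2 * ?m * h x) \<partial>std_gaussian n)"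
    unfolding l2_power2
    by (intro Bochner_Integration.integral_cong) (auto simp: power2_eq_square algebra_simps)
  also have "\<dots> = (\<integral>x. (h x)\<^sup>2 \<partial>std_gaussian n) - ?m\<^sup>2"
    using tame_integrable[OF tame_power[OF assms(1), of 2]] tame_integrable[OF assms(1)]
    by simp (simp add: power2_eq_square)
  also have "\<dots> \<le> (\<integral>x. (\<Sum>i<n. (D x i)\<^sup>2) \<partial>std_gaussian n)"
    using poincare_ineq_logconcave[of n "\<lambda>_. 1" h D L] assms by simp
  finally show ?thesis .
qed

section \<open>Gaussian integration by parts\<close>

text \<open>The difference of the two integrands, times the density, is the derivative of
  \<open>f\<close> times the density. This product vanishes at both ends, since Gaussian decay beats
  \<open>exp (a * \<bar>x\<bar>)\<close>.\<close>

lemma stein_std_normal: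
  fixes f f' :: "real \<Rightarrow> real"
  assumes f: "\<And>x. (f has_real_derivative f' x) (at x)" and cont: "\<And>x. isCont f' x"
    and bf: "\<And>x. \<bar>f x\<bar> \<le> C * exp (a * \<bar>x\<bar>)" and bf': "\<And>x. \<bar>f' x\<bar> \<le> C * exp (a * \<bar>x\<bar>)"
  shows "(\<integral>x. x * f x \<partial>density lborel std_normal_density) = (\<integral>x. f' x \<partial>density lborel std_normal_density)"
proof -
  let ?N = "density lborel std_normal_density" and ?\<phi> = std_normal_density
  have fc: "isCont f x" for x using f by (rule DERIV_isCont)
  have mf [measurable]: "f \<in> borel_measurable borel" "f' \<in> borel_measurable borel"
    using fc cont by (auto intro!: borel_measurable_continuous_onI continuous_at_imp_continuous_on)
  have C0: "C \<ge> 0" using bf[of 0] by simp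
  have int1: "integrable ?N (\<lambda>x. x * f x)"
  proof (rule Bochner_Integration.integrable_bound)
    show "integrable ?N (\<lambda>x. C * exp ((a + 1) * \<bar>x\<bar>))"
      using integrable_exp_abs_std_normal[of "a + 1"] by simp
    show "AE x in ?N. norm (x * f x) \<le> norm (C * exp ((a + 1) * \<bar>x\<bar>))"
    proof (rule AE_I2)
      fix x :: real
      have "\<bar>x\<bar> \<le> exp \<bar>x\<bar>" using exp_ge_add_one_self[of "\<bar>x\<bar>"] by linarith
      then have "\<bar>x\<bar> * \<bar>f x\<bar> \<le> exp \<bar>x\<bar> * (C * exp (a * \<bar>x\<bar>))" by (intro mult_mono bf) auto
      then show "norm (x * f x) \<le> norm (C * exp ((a + 1) * \<bar>x\<bar>))"
        using C0 unfolding distrib_right exp_add by (simp add: abs_mult mult_ac)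
    qed
  qed simp
  have int2: "integrable ?N f'"
  proof (rule Bochner_Integration.integrable_bound)
    show "integrable ?N (\<lambda>x. C * exp (a * \<bar>x\<bar>))"
      using integrable_exp_abs_std_normal[of a] by simp
  qed (use C0 bf' in auto)
  define F where "F x = f x * ?\<phi> x" for x
  have F: "(F has_real_derivative ?\<phi> x * (f' x - x * f x)) (at x)" for x
    unfolding F_def std_normal_density_def
    by (rule derivative_eq_intros f refl | simp add: algebra_simps diff_divide_distrib)+
  have limg: "((\<lambda>x. C * (exp (a * x) * ?\<phi> x)) \<longlongrightarrow> 0) at_top"
  proof (rule Lim_null_comparison[OF always_eventually])
    define K where "K = C * exp ((a + 1)\<^sup>2 / 2)"
    have "((\<lambda>x. exp (- x :: real)) \<longlongrightarrow> 0) at_top"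
      by (rule filterlim_compose[OF exp_at_bot filterlim_uminus_at_bot_at_top])
    then show "((\<lambda>x. K * exp (- x)) \<longlongrightarrow> 0) at_top" by (rule tendsto_mult_right_zero)
    show "\<forall>x. norm (C * (exp (a * x) * ?\<phi> x)) \<le> K * exp (- x)"
    proof
      fix x :: real
      \<comment> \<open>Completing the square trades the Gaussian decay for the simpler comparison
        function \<open>exp (- x)\<close>.\<close>
      have "0 \<le> ((a + 1) - x)\<^sup>2 / 2" by simp
      then have "a * x - x\<^sup>2 / 2 \<le> (a + 1)\<^sup>2 / 2 - x" by (simp add: power2_eq_square field_simps)
      then have "exp (a * x) * exp (- x\<^sup>2 / 2) \<le> exp ((a + 1)\<^sup>2 / 2) * exp (- x)"
        by (simp add: exp_add[symmetric] exp_diff[symmetric])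
      moreover have "?\<phi> x \<le> 1 * exp (- x\<^sup>2 / 2)"
        unfolding std_normal_density_def using pi_ge_two
        by (intro mult_right_mono) (auto simp: real_le_rsqrt)
      then have "exp (a * x) * ?\<phi> x \<le> exp (a * x) * exp (- x\<^sup>2 / 2)"
        by (intro mult_left_mono) auto
      ultimately have "C * (exp (a * x) * ?\<phi> x) \<le> C * (exp ((a + 1)\<^sup>2 / 2) * exp (- x))"
        using C0 by (intro mult_left_mono) linarith+
      then show "norm (C * (exp (a * x) * ?\<phi> x)) \<le> K * exp (- x)"
        using C0 by (simp add: K_def)
    qed
  qed
  have "(F \<longlongrightarrow> 0) at_top"
  proof (rule Lim_null_comparison[OF _ limg])
    show "\<forall>\<^sub>F x in at_top. norm (F x) \<le> C * (exp (a * x) * ?\<phi> x)"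
      using eventually_ge_at_top[of 0]
    proof eventually_elim
      case (elim x)
      then show ?case using mult_right_mono[OF bf[of x], of "?\<phi> x"] by (simp add: F_def abs_mult)
    qed
  qed
  moreover have "(F \<longlongrightarrow> 0) at_bot"
    unfolding at_bot_mirror filterlim_filtermap
  proof (rule Lim_null_comparison[OF _ limg])
    show "\<forall>\<^sub>F x in at_top. norm (F (- x)) \<le> C * (exp (a * x) * ?\<phi> x)"
      using eventually_ge_at_top[of 0]
    proof eventually_elim
      case (elim x)
      then show ?case using mult_right_mono[OF bf[of "-x"], of "?\<phi> x"]
        by (simp add: F_def abs_mult std_normal_density_def)
    qed
  qed
  moreover have intd: "integrable lborel (\<lambda>x. ?\<phi> x * (f' x - x * f x))"
    using Bochner_Integration.integrable_diff[OF int2 int1] by (simp add: integrable_density)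
  ultimately have "(LBINT x=-\<infinity>..\<infinity>. ?\<phi> x * (f' x - x * f x)) = 0 - 0"
  proof (intro interval_integral_FTC_integrable)
    show "isCont (\<lambda>x. ?\<phi> x * (f' x - x * f x)) x" for x
      unfolding std_normal_density_def by (intro continuous_intros fc cont) auto
  qed (use F in \<open>auto simp: has_real_derivative_iff_has_vector_derivative[symmetric] ereal_tendsto_simps
        set_integrable_def einterval_def\<close>)
  then have "(\<integral>x. ?\<phi> x * (f' x - x * f x) \<partial>lborel) = 0"
    by (simp add: interval_integral_to_infinity_eq interval_lebesgue_integral_def set_lebesgue_integral_def einterval_def)
  then have "(\<integral>x. f' x - x * f x \<partial>?N) = 0"
    by (subst integral_density) (auto intro: AE_I2)
  then show ?thesis using int1 int2 by simp
qed

lemma l1_fun_upd: "i < n \<Longrightarrow> l1 n (x(i := t)) = \<bar>t\<bar> + (\<Sum>j\<in>{..<n} - {i}. \<bar>x j\<bar>)"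
  unfolding l1_def by (subst sum.remove[of _ i]) (auto intro!: sum.cong)

text \<open>Fubini isolates coordinate \<open>i\<close>. With the other coordinates fixed, the tame
  bounds become one-dimensional exponential bounds with constants common to \<open>f\<close> and
  \<open>f'\<close>.\<close>

lemma stein_std_gaussian:
  fixes f f' :: "(nat \<Rightarrow> real) \<Rightarrow> real"
  assumes i: "i < n" and ft: "tame n f" and f't: "tame n f'"
    and f: "\<And>x t. ((\<lambda>t. f (x(i := t))) has_real_derivative f' (x(i := t))) (at t)"
    and cont: "\<And>x t. isCont (\<lambda>t. f' (x(i := t))) t"
  shows "(\<integral>x. x i * f x \<partial>std_gaussian n) = (\<integral>x. f' x \<partial>std_gaussian n)"
proof -
  let ?N = "density lborel std_normal_density"
  interpret product_sigma_finite "\<lambda>_::nat. ?N" by (rule product_sigma_finite_std_normal)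
  have ins: "{..<n} = insert i ({..<n} - {i})" using i by auto
  have split: "(\<integral>x. F x \<partial>std_gaussian n) = (\<integral>x. (\<integral>t. F (x(i := t)) \<partial>?N) \<partial>PiM ({..<n} - {i}) (\<lambda>_. ?N))"
    if "tame n F" for F
  proof -
    have "integrable (PiM (insert i ({..<n} - {i})) (\<lambda>_. ?N)) F"
      using tame_integrable[OF that] unfolding std_gaussian_def ins[symmetric] .
    from product_integral_insert[OF _ _ this]
    show ?thesis unfolding std_gaussian_def ins[symmetric] by simp
  qed
  obtain C a where C: "C \<ge> 0" "a \<ge> 0" "\<And>x. \<bar>f x\<bar> \<le> C * exp (a * l1 n x)" using tameE[OF ft] by metis
  obtain D b where D: "D \<ge> 0" "b \<ge> 0" "\<And>x. \<bar>f' x\<bar> \<le> D * exp (b * l1 n x)" using tameE[OF f't] by metis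
  have "(\<integral>x. x i * f x \<partial>std_gaussian n)
      = (\<integral>x. (\<integral>t. t * f (x(i := t)) \<partial>?N) \<partial>PiM ({..<n} - {i}) (\<lambda>_. ?N))"
    by (subst split) (auto intro!: tame_mult tame_coord i ft)
  also have "\<dots> = (\<integral>x. (\<integral>t. f' (x(i := t)) \<partial>?N) \<partial>PiM ({..<n} - {i}) (\<lambda>_. ?N))"
  proof (rule Bochner_Integration.integral_cong[OF refl])
    fix x :: "nat \<Rightarrow> real"
    define r where "r = (\<Sum>j\<in>{..<n} - {i}. \<bar>x j\<bar>)"
    have r: "r \<ge> 0" by (simp add: r_def sum_nonneg)
    define K where "K = (C + D) * exp ((a + b) * r)"
    have le: "c * exp (e * l1 n (x(i := t))) \<le> K * exp ((a + b) * \<bar>t\<bar>)"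
      if "0 \<le> c" "c \<le> C + D" "0 \<le> e" "e \<le> a + b" for c e t
    proof -
      have "c * exp (e * l1 n (x(i := t))) \<le> (C + D) * exp ((a + b) * l1 n (x(i := t)))"
        using that l1_nonneg by (intro mult_mono) (auto intro: mult_right_mono)
      also have "\<dots> = K * exp ((a + b) * \<bar>t\<bar>)"
        unfolding l1_fun_upd[OF i] r_def[symmetric] K_def by (simp add: distrib_left exp_add)
      finally show ?thesis .
    qed
    show "(\<integral>t. t * f (x(i := t)) \<partial>?N) = (\<integral>t. f' (x(i := t)) \<partial>?N)"
    proof (rule stein_std_normal[where C=K and a="a + b"])
      show "\<bar>f (x(i := t))\<bar> \<le> K * exp ((a + b) * \<bar>t\<bar>)" for t
        by (rule order_trans[OF C(3) le]) (use C D in auto)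
      show "\<bar>f' (x(i := t))\<bar> \<le> K * exp ((a + b) * \<bar>t\<bar>)" for t
        by (rule order_trans[OF D(3) le]) (use C D in auto)
    qed (rule f cont)+
  qed
  also have "\<dots> = (\<integral>x. f' x \<partial>std_gaussian n)" by (rule split[OF f't, symmetric])
  finally show ?thesis .
qed

text \<open>Stein's identity for the linear function \<open>dot n g v\<close> shows that its
  covariance with \<open>g i\<close> is \<open>v i\<close>.\<close>

lemma integral_dot_power2: "(\<integral>g. (dot n g v)\<^sup>2 \<partial>std_gaussian n) = (\<Sum>i<n. (v i)\<^sup>2)"
proof -
  have co: "(\<integral>g. g i * dot n g v \<partial>std_gaussian n) = v i" if i: "i < n" for i
  proof -
    have eq: "dot n (x(i := t)) v = t * v i + (\<Sum>j\<in>{..<n} - {i}. x j * v j)" for x t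
      unfolding dot_def using i by (subst sum.remove[of _ i]) (auto intro!: sum.cong)
    have "(\<integral>g. g i * dot n g v \<partial>std_gaussian n) = (\<integral>g. v i \<partial>std_gaussian n)"
    proof (rule stein_std_gaussian[OF i])
      show "((\<lambda>t. dot n (x(i := t)) v) has_real_derivative v i) (at t)" for x t
        unfolding eq by (rule derivative_eq_intros refl | simp)+
    qed auto
    then show ?thesis by simp
  qed
  have "(\<integral>g. (dot n g v)\<^sup>2 \<partial>std_gaussian n) = (\<integral>g. (\<Sum>i<n. v i * (g i * dot n g v)) \<partial>std_gaussian n)"
    by (intro Bochner_Integration.integral_cong refl)
      (simp add: power2_eq_square sum_distrib_right sum_distrib_left dot_def ac_simps)
  also have "\<dots> = (\<Sum>i<n. v i * (\<integral>g. g i * dot n g v \<partial>std_gaussian n))"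
    by (subst Bochner_Integration.integral_sum) (auto intro!: tame_integrable tame_mult)
  finally show ?thesis by (simp add: co power2_eq_square)
qed

lemma integral_coord: "i < n \<Longrightarrow> (\<integral>g. g i \<partial>std_gaussian n) = 0"
  using stein_std_gaussian[of i n "\<lambda>_. 1" "\<lambda>_. 0"] by simp

lemma integral_dot [simp]: "(\<integral>g. dot n g v \<partial>std_gaussian n) = 0"
  unfolding dot_def
  by (subst Bochner_Integration.integral_sum) (auto intro!: tame_integrable simp: integral_coord)

lemma abs_dot_le_l1:
  assumes "\<And>i. i < n \<Longrightarrow> \<bar>s i\<bar> \<le> B"
  shows "\<bar>dot n g s\<bar> \<le> B * l1 n g"
proof -
  have "\<bar>dot n g s\<bar> \<le> (\<Sum>i<n. \<bar>g i * s i\<bar>)" unfolding dot_def by (rule sum_abs)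
  also have "\<dots> \<le> (\<Sum>i<n. B * \<bar>g i\<bar>)"
  proof (rule sum_mono)
    fix i assume "i \<in> {..<n}"
    then have "\<bar>s i\<bar> * \<bar>g i\<bar> \<le> B * \<bar>g i\<bar>" using assms by (intro mult_right_mono) auto
    then show "\<bar>g i * s i\<bar> \<le> B * \<bar>g i\<bar>" by (simp add: abs_mult mult.commute)
  qed
  finally show ?thesis by (simp add: l1_def sum_distrib_left)
qed

section \<open>Logarithms of exponential averages over a probability vector\<close>

lemma exp_upper_quadratic: "\<bar>x\<bar> \<le> 1 \<Longrightarrow> exp x \<le> 1 + x + (x::real)\<^sup>2"
proof (cases "x \<ge> 0")
  case True
  assume "\<bar>x\<bar> \<le> 1" with True show ?thesis using exp_bound[of x] by simp
next
  case False
  assume x: "\<bar>x\<bar> \<le> 1"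
  have "exp x = 1 / exp (- x)" by (simp add: exp_minus field_simps)
  also have "\<dots> \<le> 1 / (1 + (- x))"
    using False exp_ge_add_one_self[of "- x"] by (intro divide_left_mono) auto
  also have "\<dots> \<le> 1 + x + x\<^sup>2"
  proof -
    have "(1 + x + x\<^sup>2) * (1 - x) = 1 - x * x\<^sup>2" by (simp add: power2_eq_square algebra_simps)
    also have "\<dots> \<ge> 1" using False by (simp add: mult_nonpos_nonneg)
    finally show ?thesis using False by (simp add: field_simps)
  qed
  finally show ?thesis .
qed

context
  fixes S :: "'a set" and p :: "'a \<Rightarrow> real"
  assumes S: "finite S" and p: "\<And>s. s \<in> S \<Longrightarrow> p s \<ge> 0" and p1: "(\<Sum>s\<in>S. p s) = 1"
begin

lemma avg_le: "(\<And>s. s \<in> S \<Longrightarrow> a s \<le> r) \<Longrightarrow> (\<Sum>s\<in>S. p s * a s) \<le> r"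
  using sum_mono[of S "\<lambda>s. p s * a s" "\<lambda>s. p s * r"] p p1
  by (simp add: mult_left_mono sum_distrib_right[symmetric])

lemma avg_ge: "(\<And>s. s \<in> S \<Longrightarrow> r \<le> a s) \<Longrightarrow> r \<le> (\<Sum>s\<in>S. p s * a s)"
  using avg_le[of "\<lambda>s. - a s" "- r"] by (simp add: sum_negf)

lemma avg_exp_pos: "(\<Sum>s\<in>S. p s * exp (a s)) > 0"
proof -
  have "\<not> (\<forall>s\<in>S. p s * exp (a s) = 0)"
  proof
    assume "\<forall>s\<in>S. p s * exp (a s) = 0"
    then have "sum p S = 0" by (intro sum.neutral) simp
    then show False using p1 by simp
  qed
  then obtain s where s: "s \<in> S" "p s * exp (a s) \<noteq> 0" by blast
  show ?thesis
    using p s by (intro sum_pos2[OF S s(1)]) (auto simp: less_le)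
qed

lemma avg_le_ln_avg_exp: "(\<Sum>s\<in>S. p s * a s) \<le> ln (\<Sum>s\<in>S. p s * exp (a s))"
proof -
  define m where "m = (\<Sum>s\<in>S. p s * a s)"
  have "(\<Sum>s\<in>S. p s * (exp m * (1 + (a s - m)))) = (\<Sum>s\<in>S. exp m * p s + exp m * (p s * a s) - exp m * m * p s)"
    by (intro sum.cong refl) (simp add: algebra_simps)
  also have "\<dots> = exp m"
    by (simp add: sum.distrib sum_subtractf sum_distrib_left[symmetric] p1 m_def[symmetric])
  finally have "exp m = (\<Sum>s\<in>S. p s * (exp m * (1 + (a s - m))))" ..
  also have "\<dots> \<le> (\<Sum>s\<in>S. p s * (exp m * exp (a s - m)))"
    by (intro sum_mono mult_left_mono p exp_ge_add_one_self) auto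
  also have "\<dots> = (\<Sum>s\<in>S. p s * exp (a s))" by (simp add: exp_diff)
  finally show ?thesis using avg_exp_pos by (simp add: ln_ge_iff m_def)
qed

lemma avg_power2_le: "(\<Sum>s\<in>S. p s * a s)\<^sup>2 \<le> (\<Sum>s\<in>S. p s * (a s)\<^sup>2)"
proof -
  let ?m = "\<Sum>s\<in>S. p s * a s"
  have "0 \<le> (\<Sum>s\<in>S. p s * (a s - ?m)\<^sup>2)" by (intro sum_nonneg mult_nonneg_nonneg p) auto
  also have "\<dots> = (\<Sum>s\<in>S. p s * (a s)\<^sup>2 - 2 * ?m * (p s * a s) + ?m\<^sup>2 * p s)"
    by (intro sum.cong refl) (simp add: power2_eq_square algebra_simps)
  also have "\<dots> = (\<Sum>s\<in>S. p s * (a s)\<^sup>2) - ?m\<^sup>2"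
    by (simp add: sum.distrib sum_subtractf sum_distrib_left[symmetric] p1) (simp add: power2_eq_square)
  finally show ?thesis by simp
qed

lemma abs_ln_avg_exp_le:
  assumes "\<And>s. s \<in> S \<Longrightarrow> \<bar>a s\<bar> \<le> r"
  shows "\<bar>ln (\<Sum>s\<in>S. p s * exp (a s))\<bar> \<le> r"
proof -
  have "- r \<le> (\<Sum>s\<in>S. p s * a s)" by (rule avg_ge) (use assms in force)
  moreover have "(\<Sum>s\<in>S. p s * exp (a s)) \<le> exp r" by (rule avg_le) (use assms in force)
  then have "ln (\<Sum>s\<in>S. p s * exp (a s)) \<le> r" using avg_exp_pos by (metis ln_exp ln_le_cancel_iff exp_gt_zero)
  ultimately show ?thesis using avg_le_ln_avg_exp[of a] by linarith
qed

text \<open>For small \<open>r\<close> a quadratic bound on the exponential of the centred values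
  suffices; for \<open>2 * r > 1\<close> the trivial bound \<open>2 * r\<close> is already below
  \<open>4 * r\<^sup>2\<close>. Validity for every \<open>r\<close> matters, since \<open>r\<close>
  will depend on \<open>g\<close> and be unbounded.\<close>

lemma ln_avg_exp_le:
  assumes "\<And>s. s \<in> S \<Longrightarrow> \<bar>a s\<bar> \<le> r" and r: "r \<ge> 0"
  shows "ln (\<Sum>s\<in>S. p s * exp (a s)) \<le> (\<Sum>s\<in>S. p s * a s) + 4 * r\<^sup>2"
proof -
  define m where "m = (\<Sum>s\<in>S. p s * a s)"
  have m: "\<bar>m\<bar> \<le> r" unfolding m_def abs_le_iff
    using avg_le[of a r] avg_ge[of "-r" a] assms by (force simp: abs_le_iff)
  have b: "\<bar>a s - m\<bar> \<le> 2 * r" if "s \<in> S" for s using assms(1)[OF that] m by linarith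
  have "(\<Sum>s\<in>S. p s * exp (a s)) = exp m * (\<Sum>s\<in>S. p s * exp (a s - m))"
    by (simp add: exp_diff sum_distrib_left)
  then have eq: "ln (\<Sum>s\<in>S. p s * exp (a s)) = m + ln (\<Sum>s\<in>S. p s * exp (a s - m))"
    using avg_exp_pos[of "\<lambda>s. a s - m"] by (simp add: ln_mult)
  have "ln (\<Sum>s\<in>S. p s * exp (a s - m)) \<le> 4 * r\<^sup>2"
  proof (cases "2 * r \<le> 1")
    case True
    have "(\<Sum>s\<in>S. p s * exp (a s - m)) \<le> (\<Sum>s\<in>S. p s * (1 + (a s - m) + (a s - m)\<^sup>2))"
      using b True by (intro sum_mono mult_left_mono p exp_upper_quadratic) force+
    also have "\<dots> = (\<Sum>s\<in>S. p s + p s * a s - m * p s + p s * (a s - m)\<^sup>2)"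
      by (intro sum.cong refl) (simp add: algebra_simps)
    also have "\<dots> = 1 + (\<Sum>s\<in>S. p s * (a s - m)\<^sup>2)"
      by (simp add: sum.distrib sum_subtractf p1 sum_distrib_left[symmetric] m_def[symmetric])
    also have "(\<Sum>s\<in>S. p s * (a s - m)\<^sup>2) \<le> (2 * r)\<^sup>2"
    proof (rule avg_le)
      fix s assume "s \<in> S"
      then have "\<bar>a s - m\<bar> \<le> \<bar>2 * r\<bar>" using b[of s] r by simp
      then show "(a s - m)\<^sup>2 \<le> (2 * r)\<^sup>2" by (simp only: abs_le_square_iff)
    qed
    finally have "(\<Sum>s\<in>S. p s * exp (a s - m)) \<le> 1 + 4 * r\<^sup>2" by (simp add: power_mult_distrib)
    moreover have "ln (\<Sum>s\<in>S. p s * exp (a s - m)) \<le> (\<Sum>s\<in>S. p s * exp (a s - m)) - 1"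
      by (rule ln_le_minus_one) (rule avg_exp_pos)
    ultimately show ?thesis by simp
  next
    case False
    have "ln (\<Sum>s\<in>S. p s * exp (a s - m)) \<le> 2 * r" using abs_ln_avg_exp_le[of "\<lambda>s. a s - m" "2 * r"] b by simp
    also have "\<dots> \<le> 2 * r * (2 * r)" using False r mult_left_mono[of 1 "2 * r" "2 * r"] by simp
    finally show ?thesis by (simp add: power2_eq_square)
  qed
  then show ?thesis using eq by (simp add: m_def)
qed

end

section \<open>Soft maxima and Gibbs weights\<close>

text \<open>The weights \<open>b\<close> enter without the factor \<open>l\<close>, so the
  corresponding hard maximum has the constants \<open>b s / l\<close>.\<close>

definition lse :: "nat \<Rightarrow> (nat \<Rightarrow> real) set \<Rightarrow> real \<Rightarrow> ((nat \<Rightarrow> real) \<Rightarrow> real) \<Rightarrow> (nat \<Rightarrow> real) \<Rightarrow> real" where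
  "lse n S l b g = ln (\<Sum>s\<in>S. exp (l * dot n g s + b s)) / l"

definition gibbs :: "nat \<Rightarrow> (nat \<Rightarrow> real) set \<Rightarrow> real \<Rightarrow> ((nat \<Rightarrow> real) \<Rightarrow> real) \<Rightarrow> (nat \<Rightarrow> real) \<Rightarrow> (nat \<Rightarrow> real) \<Rightarrow> real" where
  "gibbs n S l b g s = exp (l * dot n g s + b s) / (\<Sum>r\<in>S. exp (l * dot n g r + b r))"

text \<open>The gradient of \<open>lse\<close> at \<open>g\<close>.\<close>

definition gmean :: "nat \<Rightarrow> (nat \<Rightarrow> real) set \<Rightarrow> real \<Rightarrow> ((nat \<Rightarrow> real) \<Rightarrow> real) \<Rightarrow> (nat \<Rightarrow> real) \<Rightarrow> nat \<Rightarrow> real" where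
  "gmean n S l b g i = (\<Sum>s\<in>S. gibbs n S l b g s * s i)"

text \<open>The trace of the covariance of the Gibbs measure, that is, the Laplacian of
  \<open>lse\<close> divided by \<open>l\<close>.\<close>

definition spread :: "nat \<Rightarrow> (nat \<Rightarrow> real) set \<Rightarrow> real \<Rightarrow> ((nat \<Rightarrow> real) \<Rightarrow> real) \<Rightarrow> (nat \<Rightarrow> real) \<Rightarrow> real" where
  "spread n S l b g = (\<Sum>s\<in>S. gibbs n S l b g s * (\<Sum>i<n. (gmean n S l b g i - s i)\<^sup>2))"

definition hmax :: "nat \<Rightarrow> (nat \<Rightarrow> real) set \<Rightarrow> ((nat \<Rightarrow> real) \<Rightarrow> real) \<Rightarrow> (nat \<Rightarrow> real) \<Rightarrow> real" where
  "hmax n S c g = Max ((\<lambda>s. dot n g s + c s) ` S)"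

lemma dot_diff_left: "dot n y s - dot n x s = (\<Sum>i<n. s i * (y i - x i))"
  by (simp add: dot_def sum_subtractf[symmetric] algebra_simps)

lemma finite_coord_bound:
  fixes S :: "(nat \<Rightarrow> real) set"
  assumes "finite S"
  obtains B :: real where "B \<ge> 0" "\<And>s i. s \<in> S \<Longrightarrow> i < n \<Longrightarrow> \<bar>s i\<bar> \<le> B"
proof -
  let ?B = "\<Sum>s\<in>S. \<Sum>i<n. \<bar>s i\<bar>"
  have "\<bar>s i\<bar> \<le> ?B" if "s \<in> S" "i < n" for s i
  proof -
    have "\<bar>s i\<bar> \<le> (\<Sum>i<n. \<bar>s i\<bar>)" using that by (intro member_le_sum) auto
    also have "\<dots> \<le> ?B" by (rule member_le_sum[OF that(1), of "\<lambda>s. \<Sum>i<n. \<bar>s i\<bar>"]) (use assms in \<open>auto intro: sum_nonneg\<close>)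
    finally show ?thesis .
  qed
  moreover have "?B \<ge> 0" by (intro sum_nonneg) auto
  ultimately show thesis using that by blast
qed

context
  fixes n :: nat and S :: "(nat \<Rightarrow> real) set" and c :: "(nat \<Rightarrow> real) \<Rightarrow> real"
  assumes S: "finite S" "S \<noteq> {}"
begin

lemma hmax_ge: "s \<in> S \<Longrightarrow> dot n g s + c s \<le> hmax n S c g"
  unfolding hmax_def using S by (intro Max_ge) auto

lemma hmax_le_iff: "hmax n S c g \<le> r \<longleftrightarrow> (\<forall>s\<in>S. dot n g s + c s \<le> r)"
  unfolding hmax_def using S by (subst Max_le_iff) auto

lemma hmax_attained: obtains s where "s \<in> S" "hmax n S c g = dot n g s + c s"
proof -
  have "hmax n S c g \<in> (\<lambda>s. dot n g s + c s) ` S"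
    unfolding hmax_def using S by (intro Max_in) auto
  then show thesis using that by auto
qed

lemma tame_hmax: "tame n (hmax n S c)"
proof -
  have [measurable]: "hmax n S c \<in> borel_measurable (std_gaussian n)"
    unfolding hmax_def[abs_def] using S by (intro borel_measurable_Max) auto
  have "tame n (\<lambda>g. \<Sum>s\<in>S. \<bar>dot n g s + c s\<bar>)" by (intro tame_sum tame_abs tame_add) auto
  then show ?thesis
  proof (rule tame_mono)
    fix g
    obtain s where s: "s \<in> S" "hmax n S c g = dot n g s + c s" using hmax_attained .
    have "\<bar>hmax n S c g\<bar> \<le> (\<Sum>s\<in>S. \<bar>dot n g s + c s\<bar>)"
      unfolding s(2) by (rule member_le_sum[OF s(1), of "\<lambda>s. \<bar>dot n g s + c s\<bar>"]) (use S in auto)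
    then show "\<bar>hmax n S c g\<bar> \<le> \<bar>\<Sum>s\<in>S. \<bar>dot n g s + c s\<bar>\<bar>" by linarith
  qed simp
qed

end

context
  fixes n :: nat and S :: "(nat \<Rightarrow> real) set" and l :: real and b :: "(nat \<Rightarrow> real) \<Rightarrow> real"
  assumes S: "finite S" "S \<noteq> {}" and l: "l > 0"
begin

lemma partition_pos: "(\<Sum>r\<in>S. exp (l * dot n g r + b r)) > 0"
  using S by (intro sum_pos) auto

lemma gibbs_pos: "gibbs n S l b g s > 0"
  unfolding gibbs_def using partition_pos by simp

lemma sum_gibbs: "(\<Sum>s\<in>S. gibbs n S l b g s) = 1"
  unfolding gibbs_def using partition_pos[of g] by (simp add: sum_divide_distrib[symmetric])

lemmas gibbs_nonneg = less_imp_le[OF gibbs_pos]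

lemma gibbs_le_one: "s \<in> S \<Longrightarrow> gibbs n S l b g s \<le> 1"
  using member_le_sum[of s S "gibbs n S l b g"] sum_gibbs[of g] gibbs_nonneg S by simp

lemma gibbs_eq: "gibbs n S l b g s = exp (l * (dot n g s - lse n S l b g) + b s)"
  using partition_pos[of g] l
  by (simp add: gibbs_def lse_def right_diff_distrib exp_add exp_diff)

text \<open>A change of the exponents is an exponential average under the old Gibbs weights. With
  \<open>e\<close> arbitrary this covers a move of the point as well as a change of temperature and
  weights.\<close>

lemma ln_partition_diff:
  "ln (\<Sum>s\<in>S. exp (e s)) - l * lse n S l b x
    = ln (\<Sum>s\<in>S. gibbs n S l b x s * exp (e s - (l * dot n x s + b s)))"
proof -
  have "(\<Sum>s\<in>S. gibbs n S l b x s * exp (e s - (l * dot n x s + b s)))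
      = (\<Sum>s\<in>S. exp (e s)) / (\<Sum>s\<in>S. exp (l * dot n x s + b s))"
    unfolding sum_divide_distrib by (intro sum.cong refl) (simp add: gibbs_def exp_diff)
  moreover have "(\<Sum>s\<in>S. exp (e s)) > 0" using S by (intro sum_pos) auto
  ultimately show ?thesis using partition_pos[of x] l by (simp add: lse_def ln_div)
qed

lemma lse_diff:
  "l * (lse n S l b y - lse n S l b x)
    = ln (\<Sum>s\<in>S. gibbs n S l b x s * exp (l * (dot n y s - dot n x s)))"
  using ln_partition_diff[of "\<lambda>s. l * dot n y s + b s" x] l
  by (simp add: right_diff_distrib) (simp add: lse_def)

lemma avg_gibbs_dot_diff:
  "(\<Sum>s\<in>S. gibbs n S l b x s * (l * (dot n y s - dot n x s))) = l * (\<Sum>i<n. gmean n S l b x i * (y i - x i))"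
proof -
  have "(\<Sum>s\<in>S. gibbs n S l b x s * (l * (dot n y s - dot n x s)))
      = (\<Sum>s\<in>S. \<Sum>i<n. l * (gibbs n S l b x s * s i * (y i - x i)))"
    by (simp add: dot_diff_left sum_distrib_left mult_ac)
  also have "\<dots> = (\<Sum>i<n. \<Sum>s\<in>S. l * (gibbs n S l b x s * s i * (y i - x i)))" by (rule sum.swap)
  also have "\<dots> = l * (\<Sum>i<n. gmean n S l b x i * (y i - x i))"
    by (simp add: gmean_def sum_distrib_left sum_distrib_right mult_ac)
  finally show ?thesis .
qed

lemma lse_subgradient:
  "lse n S l b x + (\<Sum>i<n. gmean n S l b x i * (y i - x i)) \<le> lse n S l b y"
proof -
  have "l * (\<Sum>i<n. gmean n S l b x i * (y i - x i)) \<le> l * (lse n S l b y - lse n S l b x)"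
    unfolding lse_diff avg_gibbs_dot_diff[symmetric]
    by (rule avg_le_ln_avg_exp[OF S(1) gibbs_nonneg sum_gibbs])
  then show ?thesis using l by simp
qed

text \<open>Cauchy--Schwarz bounds the exponents and \<open>ln_avg_exp_le\<close> does the rest.
  Only the finiteness of the constant counts: it becomes the \<open>L\<close> of the Poincare
  inequality, which does not appear in the conclusion there.\<close>

lemma lse_upper_quadratic:
  assumes B: "\<And>s. s \<in> S \<Longrightarrow> (\<Sum>i<n. (s i)\<^sup>2) \<le> B"
  shows "lse n S l b y \<le> lse n S l b x + (\<Sum>i<n. gmean n S l b x i * (y i - x i))
    + 4 * l * B * (\<Sum>i<n. (y i - x i)\<^sup>2)"
proof -
  define d where "d = (\<Sum>i<n. (y i - x i)\<^sup>2)"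
  have d: "d \<ge> 0" by (simp add: d_def sum_nonneg)
  obtain s0 where "s0 \<in> S" using S by auto
  then have B0: "B \<ge> 0" using B[of s0] sum_nonneg[of "{..<n}" "\<lambda>i. (s0 i)\<^sup>2"] by auto
  define r where "r = l * (sqrt B * sqrt d)"
  have r: "r \<ge> 0" using l d B0 by (simp add: r_def)
  have bd: "\<bar>l * (dot n y s - dot n x s)\<bar> \<le> r" if s: "s \<in> S" for s
  proof -
    have "\<bar>dot n y s - dot n x s\<bar> \<le> (\<Sum>i<n. \<bar>s i\<bar> * \<bar>y i - x i\<bar>)"
      unfolding dot_diff_left using sum_abs[of "\<lambda>i. s i * (y i - x i)"] by (simp add: abs_mult)
    also have "\<dots> \<le> L2_set s {..<n} * L2_set (\<lambda>i. y i - x i) {..<n}" by (rule L2_set_mult_ineq)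
    also have "\<dots> \<le> sqrt B * sqrt d"
      unfolding L2_set_def d_def using B[OF s] B0 by (intro mult_mono) (auto intro: sum_nonneg)
    finally show ?thesis using l by (simp add: r_def abs_mult)
  qed
  have "l * (lse n S l b y - lse n S l b x) \<le> l * (\<Sum>i<n. gmean n S l b x i * (y i - x i)) + 4 * r\<^sup>2"
    unfolding lse_diff avg_gibbs_dot_diff[symmetric]
    by (rule ln_avg_exp_le[OF S(1) gibbs_nonneg sum_gibbs bd r])
  also have "4 * r\<^sup>2 = l * (4 * l * B * d)"
    using B0 d by (simp add: r_def power_mult_distrib) (simp add: power2_eq_square)
  finally have "l * (lse n S l b y - lse n S l b x)
      \<le> l * ((\<Sum>i<n. gmean n S l b x i * (y i - x i)) + 4 * l * B * d)" by (simp add: distrib_left)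
  then show ?thesis using l by (simp add: d_def)
qed

text \<open>The Lipschitz bound does not see \<open>b\<close>; the uniformity of later constants in
  the weights starts here.\<close>

lemma abs_lse_diff_zero_le:
  assumes "\<And>s i. s \<in> S \<Longrightarrow> i < n \<Longrightarrow> \<bar>s i\<bar> \<le> B"
  shows "\<bar>lse n S l b x - lse n S l b (\<lambda>_. 0)\<bar> \<le> B * l1 n x"
proof -
  have "\<bar>l * (lse n S l b x - lse n S l b (\<lambda>_. 0))\<bar> \<le> l * (B * l1 n x)"
    unfolding lse_diff
  proof (rule abs_ln_avg_exp_le[OF S(1) gibbs_nonneg sum_gibbs])
    fix s assume s: "s \<in> S"
    then have "\<bar>dot n x s\<bar> \<le> B * l1 n x" by (intro abs_dot_le_l1 assms)
    then show "\<bar>l * (dot n x s - dot n (\<lambda>_. 0) s)\<bar> \<le> l * (B * l1 n x)"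
      using l by (simp add: abs_mult dot_def)
  qed
  then show ?thesis using l by (simp add: abs_mult)
qed

lemma tame_lse: "tame n (lse n S l b)"
proof -
  obtain B where B: "B \<ge> 0" "\<And>s i. s \<in> S \<Longrightarrow> i < n \<Longrightarrow> \<bar>s i\<bar> \<le> B"
    using finite_coord_bound[OF S(1), of n] by metis
  have "tame n (\<lambda>x. B * l1 n x + \<bar>lse n S l b (\<lambda>_. 0)\<bar>)" by (intro tame_add tame_mult) auto
  then show ?thesis
  proof (rule tame_mono)
    show "lse n S l b \<in> borel_measurable (std_gaussian n)" unfolding lse_def[abs_def] by measurable
    fix x
    have "\<bar>lse n S l b x - lse n S l b (\<lambda>_. 0)\<bar> \<le> B * l1 n x" using B(2) by (rule abs_lse_diff_zero_le)
    then show "\<bar>lse n S l b x\<bar> \<le> \<bar>B * l1 n x + \<bar>lse n S l b (\<lambda>_. 0)\<bar>\<bar>" by linarith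
  qed
qed

lemma tame_gibbs: "s \<in> S \<Longrightarrow> tame n (\<lambda>g. gibbs n S l b g s)"
  by (rule tame_mono[OF tame_const[of n 1]])
    (auto simp: gibbs_nonneg gibbs_le_one, simp add: gibbs_def)

lemma tame_gmean: "tame n (\<lambda>g. gmean n S l b g i)"
  unfolding gmean_def by (intro tame_sum tame_mult tame_gibbs) auto

text \<open>The logarithm of a Gibbs weight is affine in \<open>g\<close> minus
  \<open>l * lse\<close>, and \<open>lse\<close> is convex. Midpoint convexity follows by adding the
  subgradient inequalities at the midpoint, whose linear terms cancel.\<close>

lemma gibbs_logconcave:
  "gibbs n S l b x s * gibbs n S l b y s \<le> (gibbs n S l b (\<lambda>i\<in>{..<n}. (x i + y i) / 2) s)\<^sup>2"
proof -
  let ?m = "\<lambda>i\<in>{..<n}. (x i + y i) / 2"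
  have "(\<Sum>i<n. gmean n S l b ?m i * (x i - ?m i)) + (\<Sum>i<n. gmean n S l b ?m i * (y i - ?m i)) = 0"
    unfolding sum.distrib[symmetric] by (intro sum.neutral) (auto simp: field_simps)
  then have cv: "2 * lse n S l b ?m \<le> lse n S l b x + lse n S l b y"
    using lse_subgradient[of ?m x] lse_subgradient[of ?m y] by linarith
  have "2 * dot n ?m s = dot n x s + dot n y s"
    unfolding dot_def sum_distrib_left sum.distrib[symmetric] by (intro sum.cong) (auto simp: field_simps)
  then have "l * (dot n x s - lse n S l b x) + l * (dot n y s - lse n S l b y)
      \<le> 2 * (l * (dot n ?m s - lse n S l b ?m))"
    using mult_left_mono[OF cv, of l] l by (simp add: algebra_simps)
  then show ?thesis
    unfolding gibbs_eq power2_eq_square by (simp add: exp_add[symmetric])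
qed

lemma gibbs_mass_pos: "s \<in> S \<Longrightarrow> (\<integral>g. gibbs n S l b g s \<partial>std_gaussian n) > 0"
proof -
  assume s: "s \<in> S"
  have i: "integrable (std_gaussian n) (\<lambda>g. gibbs n S l b g s)" by (rule tame_integrable[OF tame_gibbs[OF s]])
  have "(\<integral>g. gibbs n S l b g s \<partial>std_gaussian n) \<noteq> 0"
  proof
    assume "(\<integral>g. gibbs n S l b g s \<partial>std_gaussian n) = 0"
    then have "AE g in std_gaussian n. gibbs n S l b g s = 0"
      by (subst (asm) integral_nonneg_eq_0_iff_AE[OF i]) (auto simp: gibbs_nonneg)
    then have "AE g in std_gaussian n. False" using gibbs_pos by (auto simp: less_le)
    then show False
      using prob_space.AE_False[OF prob_space_std_gaussian] by simp
  qed
  moreover have "(\<integral>g. gibbs n S l b g s \<partial>std_gaussian n) \<ge> 0" by (simp add: gibbs_nonneg)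
  ultimately show ?thesis by linarith
qed

lemma tame_gmean_diff_sq: "tame n (\<lambda>g. \<Sum>i<n. (gmean n S l b g i - s i)\<^sup>2)"
  by (intro tame_sum tame_power tame_diff tame_gmean tame_const)

text \<open>The gap \<open>lse - dot\<close> is convex with gradient \<open>gmean - s\<close>, so
  the Poincare inequality for the weight \<open>gibbs s\<close> applies with \<open>L = 0\<close>.
  Both sides stay unnormalized, so that summing over \<open>s\<close> gives integrals against the
  Gaussian measure.\<close>

lemma gibbs_variance:
  assumes s: "s \<in> S"
  defines "m \<equiv> (\<integral>g. gibbs n S l b g s * (lse n S l b g - dot n g s) \<partial>std_gaussian n)
    / (\<integral>g. gibbs n S l b g s \<partial>std_gaussian n)"
  shows "(\<integral>g. gibbs n S l b g s * (lse n S l b g - dot n g s - m)\<^sup>2 \<partial>std_gaussian n)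
    \<le> (\<integral>g. gibbs n S l b g s * (\<Sum>i<n. (gmean n S l b g i - s i)\<^sup>2) \<partial>std_gaussian n)"
proof -
  let ?h = "\<lambda>g. lse n S l b g - dot n g s" and ?\<rho> = "\<lambda>g. gibbs n S l b g s"
  let ?p = "\<integral>g. ?\<rho> g \<partial>std_gaussian n"
  have h: "tame n ?h" by (intro tame_diff tame_lse tame_dot)
  note \<rho> = tame_gibbs[OF s]
  have p: "?p > 0" by (rule gibbs_mass_pos[OF s])
  have "(\<integral>g. ?\<rho> g * (?h g)\<^sup>2 \<partial>std_gaussian n) - (\<integral>g. ?\<rho> g * ?h g \<partial>std_gaussian n)\<^sup>2 / ?p
      \<le> (\<integral>g. ?\<rho> g * (\<Sum>i<n. (gmean n S l b g i - s i)\<^sup>2) \<partial>std_gaussian n)"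
  proof (rule poincare_ineq_logconcave[where L=0])
    fix x y
    show "?h x + (\<Sum>i<n. (gmean n S l b x i - s i) * (y i - x i)) - 0 * (\<Sum>i<n. (y i - x i)\<^sup>2) \<le> ?h y"
      using lse_subgradient[of x y] dot_diff_left[of n y s x]
      by (simp add: left_diff_distrib sum_subtractf)
  qed (use \<rho> h p s gibbs_nonneg gibbs_logconcave tame_gmean_diff_sq in auto)
  moreover have "(\<integral>g. ?\<rho> g * (?h g - m)\<^sup>2 \<partial>std_gaussian n)
      = (\<integral>g. ?\<rho> g * (?h g)\<^sup>2 - (2 * m) * (?\<rho> g * ?h g) + m\<^sup>2 * ?\<rho> g \<partial>std_gaussian n)"
    by (intro Bochner_Integration.integral_cong refl) (simp add: power2_eq_square algebra_simps)
  moreover have "\<dots> = (\<integral>g. ?\<rho> g * (?h g)\<^sup>2 \<partial>std_gaussian n) - (2 * m) * (\<integral>g. ?\<rho> g * ?h g \<partial>std_gaussian n) + m\<^sup>2 * ?p"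
    using tame_integrable[OF tame_mult[OF \<rho> tame_power[OF h, of 2]]]
      tame_integrable[OF tame_mult[OF \<rho> h]] tame_integrable[OF \<rho>]
    by simp
  moreover have "(2 * m) * (\<integral>g. ?\<rho> g * ?h g \<partial>std_gaussian n) - m\<^sup>2 * ?p
      = (\<integral>g. ?\<rho> g * ?h g \<partial>std_gaussian n)\<^sup>2 / ?p"
    using p unfolding m_def by (simp add: power2_eq_square field_simps)
  ultimately show ?thesis by linarith
qed

lemma gmean_derivative:
  assumes i: "i < n"
  shows "((\<lambda>t. gmean n S l b (x(i := t)) i) has_real_derivative
    l * (\<Sum>s\<in>S. gibbs n S l b (x(i := t)) s * (gmean n S l b (x(i := t)) i - s i)\<^sup>2)) (at t)"
proof -
  define e where "e s t = exp (l * dot n (x(i := t)) s + b s)" for s t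
  have eq: "dot n (x(i := t)) s = t * s i + (\<Sum>j\<in>{..<n} - {i}. x j * s j)" for t s
    unfolding dot_def using i by (subst sum.remove[of _ i]) (auto intro!: sum.cong)
  have e: "(e s has_real_derivative l * s i * e s t) (at t)" for s t
    unfolding e_def[abs_def] eq by (rule derivative_eq_intros refl | simp)+
  define Z N where "Z t = (\<Sum>s\<in>S. e s t)" and "N t = (\<Sum>s\<in>S. e s t * s i)" for t
  have Z: "Z t > 0" for t unfolding Z_def e_def by (rule partition_pos)
  have gm: "gmean n S l b (x(i := t)) i = N t / Z t" for t
    by (simp add: gmean_def gibbs_def N_def Z_def e_def sum_divide_distrib)
  have gi: "gibbs n S l b (x(i := t)) s = e s t / Z t" for t s
    by (simp add: gibbs_def Z_def e_def)
  have dZ: "(Z has_real_derivative (\<Sum>s\<in>S. l * s i * e s t)) (at t)"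
    unfolding Z_def[abs_def] by (intro DERIV_sum e)
  have dN: "(N has_real_derivative (\<Sum>s\<in>S. l * s i * e s t * s i)) (at t)"
    unfolding N_def[abs_def] by (intro DERIV_sum DERIV_cmult_right e)
  have "((\<lambda>t. N t / Z t) has_real_derivative
      ((\<Sum>s\<in>S. l * s i * e s t * s i) * Z t - N t * (\<Sum>s\<in>S. l * s i * e s t)) / (Z t * Z t)) (at t)"
    by (rule DERIV_divide[OF dN dZ]) (use Z[of t] in auto)
  also have "((\<Sum>s\<in>S. l * s i * e s t * s i) * Z t - N t * (\<Sum>s\<in>S. l * s i * e s t)) / (Z t * Z t)
      = l * (\<Sum>s\<in>S. gibbs n S l b (x(i := t)) s * (gmean n S l b (x(i := t)) i - s i)\<^sup>2)"
  proof -
    define A where "A = (\<Sum>s\<in>S. e s t * (s i)\<^sup>2)"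
    have 1: "(\<Sum>s\<in>S. l * s i * e s t * s i) = l * A"
      by (simp add: A_def sum_distrib_left power2_eq_square mult_ac)
    have 2: "(\<Sum>s\<in>S. l * s i * e s t) = l * N t"
      by (simp add: N_def sum_distrib_left mult_ac)
    have "(\<Sum>s\<in>S. e s t / Z t * (N t / Z t - s i)\<^sup>2)
        = (\<Sum>s\<in>S. (N t / Z t)\<^sup>2 / Z t * e s t - 2 * (N t / Z t) / Z t * (e s t * s i) + 1 / Z t * (e s t * (s i)\<^sup>2))"
      by (intro sum.cong refl) (simp add: power2_diff algebra_simps add_divide_distrib diff_divide_distrib)
    also have "\<dots> = (N t / Z t)\<^sup>2 / Z t * Z t - 2 * (N t / Z t) / Z t * N t + 1 / Z t * A"
      by (simp only: sum.distrib sum_subtractf sum_distrib_left[symmetric] Z_def[of t, symmetric] N_def[of t, symmetric] A_def[symmetric])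
    also have "\<dots> = (A * Z t - N t * N t) / (Z t * Z t)"
      using Z[of t] by (simp add: power2_eq_square field_simps)
    finally show ?thesis unfolding 1 2 gm gi by (simp add: right_diff_distrib mult_ac)
  qed
  finally show ?thesis unfolding gm .
qed

lemma isCont_gibbs_coord: "isCont (\<lambda>t. gibbs n S l b (x(i := t)) s) t"
proof -
  have "isCont (\<lambda>t. (x(i := t)) j) t" for j by (cases "j = i") auto
  then have [continuous_intros]: "isCont (\<lambda>t. dot n (x(i := t)) r) t" for r
    unfolding dot_def by (intro continuous_intros)
  show ?thesis unfolding gibbs_def
    using partition_pos[of "x(i := t)"] by (intro continuous_intros) auto
qed

lemma tame_spread: "tame n (spread n S l b)"
  unfolding spread_def[abs_def] by (intro tame_sum tame_mult tame_gibbs tame_gmean_diff_sq)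

text \<open>By Stein's identity the left-hand side is the mean of the scalar product of
  \<open>g\<close> with \<open>gmean\<close>, which is a Gibbs average of the values
  \<open>dot n g s\<close> and so at most their maximum. The weights \<open>b\<close> affect the
  average but not the maximum.\<close>

lemma spread_integral_le:
  "l * (\<integral>g. spread n S l b g \<partial>std_gaussian n) \<le> (\<integral>g. hmax n S (\<lambda>_. 0) g \<partial>std_gaussian n)"
proof -
  let ?v = "\<lambda>i g. \<Sum>s\<in>S. gibbs n S l b g s * (gmean n S l b g i - s i)\<^sup>2"
  have vt: "tame n (?v i)" for i
    by (intro tame_sum tame_mult tame_gibbs tame_power tame_diff tame_gmean tame_const)
  have st: "(\<integral>g. g i * gmean n S l b g i \<partial>std_gaussian n) = (\<integral>g. l * ?v i g \<partial>std_gaussian n)" if i: "i < n" for i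
  proof (rule stein_std_gaussian[OF i])
    show "isCont (\<lambda>t. l * ?v i (x(i := t))) t" for x t
      unfolding gmean_def by (intro continuous_intros isCont_gibbs_coord)
  qed (auto intro!: tame_gmean tame_mult vt gmean_derivative[OF i])
  have "spread n S l b g = (\<Sum>i<n. ?v i g)" for g
    unfolding spread_def sum_distrib_left by (rule sum.swap)
  then have "(\<integral>g. spread n S l b g \<partial>std_gaussian n) = (\<Sum>i<n. \<integral>g. ?v i g \<partial>std_gaussian n)"
    using Bochner_Integration.integral_sum[of "{..<n}" "std_gaussian n" ?v] tame_integrable[OF vt] by presburger
  then have "l * (\<integral>g. spread n S l b g \<partial>std_gaussian n) = (\<Sum>i<n. \<integral>g. l * ?v i g \<partial>std_gaussian n)"
    by (simp only: sum_distrib_left[of l "\<lambda>i. \<integral>g. ?v i g \<partial>std_gaussian n"] integral_mult_right_zero)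
  also have "\<dots> = (\<Sum>i<n. \<integral>g. g i * gmean n S l b g i \<partial>std_gaussian n)"
    by (intro sum.cong refl st[symmetric]) auto
  also have "\<dots> = (\<integral>g. (\<Sum>i<n. g i * gmean n S l b g i) \<partial>std_gaussian n)"
    by (rule Bochner_Integration.integral_sum[symmetric]) (auto intro!: tame_integrable tame_mult tame_coord tame_gmean)
  also have "\<dots> \<le> (\<integral>g. hmax n S (\<lambda>_. 0) g \<partial>std_gaussian n)"
  proof (rule integral_mono_tame)
    show "tame n (\<lambda>g. \<Sum>i<n. g i * gmean n S l b g i)"
      by (intro tame_sum tame_mult tame_coord tame_gmean) auto
    show "tame n (hmax n S (\<lambda>_. 0))" by (rule tame_hmax[OF S])
    fix g
    have "(\<Sum>i<n. g i * gmean n S l b g i) = (\<Sum>i<n. \<Sum>s\<in>S. gibbs n S l b g s * (g i * s i))"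
      by (simp add: gmean_def sum_distrib_left mult_ac)
    also have "\<dots> = (\<Sum>s\<in>S. gibbs n S l b g s * dot n g s)"
      by (subst sum.swap) (simp add: dot_def sum_distrib_left)
    also have "\<dots> \<le> hmax n S (\<lambda>_. 0) g"
      by (rule avg_le[OF S(1) gibbs_nonneg sum_gibbs])
        (use hmax_ge[OF S, of _ n g "\<lambda>_. 0"] in simp)
    finally show "(\<Sum>i<n. g i * gmean n S l b g i) \<le> hmax n S (\<lambda>_. 0) g" .
  qed
  finally show ?thesis .
qed

lemma hmax_le_lse: "hmax n S (\<lambda>s. b s / l) g \<le> lse n S l b g"
  unfolding hmax_le_iff[OF S]
proof
  fix s assume s: "s \<in> S"
  have "exp (l * dot n g s + b s) \<le> (\<Sum>r\<in>S. exp (l * dot n g r + b r))"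
    by (rule member_le_sum[OF s, of "\<lambda>r. exp (l * dot n g r + b r)"]) (use S in auto)
  then have "l * dot n g s + b s \<le> l * lse n S l b g"
    using l partition_pos[of g] by (simp add: lse_def ln_ge_iff)
  then have "l * (dot n g s + b s / l) \<le> l * lse n S l b g" using l by (simp add: distrib_left)
  then show "dot n g s + b s / l \<le> lse n S l b g" using l by simp
qed

lemma lse_le_hmax: "lse n S l b g \<le> hmax n S (\<lambda>s. b s / l) g + ln (card S) / l"
proof -
  let ?h = "hmax n S (\<lambda>s. b s / l) g"
  have "(\<Sum>s\<in>S. exp (l * dot n g s + b s)) \<le> (\<Sum>s\<in>S. exp (l * ?h))"
  proof (rule sum_mono)
    fix s assume "s \<in> S"
    then have "l * (dot n g s + b s / l) \<le> l * ?h" using l by (intro mult_left_mono hmax_ge[OF S]) auto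
    then show "exp (l * dot n g s + b s) \<le> exp (l * ?h)" using l by (simp add: distrib_left)
  qed
  also have "\<dots> = real (card S) * exp (l * ?h)" by simp
  finally have "ln (\<Sum>s\<in>S. exp (l * dot n g s + b s)) \<le> ln (real (card S) * exp (l * ?h))"
    using partition_pos[of g] by (simp add: ln_mono)
  also have "\<dots> = ln (card S) + l * ?h" using S by (simp add: ln_mult card_gt_0_iff)
  finally show ?thesis using l by (simp add: lse_def field_simps)
qed

end

section \<open>Changing the temperature\<close>

text \<open>Relative to its value at the origin, a component weight lies between
  \<open>exp (- (2 * hi * B) * l1 n g)\<close> and \<open>exp (2 * hi * B * l1 n g)\<close>,
  whatever \<open>b\<close> is. Hence its normalized first moment is bounded uniformly in
  \<open>b\<close> and \<open>l\<close>. This makes the error constant of \<open>lse_step\<close>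
  the same for all steps of the flow.\<close>

lemma gibbs_l1_moment_le:
  fixes S :: "(nat \<Rightarrow> real) set"
  assumes S: "finite S" "S \<noteq> {}" and l: "0 < l" "l \<le> hi" and s: "s \<in> S"
    and B: "B \<ge> 0" "\<And>s i. s \<in> S \<Longrightarrow> i < n \<Longrightarrow> \<bar>s i\<bar> \<le> B"
  shows "(\<integral>g. gibbs n S l b g s * l1 n g \<partial>std_gaussian n)
    \<le> (\<integral>g. exp (2 * hi * B * l1 n g) * l1 n g \<partial>std_gaussian n) / (\<integral>g. exp (- (2 * hi * B) * l1 n g) \<partial>std_gaussian n)
      * (\<integral>g. gibbs n S l b g s \<partial>std_gaussian n)"
proof -
  define p0 where "p0 = gibbs n S l b (\<lambda>_. 0) s"
  have p0: "p0 > 0" unfolding p0_def by (rule gibbs_pos[OF S l(1)])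
  have ratio: "gibbs n S l b g s = p0 * exp (l * (dot n g s - (lse n S l b g - lse n S l b (\<lambda>_. 0))))" for g
    unfolding p0_def gibbs_eq[OF S l(1)] exp_add[symmetric] by (simp add: dot_def algebra_simps)
  have ex: "\<bar>l * (dot n g s - (lse n S l b g - lse n S l b (\<lambda>_. 0)))\<bar> \<le> 2 * hi * B * l1 n g" for g
  proof -
    have "\<bar>dot n g s\<bar> \<le> B * l1 n g" by (intro abs_dot_le_l1 B(2) s)
    moreover have "\<bar>lse n S l b g - lse n S l b (\<lambda>_. 0)\<bar> \<le> B * l1 n g"
      using B(2) by (rule abs_lse_diff_zero_le[OF S l(1)])
    ultimately have "l * \<bar>dot n g s - (lse n S l b g - lse n S l b (\<lambda>_. 0))\<bar> \<le> hi * (2 * (B * l1 n g))"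
      using l by (intro mult_mono) auto
    then show ?thesis using l by (simp add: abs_mult mult_ac)
  qed
  let ?U = "\<integral>g. exp (2 * hi * B * l1 n g) * l1 n g \<partial>std_gaussian n"
  let ?L = "\<integral>g. exp (- (2 * hi * B) * l1 n g) \<partial>std_gaussian n"
  have L: "?L > 0"
  proof -
    have "?L \<noteq> 0"
    proof
      assume "?L = 0"
      then have "AE g in std_gaussian n. exp (- (2 * hi * B) * l1 n g) = 0"
        by (subst (asm) integral_nonneg_eq_0_iff_AE[OF integrable_exp_l1]) auto
      then show False using prob_space.AE_False[OF prob_space_std_gaussian] by simp
    qed
    moreover have "?L \<ge> 0" by simp
    ultimately show ?thesis by linarith
  qed
  have "(\<integral>g. gibbs n S l b g s * l1 n g \<partial>std_gaussian n) \<le> (\<integral>g. p0 * (exp (2 * hi * B * l1 n g) * l1 n g) \<partial>std_gaussian n)"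
  proof (rule integral_mono_tame)
    fix g
    have "gibbs n S l b g s \<le> p0 * exp (2 * hi * B * l1 n g)"
      unfolding ratio using p0 ex[of g] by (auto simp: abs_le_iff)
    from mult_right_mono[OF this l1_nonneg[of n g]]
    show "gibbs n S l b g s * l1 n g \<le> p0 * (exp (2 * hi * B * l1 n g) * l1 n g)" by (simp add: mult_ac)
  qed (intro tame_mult tame_gibbs[OF S l(1) s] tame_l1 tame_const tame_exp_l1)+
  also have "\<dots> = p0 * ?U" by simp
  finally have up: "(\<integral>g. gibbs n S l b g s * l1 n g \<partial>std_gaussian n) \<le> p0 * ?U" .
  have "p0 * ?L = (\<integral>g. p0 * exp (- (2 * hi * B) * l1 n g) \<partial>std_gaussian n)" by simp
  also have "\<dots> \<le> (\<integral>g. gibbs n S l b g s \<partial>std_gaussian n)"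
  proof (rule integral_mono_tame)
    show "p0 * exp (- (2 * hi * B) * l1 n g) \<le> gibbs n S l b g s" for g
      unfolding ratio using p0 ex[of g] by (auto simp: abs_le_iff)
  qed (intro tame_mult tame_gibbs[OF S l(1) s] tame_const tame_exp_l1)+
  finally have lo: "p0 * ?L \<le> (\<integral>g. gibbs n S l b g s \<partial>std_gaussian n)" .
  have U: "?U \<ge> 0" by (intro integral_nonneg_AE AE_I2) (simp_all add: l1_nonneg)
  have "p0 * ?U = ?U / ?L * (p0 * ?L)" using L by simp
  also have "\<dots> \<le> ?U / ?L * (\<integral>g. gibbs n S l b g s \<partial>std_gaussian n)"
    using U L by (intro mult_left_mono lo) auto
  finally show ?thesis using up by linarith
qed

text \<open>The new weights \<open>b + (l' - l) m\<close> re-centre the gap \<open>lse - dot g s\<close> at its mean \<open>m s\<close> under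
  the component \<open>gibbs s\<close> of the Gaussian mixture. This kills the first-order bias, and the Poincare
  inequality for the component controls the remaining fluctuation.\<close>

lemma lse_step:
  fixes S :: "(nat \<Rightarrow> real) set"
  assumes S: "finite S" "S \<noteq> {}" and lo: "0 < lo"
    and W: "(\<integral>g. hmax n S (\<lambda>_. 0) g \<partial>std_gaussian n) \<le> W"
  obtains c where "c \<ge> 0" "\<And>l l' b. lo \<le> l \<Longrightarrow> l \<le> hi \<Longrightarrow> lo \<le> l' \<Longrightarrow>
    \<exists>b'. l2 n (\<lambda>g. lse n S l' b' g - lse n S l b g) \<le> \<bar>l' - l\<bar> / l' * sqrt (W / l) + c * (l' - l)\<^sup>2"
proof -
  obtain B where B: "B \<ge> 0" "\<And>s i. s \<in> S \<Longrightarrow> i < n \<Longrightarrow> \<bar>s i\<bar> \<le> B"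
    using finite_coord_bound[OF S(1), of n] by metis
  define K where "K = (\<integral>g. exp (2 * hi * B * l1 n g) * l1 n g \<partial>std_gaussian n)
    / (\<integral>g. exp (- (2 * hi * B) * l1 n g) \<partial>std_gaussian n)"
  have K: "K \<ge> 0" unfolding K_def by (intro divide_nonneg_nonneg integral_nonneg_AE AE_I2) (simp_all add: l1_nonneg)
  \<comment> \<open>Dominates all centred gaps: a gap moves by at most \<open>2 * B * l1 n g\<close>
    away from the value of \<open>lse\<close> at 0, and its component mean by at most
    \<open>2 * B * K\<close>.\<close>
  define R where "R g = 2 * B * (l1 n g + K)" for g
  have Rt: "tame n R" unfolding R_def[abs_def] by (intro tame_mult tame_add) auto
  have R: "R g \<ge> 0" for g using B K l1_nonneg[of n g] by (simp add: R_def)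
  define c where "c = 4 * l2 n (\<lambda>g. (R g)\<^sup>2) / lo"
  show thesis
  proof
    show "c \<ge> 0" unfolding c_def using lo by (simp add: l2_nonneg)
    fix l l' b assume ll: "lo \<le> l" "l \<le> hi" "lo \<le> l'"
    then have l: "l > 0" "l' > 0" using lo by auto
    let ?\<pi> = "\<lambda>g s. gibbs n S l b g s" and ?G = "lse n S l b"
    let ?p = "\<lambda>s. \<integral>g. ?\<pi> g s \<partial>std_gaussian n"
    define m where "m s = (\<integral>g. ?\<pi> g s * (?G g - dot n g s) \<partial>std_gaussian n) / ?p s" for s
    define Y where "Y s g = ?G g - dot n g s - m s" for s g
    define \<delta> where "\<delta> = l' - l"
    define b' where "b' s = b s + \<delta> * m s" for s
    note \<pi>t = tame_gibbs[OF S l(1)] and Gt = tame_lse[OF S l(1)]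
    have Yt: "tame n (Y s)" for s unfolding Y_def[abs_def] by (intro tame_diff Gt tame_dot tame_const)
    have lip: "\<bar>?G g - ?G (\<lambda>_. 0) - dot n g s\<bar> \<le> 2 * B * l1 n g" if s: "s \<in> S" for s g
    proof -
      have "\<bar>dot n g s\<bar> \<le> B * l1 n g" by (intro abs_dot_le_l1 B(2) s)
      moreover have "\<bar>?G g - ?G (\<lambda>_. 0)\<bar> \<le> B * l1 n g"
        using B(2) by (rule abs_lse_diff_zero_le[OF S l(1)])
      ultimately show ?thesis by linarith
    qed
    have mb: "\<bar>m s - ?G (\<lambda>_. 0)\<bar> \<le> 2 * B * K" if s: "s \<in> S" for s
    proof -
      have p: "?p s > 0" by (rule gibbs_mass_pos[OF S l(1) s])
      have t: "tame n (\<lambda>g. ?\<pi> g s * (?G g - ?G (\<lambda>_. 0) - dot n g s))"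
        by (intro tame_mult \<pi>t s tame_diff Gt tame_dot tame_const)
      have "(\<integral>g. ?\<pi> g s * (?G g - ?G (\<lambda>_. 0) - dot n g s) \<partial>std_gaussian n)
          = (\<integral>g. ?\<pi> g s * (?G g - dot n g s) - ?G (\<lambda>_. 0) * ?\<pi> g s \<partial>std_gaussian n)"
        by (intro Bochner_Integration.integral_cong refl) (simp add: algebra_simps)
      also have "\<dots> = m s * ?p s - ?G (\<lambda>_. 0) * ?p s"
        using p tame_integrable[OF \<pi>t[OF s]] tame_integrable[OF tame_mult[OF \<pi>t[OF s] tame_diff[OF Gt tame_dot]]]
        by (simp add: m_def)
      finally have eq: "(m s - ?G (\<lambda>_. 0)) * ?p s = (\<integral>g. ?\<pi> g s * (?G g - ?G (\<lambda>_. 0) - dot n g s) \<partial>std_gaussian n)"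
        by (simp add: left_diff_distrib)
      have "\<bar>(m s - ?G (\<lambda>_. 0)) * ?p s\<bar> \<le> (\<integral>g. \<bar>?\<pi> g s * (?G g - ?G (\<lambda>_. 0) - dot n g s)\<bar> \<partial>std_gaussian n)"
        unfolding eq by (rule integral_abs_bound)
      also have "\<dots> \<le> (\<integral>g. 2 * B * (?\<pi> g s * l1 n g) \<partial>std_gaussian n)"
      proof (rule integral_mono_tame)
        fix g
        have "\<bar>?\<pi> g s * (?G g - ?G (\<lambda>_. 0) - dot n g s)\<bar> \<le> ?\<pi> g s * (2 * B * l1 n g)"
          unfolding abs_mult using gibbs_nonneg[OF S l(1)] lip[OF s, of g]
          by (simp add: mult_left_mono del: mult_le_cancel_left_pos)
        then show "\<bar>?\<pi> g s * (?G g - ?G (\<lambda>_. 0) - dot n g s)\<bar> \<le> 2 * B * (?\<pi> g s * l1 n g)" by (simp add: mult_ac)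
      qed (use t in \<open>auto intro!: tame_mult \<pi>t s tame_abs\<close>)
      also have "\<dots> = 2 * B * (\<integral>g. ?\<pi> g s * l1 n g \<partial>std_gaussian n)" by simp
      also have "\<dots> \<le> 2 * B * (K * ?p s)"
        unfolding K_def using B by (intro mult_left_mono gibbs_l1_moment_le S l ll s) auto
      finally have "\<bar>m s - ?G (\<lambda>_. 0)\<bar> * ?p s \<le> 2 * B * K * ?p s" using p by (simp add: abs_mult mult_ac)
      then show ?thesis using p by simp
    qed
    have YR: "\<bar>- \<delta> * Y s g\<bar> \<le> \<bar>\<delta>\<bar> * R g" if s: "s \<in> S" for s g
    proof -
      have "\<bar>Y s g\<bar> \<le> R g" using lip[OF s, of g] mb[OF s] by (simp add: Y_def R_def distrib_left)
      then show ?thesis by (simp add: abs_mult mult_left_mono)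
    qed
    have pt: "\<bar>lse n S l' b' g - ?G g\<bar> \<le> \<bar>\<delta>\<bar> / l' * \<bar>\<Sum>s\<in>S. ?\<pi> g s * Y s g\<bar> + 4 * \<delta>\<^sup>2 / l' * (R g)\<^sup>2" for g
    proof -
      note avg = S(1) gibbs_nonneg[OF S l(1)] sum_gibbs[OF S l(1), of n b g]
      define A where "A = (\<Sum>s\<in>S. ?\<pi> g s * exp (- \<delta> * Y s g))"
      have A: "A > 0" unfolding A_def by (rule avg_exp_pos[OF avg])
      have "l' * lse n S l' b' g - l * ?G g
          = ln (\<Sum>s\<in>S. ?\<pi> g s * exp ((l' * dot n g s + b' s) - (l * dot n g s + b s)))"
        using ln_partition_diff[OF S l(1), of "\<lambda>s. l' * dot n g s + b' s" n b g] l(2) by (simp add: lse_def)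
      also have "(\<Sum>s\<in>S. ?\<pi> g s * exp ((l' * dot n g s + b' s) - (l * dot n g s + b s))) = exp (\<delta> * ?G g) * A"
      proof -
        have "(l' * dot n g s + b' s) - (l * dot n g s + b s) = \<delta> * ?G g + - \<delta> * Y s g" for s
          by (simp add: b'_def \<delta>_def Y_def algebra_simps)
        then show ?thesis by (simp only: A_def exp_add sum_distrib_left mult_ac)
      qed
      also have "ln \<dots> = \<delta> * ?G g + ln A" using A by (simp add: ln_mult)
      \<comment> \<open>Since \<open>b'\<close> contains \<open>\<delta> * m s\<close>, the
        increment is the logarithm of an exponential average of the centred gaps alone.\<close>
      finally have eq: "l' * (lse n S l' b' g - ?G g) = ln A" by (simp add: \<delta>_def algebra_simps)
      define M where "M = (\<Sum>s\<in>S. ?\<pi> g s * (- \<delta> * Y s g))"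
      have M: "M = - \<delta> * (\<Sum>s\<in>S. ?\<pi> g s * Y s g)" by (simp add: M_def sum_distrib_left mult_ac)
      have "M \<le> ln A" unfolding M_def A_def by (rule avg_le_ln_avg_exp[OF avg])
      moreover have "ln A \<le> M + 4 * (\<bar>\<delta>\<bar> * R g)\<^sup>2"
        unfolding M_def A_def using R[of g] by (intro ln_avg_exp_le[OF avg YR]) auto
      ultimately have "\<bar>ln A\<bar> \<le> \<bar>M\<bar> + 4 * \<delta>\<^sup>2 * (R g)\<^sup>2" by (simp add: power_mult_distrib)
      then have "l' * \<bar>lse n S l' b' g - ?G g\<bar> \<le> \<bar>\<delta>\<bar> * \<bar>\<Sum>s\<in>S. ?\<pi> g s * Y s g\<bar> + 4 * \<delta>\<^sup>2 * (R g)\<^sup>2"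
        unfolding eq[symmetric] M using l(2) by (simp add: abs_mult)
      then have "\<bar>lse n S l' b' g - ?G g\<bar> \<le> (\<bar>\<delta>\<bar> * \<bar>\<Sum>s\<in>S. ?\<pi> g s * Y s g\<bar> + 4 * \<delta>\<^sup>2 * (R g)\<^sup>2) / l'"
        using l(2) by (simp add: pos_le_divide_eq mult.commute)
      then show ?thesis by (simp add: add_divide_distrib)
    qed
    have MYt: "tame n (\<lambda>g. \<Sum>s\<in>S. ?\<pi> g s * Y s g)" by (intro tame_sum tame_mult \<pi>t Yt)
    \<comment> \<open>Jensen's inequality for the mixture, then the Poincare inequality for each
      component. The component bounds add up to the mean spread.\<close>
    have "(l2 n (\<lambda>g. \<Sum>s\<in>S. ?\<pi> g s * Y s g))\<^sup>2 \<le> (\<integral>g. (\<Sum>s\<in>S. ?\<pi> g s * (Y s g)\<^sup>2) \<partial>std_gaussian n)"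
      unfolding l2_power2
      by (intro integral_mono_tame tame_power MYt tame_sum tame_mult \<pi>t Yt
          avg_power2_le[OF S(1) gibbs_nonneg[OF S l(1)] sum_gibbs[OF S l(1)]]) auto
    also have "\<dots> = (\<Sum>s\<in>S. \<integral>g. ?\<pi> g s * (Y s g)\<^sup>2 \<partial>std_gaussian n)"
      by (intro Bochner_Integration.integral_sum tame_integrable tame_mult \<pi>t tame_power Yt)
    also have "\<dots> \<le> (\<Sum>s\<in>S. \<integral>g. ?\<pi> g s * (\<Sum>i<n. (gmean n S l b g i - s i)\<^sup>2) \<partial>std_gaussian n)"
      unfolding Y_def m_def by (intro sum_mono gibbs_variance[OF S l(1)])
    also have "\<dots> = (\<integral>g. spread n S l b g \<partial>std_gaussian n)"
      unfolding spread_def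
      by (intro Bochner_Integration.integral_sum[symmetric] tame_integrable tame_mult \<pi>t tame_gmean_diff_sq[OF S l(1)])
    also have "\<dots> \<le> W / l"
      using spread_integral_le[OF S l(1), of n b] W l(1) by (simp add: field_simps)
    finally have MY: "l2 n (\<lambda>g. \<Sum>s\<in>S. ?\<pi> g s * Y s g) \<le> sqrt (W / l)"
      using real_le_rsqrt by blast
    have "l2 n (\<lambda>g. lse n S l' b' g - ?G g)
        \<le> l2 n (\<lambda>g. \<bar>\<delta>\<bar> / l' * \<bar>\<Sum>s\<in>S. ?\<pi> g s * Y s g\<bar> + 4 * \<delta>\<^sup>2 / l' * (R g)\<^sup>2)"
    proof (rule l2_mono)
      show "tame n (\<lambda>g. lse n S l' b' g - ?G g)" by (intro tame_diff tame_lse S l)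
      show "tame n (\<lambda>g. \<bar>\<delta>\<bar> / l' * \<bar>\<Sum>s\<in>S. ?\<pi> g s * Y s g\<bar> + 4 * \<delta>\<^sup>2 / l' * (R g)\<^sup>2)"
        by (intro tame_add tame_mult tame_const tame_abs tame_power MYt Rt)
      show "\<bar>lse n S l' b' g - ?G g\<bar> \<le> \<bar>\<bar>\<delta>\<bar> / l' * \<bar>\<Sum>s\<in>S. ?\<pi> g s * Y s g\<bar> + 4 * \<delta>\<^sup>2 / l' * (R g)\<^sup>2\<bar>" for g
        using pt[of g] by linarith
    qed
    also have "\<dots> \<le> l2 n (\<lambda>g. \<bar>\<delta>\<bar> / l' * \<bar>\<Sum>s\<in>S. ?\<pi> g s * Y s g\<bar>) + l2 n (\<lambda>g. 4 * \<delta>\<^sup>2 / l' * (R g)\<^sup>2)"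
      by (intro l2_triangle tame_mult tame_const tame_abs tame_power MYt Rt)
    also have "\<dots> = \<bar>\<delta>\<bar> / l' * l2 n (\<lambda>g. \<Sum>s\<in>S. ?\<pi> g s * Y s g) + 4 * \<delta>\<^sup>2 / l' * l2 n (\<lambda>g. (R g)\<^sup>2)"
      unfolding l2_cmult using l(2) by (simp add: l2_def)
    also have "\<dots> \<le> \<bar>\<delta>\<bar> / l' * sqrt (W / l) + c * \<delta>\<^sup>2"
    proof (rule add_mono)
      show "\<bar>\<delta>\<bar> / l' * l2 n (\<lambda>g. \<Sum>s\<in>S. ?\<pi> g s * Y s g) \<le> \<bar>\<delta>\<bar> / l' * sqrt (W / l)"
        using l by (intro mult_left_mono MY) auto
      have "4 * \<delta>\<^sup>2 * l2 n (\<lambda>g. (R g)\<^sup>2) / l' \<le> 4 * \<delta>\<^sup>2 * l2 n (\<lambda>g. (R g)\<^sup>2) / lo"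
        using ll lo by (intro divide_left_mono mult_nonneg_nonneg) (auto simp: l2_nonneg)
      then show "4 * \<delta>\<^sup>2 / l' * l2 n (\<lambda>g. (R g)\<^sup>2) \<le> c * \<delta>\<^sup>2" by (simp add: c_def mult_ac)
    qed
    finally show "\<exists>b'. l2 n (\<lambda>g. lse n S l' b' g - lse n S l b g) \<le> \<bar>l' - l\<bar> / l' * sqrt (W / l) + c * (l' - l)\<^sup>2"
      unfolding \<delta>_def by blast
  qed
qed

lemma inverse_sqrt_diff:
  assumes "a > 0" "b > 0"
  shows "\<bar>1 / sqrt a - 1 / sqrt b\<bar> * (sqrt a * sqrt b * (sqrt a + sqrt b)) = \<bar>b - a\<bar>"
proof -
  have sq: "sqrt a > 0" "sqrt b > 0" using assms by auto
  then have "(1 / sqrt a - 1 / sqrt b) * (sqrt a * sqrt b * (sqrt a + sqrt b)) = (sqrt b - sqrt a) * (sqrt b + sqrt a)"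
    by (simp add: field_simps)
  also have "\<dots> = b - a" using assms by (simp add: algebra_simps)
  finally show ?thesis using sq by (metis abs_mult abs_of_pos add_pos_pos mult_pos_pos)
qed

text \<open>The ideal cost is the integral of \<open>sqrt (W / l) / l\<close> and would give the
  factor 2. The factor 3 leaves room for discretization: 5/2 for the first-order term and 1/2 for
  the quadratic error.\<close>

lemma step_cost_le:
  fixes l l' lo hi W c :: real
  assumes "0 < lo" "lo \<le> l" "l \<le> hi" "lo \<le> l'" "l' \<le> hi" "W > 0" "c \<ge> 0"
    and small: "\<bar>l' - l\<bar> \<le> lo" "c * \<bar>l' - l\<bar> * (4 * hi * sqrt hi) \<le> sqrt W"
  shows "\<bar>l' - l\<bar> / l' * sqrt (W / l) + c * (l' - l)\<^sup>2 \<le> 3 * sqrt W * \<bar>1 / sqrt l - 1 / sqrt l'\<bar>"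
proof -
  have l: "l > 0" "l' > 0" using assms by auto
  define X where "X = \<bar>1 / sqrt l - 1 / sqrt l'\<bar>"
  define a where "a = sqrt l" 
  define b where "b = sqrt l'"
  have ab: "a > 0" "b > 0" "a * a = l" "b * b = l'" using l by (auto simp: a_def b_def)
  have D: "\<bar>l' - l\<bar> = X * (a * b * (a + b))"
    using inverse_sqrt_diff[OF l] by (simp add: X_def a_def b_def)
  have X: "X \<ge> 0" by (simp add: X_def)
  \<comment> \<open>A step of size at most \<open>lo\<close> gives \<open>l \<le> 2 * l'\<close>,
    and the square root of 2 is below 3/2.\<close>
  have "a \<le> 3 / 2 * b"
  proof -
    have "l \<le> 2 * l'" using assms by linarith
    then have "l \<le> (3 / 2 * b)\<^sup>2" using ab l by (simp add: power2_eq_square)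
    then show ?thesis unfolding a_def using ab by (intro real_le_lsqrt) auto
  qed
  have "\<bar>l' - l\<bar> / l' * sqrt (W / l) = X * sqrt W * ((a + b) / b)"
    unfolding D using ab l by (simp add: real_sqrt_divide a_def[symmetric] ab(4)[symmetric])
  also have "\<dots> \<le> X * sqrt W * (5 / 2)"
    using \<open>a \<le> 3 / 2 * b\<close> ab X assms by (intro mult_left_mono) (auto simp: field_simps)
  finally have 1: "\<bar>l' - l\<bar> / l' * sqrt (W / l) \<le> X * sqrt W * (5 / 2)" .
  have h: "a \<le> sqrt hi" "b \<le> sqrt hi" using assms by (auto simp: a_def b_def)
  have "a * b * (a + b) \<le> sqrt hi * sqrt hi * (sqrt hi + sqrt hi)"
    using h ab assms by (intro mult_mono add_mono) auto
  also have "\<dots> = 2 * hi * sqrt hi" using assms by simp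
  finally have h2: "a * b * (a + b) \<le> 2 * hi * sqrt hi" .
  have "c * (l' - l)\<^sup>2 = c * \<bar>l' - l\<bar> * \<bar>l' - l\<bar>" by (simp add: power2_eq_square abs_mult[symmetric])
  also have "\<dots> = X * (c * \<bar>l' - l\<bar> * (a * b * (a + b)))" using D by (metis mult.assoc mult.commute)
  also have "\<dots> \<le> X * (c * \<bar>l' - l\<bar> * (2 * hi * sqrt hi))"
    using X assms by (intro mult_left_mono h2) auto
  also have "\<dots> \<le> X * (sqrt W / 2)"
    using small(2) X by (intro mult_left_mono) auto
  finally have "c * (l' - l)\<^sup>2 \<le> X * (sqrt W / 2)" .
  with 1 show ?thesis unfolding X_def[symmetric] by (simp add: algebra_simps)
qed

text \<open>The path is cut into equal steps, so fine that the quadratic errors are absorbed. As the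
  path is monotone, the costs telescope, and the step constant \<open>c\<close>, which depends on
  \<open>S\<close> and \<open>n\<close>, leaves no trace in the result.\<close>

lemma lse_flow:
  fixes S :: "(nat \<Rightarrow> real) set"
  assumes S: "finite S" "S \<noteq> {}" and l: "l > 0" "l' > 0"
    and W: "(\<integral>g. hmax n S (\<lambda>_. 0) g \<partial>std_gaussian n) \<le> W" "W > 0"
  obtains b' where "l2 n (\<lambda>g. lse n S l' b' g - lse n S l b g) \<le> 3 * sqrt W * \<bar>1 / sqrt l - 1 / sqrt l'\<bar>"
proof -
  define lo hi where "lo = min l l'" and "hi = max l l'"
  have lo: "lo > 0" "hi > 0" using l by (auto simp: lo_def hi_def)
  obtain c where c: "c \<ge> 0" "\<And>a a' b. lo \<le> a \<Longrightarrow> a \<le> hi \<Longrightarrow> lo \<le> a' \<Longrightarrow>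
    \<exists>b'. l2 n (\<lambda>g. lse n S a' b' g - lse n S a b g) \<le> \<bar>a' - a\<bar> / a' * sqrt (W / a) + c * (a' - a)\<^sup>2"
    using lse_step[OF S lo(1) W(1)] by metis
  define D where "D = \<bar>l' - l\<bar>"
  obtain N :: nat where N: "N > 0" "D / lo \<le> N" "c * D * (4 * hi * sqrt hi) / sqrt W \<le> N"
  proof -
    obtain N1 N2 :: nat where "D / lo \<le> N1" "c * D * (4 * hi * sqrt hi) / sqrt W \<le> N2"
      using real_arch_simple by metis
    then show thesis by (intro that[of "Suc (max N1 N2)"]) auto
  qed
  define a where "a j = l + real j * ((l' - l) / N)" for j :: nat
  have a0: "a 0 = l" and aN: "a N = l'" using N by (auto simp: a_def)
  have frac: "a j = (1 - j / N) * l + (j / N) * l'" for j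
    by (simp add: a_def algebra_simps diff_divide_distrib)
  have rng: "lo \<le> a j" "a j \<le> hi" if "j \<le> N" for j
  proof -
    have t: "0 \<le> real j / N" "real j / N \<le> 1" using that N by auto
    have "lo = (1 - j / N) * lo + (j / N) * lo" by (simp add: algebra_simps)
    also have "\<dots> \<le> a j" unfolding frac using t by (intro add_mono mult_left_mono) (auto simp: lo_def)
    finally show "lo \<le> a j" .
    have "a j \<le> (1 - j / N) * hi + (j / N) * hi" unfolding frac using t
      by (intro add_mono mult_left_mono) (auto simp: hi_def)
    also have "\<dots> = hi" by (simp add: algebra_simps)
    finally show "a j \<le> hi" .
  qed
  have step: "\<bar>a (Suc j) - a j\<bar> = D / N" for j
  proof -
    have "a (Suc j) - a j = (l' - l) / N" by (simp add: a_def algebra_simps add_divide_distrib diff_divide_distrib)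
    then show ?thesis using N by (simp add: D_def abs_divide)
  qed
  have "\<exists>b'. l2 n (\<lambda>g. lse n S (a j) b' g - lse n S l b g) \<le> 3 * sqrt W * \<bar>1 / sqrt l - 1 / sqrt (a j)\<bar>"
    if "j \<le> N" for j
    using that
  proof (induction j)
    case 0
    show ?case by (rule exI[of _ b]) (simp add: a0)
  next
    case (Suc j)
    then obtain b1 where b1: "l2 n (\<lambda>g. lse n S (a j) b1 g - lse n S l b g) \<le> 3 * sqrt W * \<bar>1 / sqrt l - 1 / sqrt (a j)\<bar>"
      by auto
    have r: "lo \<le> a j" "a j \<le> hi" "lo \<le> a (Suc j)" "a (Suc j) \<le> hi" using Suc.prems rng[of j] rng[of "Suc j"] by auto
    obtain b2 where b2: "l2 n (\<lambda>g. lse n S (a (Suc j)) b2 g - lse n S (a j) b1 g)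
        \<le> \<bar>a (Suc j) - a j\<bar> / a (Suc j) * sqrt (W / a j) + c * (a (Suc j) - a j)\<^sup>2"
      using c(2)[OF r(1-3)] by blast
    have "\<dots> \<le> 3 * sqrt W * \<bar>1 / sqrt (a j) - 1 / sqrt (a (Suc j))\<bar>"
    proof (rule step_cost_le[OF lo(1) r W(2) c(1)])
      show "\<bar>a (Suc j) - a j\<bar> \<le> lo" unfolding step using N lo by (simp add: field_simps)
      show "c * \<bar>a (Suc j) - a j\<bar> * (4 * hi * sqrt hi) \<le> sqrt W" unfolding step using N(1,3) W(2)
        by (simp add: field_simps)
    qed
    with b2 have b2': "l2 n (\<lambda>g. lse n S (a (Suc j)) b2 g - lse n S (a j) b1 g)
      \<le> 3 * sqrt W * \<bar>1 / sqrt (a j) - 1 / sqrt (a (Suc j))\<bar>" by linarith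
    have pos: "a j > 0" "a (Suc j) > 0" using r lo by auto
    have mono: "1 / sqrt y \<le> 1 / sqrt x" if "0 < x" "x \<le> y" for x y :: real
      using that by (intro divide_left_mono) auto
    have "\<bar>1 / sqrt l - 1 / sqrt (a j)\<bar> + \<bar>1 / sqrt (a j) - 1 / sqrt (a (Suc j))\<bar> = \<bar>1 / sqrt l - 1 / sqrt (a (Suc j))\<bar>"
    proof (cases "l \<le> l'")
      case True
      then have "l \<le> a j" "a j \<le> a (Suc j)" using N by (auto simp: a_def divide_right_mono mult_right_mono)
      then show ?thesis using mono[of l "a j"] mono[of "a j" "a (Suc j)"] l pos by linarith
    next
      case False
      then have "(l' - l) / N \<le> 0" using N by (simp add: divide_nonpos_pos)
      then have "real j * ((l' - l) / N) \<le> 0" by (intro mult_nonneg_nonpos) auto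
      moreover have "a (Suc j) = a j + (l' - l) / N"
        by (simp add: a_def algebra_simps add_divide_distrib diff_divide_distrib)
      ultimately have "a j \<le> l" "a (Suc j) \<le> a j"
        using \<open>(l' - l) / N \<le> 0\<close> unfolding a_def by linarith+
      then show ?thesis using mono[of "a j" l] mono[of "a (Suc j)" "a j"] l pos by linarith
    qed
    then have tot: "3 * sqrt W * \<bar>1 / sqrt (a j) - 1 / sqrt (a (Suc j))\<bar> + 3 * sqrt W * \<bar>1 / sqrt l - 1 / sqrt (a j)\<bar>
        = 3 * sqrt W * \<bar>1 / sqrt l - 1 / sqrt (a (Suc j))\<bar>"
      by (metis add.commute distrib_left)
    have "l2 n (\<lambda>g. lse n S (a (Suc j)) b2 g - lse n S l b g)
        \<le> l2 n (\<lambda>g. lse n S (a (Suc j)) b2 g - lse n S (a j) b1 g) + l2 n (\<lambda>g. lse n S (a j) b1 g - lse n S l b g)"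
      by (intro l2_diff_triangle tame_lse S pos l)
    then show ?case using b1 b2' tot by (intro exI[of _ b2]) linarith
  qed
  from this[of N] show thesis using that by (auto simp: aN)
qed

section \<open>Random sparsification\<close>

text \<open>The expectation of \<open>\<Phi>\<close> over lists of \<open>N\<close> independent samples with weights \<open>p\<close>.\<close>

fun wavg :: "'a set \<Rightarrow> ('a \<Rightarrow> real) \<Rightarrow> nat \<Rightarrow> ('a list \<Rightarrow> real) \<Rightarrow> real" where
  "wavg T p 0 \<Phi> = \<Phi> []"
| "wavg T p (Suc N) \<Phi> = (\<Sum>s\<in>T. p s * wavg T p N (\<lambda>xs. \<Phi> (s # xs)))"

context
  fixes T :: "'a set" and p :: "'a \<Rightarrow> real"
  assumes T: "finite T" and p: "\<And>s. s \<in> T \<Longrightarrow> p s \<ge> 0" and p1: "(\<Sum>s\<in>T. p s) = 1"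
begin

lemma wavg_mono:
  "(\<And>xs. set xs \<subseteq> T \<Longrightarrow> length xs = N \<Longrightarrow> \<Phi> xs \<le> \<Psi> xs) \<Longrightarrow> wavg T p N \<Phi> \<le> wavg T p N \<Psi>"
proof (induction N arbitrary: \<Phi> \<Psi>)
  case (Suc N)
  show ?case unfolding wavg.simps
    by (intro sum_mono mult_left_mono p Suc.IH) (auto intro!: Suc.prems)
qed simp

text \<open>The first-moment method: some list does at least as well as the average.\<close>

lemma wavg_exists: "\<exists>xs. set xs \<subseteq> T \<and> length xs = N \<and> \<Phi> xs \<le> wavg T p N \<Phi>"
proof (induction N arbitrary: \<Phi>)
  case (Suc N)
  let ?W = "\<lambda>s. wavg T p N (\<lambda>xs. \<Phi> (s # xs))"
  have "\<exists>s\<in>T. ?W s \<le> wavg T p (Suc N) \<Phi>"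
  proof (rule ccontr)
    assume "\<not> ?thesis"
    then have gt: "wavg T p (Suc N) \<Phi> < ?W s" if "s \<in> T" for s using that by auto
    have "\<exists>s\<in>T. p s \<noteq> 0"
    proof (rule ccontr)
      assume "\<not> ?thesis"
      then have "sum p T = 0" by (intro sum.neutral) auto
      then show False using p1 by simp
    qed
    then obtain s where s: "s \<in> T" "p s > 0" using p by (auto simp: less_le)
    have "(\<Sum>s\<in>T. p s * wavg T p (Suc N) \<Phi>) < (\<Sum>s\<in>T. p s * ?W s)"
    proof (rule sum_strict_mono_ex1[OF T])
      show "\<forall>s\<in>T. p s * wavg T p (Suc N) \<Phi> \<le> p s * ?W s"
        by (intro ballI mult_left_mono p less_imp_le[OF gt])
      show "\<exists>s\<in>T. p s * wavg T p (Suc N) \<Phi> < p s * ?W s"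
        using s gt by (intro bexI[of _ s] mult_strict_left_mono) auto
    qed
    moreover have "(\<Sum>s\<in>T. p s * wavg T p (Suc N) \<Phi>) = wavg T p (Suc N) \<Phi>"
      using p1 by (simp add: sum_distrib_right[symmetric] del: wavg.simps)
    ultimately show False by simp
  qed
  then obtain s where s: "s \<in> T" "?W s \<le> wavg T p (Suc N) \<Phi>" by blast
  obtain xs where "set xs \<subseteq> T" "length xs = N" "\<Phi> (s # xs) \<le> ?W s"
    using Suc.IH[of "\<lambda>xs. \<Phi> (s # xs)"] by blast
  then show ?case using s by (intro exI[of _ "s # xs"]) auto
qed auto

lemma wavg_const: "wavg T p N (\<lambda>_. c) = c"
  by (induction N) (simp_all add: sum_distrib_right[symmetric] p1)

lemma wavg_add: "wavg T p N (\<lambda>xs. \<Phi> xs + \<Psi> xs) = wavg T p N \<Phi> + wavg T p N \<Psi>"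
  by (induction N arbitrary: \<Phi> \<Psi>) (simp_all add: distrib_left sum.distrib)

lemma wavg_cmult: "wavg T p N (\<lambda>xs. c * \<Phi> xs) = c * wavg T p N \<Phi>"
  by (induction N arbitrary: \<Phi>) (simp_all add: sum_distrib_left mult_ac)

lemma wavg_sum_list: "wavg T p N (\<lambda>xs. sum_list (map f xs)) = N * (\<Sum>s\<in>T. p s * f s)"
proof (induction N)
  case (Suc N)
  let ?m = "\<Sum>s\<in>T. p s * f s"
  have "wavg T p (Suc N) (\<lambda>xs. sum_list (map f xs)) = (\<Sum>s\<in>T. p s * f s + (N * ?m) * p s)"
    by (simp add: wavg_add wavg_const Suc.IH distrib_left mult.commute)
  also have "\<dots> = ?m + N * ?m"
    by (simp only: sum.distrib sum_distrib_left[symmetric] p1 mult_1_right)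
  finally show ?case by (simp add: distrib_right)
qed simp

text \<open>Variances of independent centred samples add up. The offset \<open>c\<close> serves the
  induction: it collects the samples already drawn.\<close>

lemma wavg_sum_list_power2:
  assumes "(\<Sum>s\<in>T. p s * f s) = 0"
  shows "wavg T p N (\<lambda>xs. (c + sum_list (map f xs))\<^sup>2) = c\<^sup>2 + N * (\<Sum>s\<in>T. p s * (f s)\<^sup>2)"
proof (induction N arbitrary: c)
  case (Suc N)
  let ?v = "\<Sum>s\<in>T. p s * (f s)\<^sup>2"
  have "wavg T p (Suc N) (\<lambda>xs. (c + sum_list (map f xs))\<^sup>2) = (\<Sum>s\<in>T. p s * ((c + f s)\<^sup>2 + N * ?v))"
    using Suc.IH[of "c + f _"] by (simp add: add.assoc)
  also have "\<dots> = (\<Sum>s\<in>T. (c\<^sup>2 + N * ?v) * p s + 2 * c * (p s * f s) + p s * (f s)\<^sup>2)"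
    by (intro sum.cong refl) (simp add: power2_eq_square algebra_simps)
  also have "\<dots> = (c\<^sup>2 + N * ?v) + ?v"
    by (simp only: sum.distrib sum_distrib_left[symmetric] p1 assms) simp
  finally show ?case by (simp add: algebra_simps)
qed simp

end

lemma wavg_integral:
  assumes "finite T" "\<And>xs. set xs \<subseteq> T \<Longrightarrow> tame n (\<Phi> xs)"
  shows "tame n (\<lambda>g. wavg T p N (\<lambda>xs. \<Phi> xs g))
    \<and> (\<integral>g. wavg T p N (\<lambda>xs. \<Phi> xs g) \<partial>std_gaussian n) = wavg T p N (\<lambda>xs. \<integral>g. \<Phi> xs g \<partial>std_gaussian n)"
  using assms(2)
proof (induction N arbitrary: \<Phi>)
  case 0
  then show ?case by simp
next
  case (Suc N)
  have IH: "tame n (\<lambda>g. wavg T p N (\<lambda>xs. \<Phi> (s # xs) g))"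
    "(\<integral>g. wavg T p N (\<lambda>xs. \<Phi> (s # xs) g) \<partial>std_gaussian n) = wavg T p N (\<lambda>xs. \<integral>g. \<Phi> (s # xs) g \<partial>std_gaussian n)"
    if "s \<in> T" for s
    using Suc.IH[of "\<lambda>xs. \<Phi> (s # xs)"] Suc.prems that by auto
  have "tame n (\<lambda>g. wavg T p (Suc N) (\<lambda>xs. \<Phi> xs g))"
    unfolding wavg.simps by (intro tame_sum tame_mult tame_const IH)
  moreover have "(\<integral>g. wavg T p (Suc N) (\<lambda>xs. \<Phi> xs g) \<partial>std_gaussian n)
      = (\<Sum>s\<in>T. \<integral>g. p s * wavg T p N (\<lambda>xs. \<Phi> (s # xs) g) \<partial>std_gaussian n)"
    unfolding wavg.simps
    by (intro Bochner_Integration.integral_sum tame_integrable tame_mult tame_const IH)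
  ultimately show ?case using IH by simp
qed

text \<open>The normalized component has integral 1, so its logarithm has mean at most 0. As
  \<open>dot n g s\<close> has mean 0, this bounds the constant \<open>b s - ln p\<close> in the
  exponent by \<open>l\<close> times the mean of \<open>lse\<close>. The remaining part is bounded
  by replacing \<open>dot n g s\<close> with \<open>hmax\<close>.\<close>

lemma density_le:
  fixes T :: "(nat \<Rightarrow> real) set"
  assumes T: "finite T" "T \<noteq> {}" and l: "l > 0" and s: "s \<in> T"
  shows "gibbs n T l b g s \<le> (\<integral>g. gibbs n T l b g s \<partial>std_gaussian n)
    * exp (l * ((\<integral>g. lse n T l b g \<partial>std_gaussian n) + hmax n T (\<lambda>_. 0) g - lse n T l b g))"
proof -
  let ?G = "lse n T l b"
  define p where "p = (\<integral>g. gibbs n T l b g s \<partial>std_gaussian n)"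
  have p: "p > 0" unfolding p_def by (rule gibbs_mass_pos[OF T l s])
  define k where "k = b s - ln p"
  have \<rho>: "gibbs n T l b g s / p = exp (l * (dot n g s - ?G g) + k)" for g
    using p by (simp add: gibbs_eq[OF T l] k_def exp_diff[symmetric] exp_add[symmetric] exp_ln[symmetric] del: exp_ln)
      (simp add: exp_diff exp_add)
  have lt: "tame n (\<lambda>g. l * (dot n g s - ?G g) + k)"
    by (intro tame_add tame_mult tame_diff tame_const tame_dot tame_lse[OF T l])
  have "k - l * (\<integral>g. ?G g \<partial>std_gaussian n) = (\<integral>g. l * (dot n g s - ?G g) + k \<partial>std_gaussian n)"
    using tame_integrable[OF tame_lse[OF T l]] tame_integrable[OF tame_dot[of n s]]
    by (simp add: tame_integrable)
  also have "\<dots> \<le> (\<integral>g. gibbs n T l b g s / p - 1 \<partial>std_gaussian n)"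
  proof (rule integral_mono_tame[OF lt])
    show "tame n (\<lambda>g. gibbs n T l b g s / p - 1)"
      by (intro tame_diff tame_divide tame_gibbs[OF T l s] tame_const)
    show "l * (dot n g s - ?G g) + k \<le> gibbs n T l b g s / p - 1" for g
      unfolding \<rho> using exp_ge_add_one_self[of "l * (dot n g s - ?G g) + k"] by linarith
  qed
  also have "\<dots> = 0"
    using tame_integrable[OF tame_gibbs[OF T l s]] p by (simp add: p_def[symmetric])
  finally have k: "k \<le> l * (\<integral>g. ?G g \<partial>std_gaussian n)" by simp
  have "l * dot n g s \<le> l * hmax n T (\<lambda>_. 0) g"
    using l hmax_ge[OF T s, of n g "\<lambda>_. 0"] by simp
  then have "gibbs n T l b g s / p \<le> exp (l * ((\<integral>g. ?G g \<partial>std_gaussian n) + hmax n T (\<lambda>_. 0) g - ?G g))"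
    unfolding \<rho> using k by (simp add: algebra_simps)
  then show ?thesis using p by (simp add: p_def[symmetric] field_simps)
qed

lemma gmean_dist_le_avg:
  fixes T :: "(nat \<Rightarrow> real) set"
  assumes T: "finite T" "T \<noteq> {}" and l: "l > 0"
  shows "(\<Sum>i<n. (gmean n T l b g i - y i)\<^sup>2) \<le> (\<Sum>t\<in>T. gibbs n T l b g t * (\<Sum>i<n. (y i - t i)\<^sup>2))"
proof -
  note avg = T(1) gibbs_nonneg[OF T l] sum_gibbs[OF T l, of n b g]
  have "(gmean n T l b g i - y i)\<^sup>2 \<le> (\<Sum>t\<in>T. gibbs n T l b g t * (y i - t i)\<^sup>2)" for i
  proof -
    have "gmean n T l b g i - y i = (\<Sum>t\<in>T. gibbs n T l b g t * (t i - y i))"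
      using avg(3) by (simp add: gmean_def right_diff_distrib sum_subtractf sum_distrib_right[symmetric])
    then show ?thesis using avg_power2_le[OF avg, of "\<lambda>t. t i - y i"] by (simp add: power2_commute)
  qed
  then have "(\<Sum>i<n. (gmean n T l b g i - y i)\<^sup>2) \<le> (\<Sum>i<n. \<Sum>t\<in>T. gibbs n T l b g t * (y i - t i)\<^sup>2)"
    by (rule sum_mono)
  also have "\<dots> = (\<Sum>t\<in>T. gibbs n T l b g t * (\<Sum>i<n. (y i - t i)\<^sup>2))"
    by (subst sum.swap) (simp add: sum_distrib_left)
  finally show ?thesis .
qed

lemma gmean_dist_le:
  fixes T :: "(nat \<Rightarrow> real) set"
  assumes T: "finite T" "T \<noteq> {}" and l: "l > 0"
    and D: "\<And>t. t \<in> T \<Longrightarrow> (\<Sum>i<n. (t i - y i)\<^sup>2) \<le> D"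
  shows "(\<Sum>i<n. (gmean n T l b g i - y i)\<^sup>2) \<le> D"
  by (rule order_trans[OF gmean_dist_le_avg[OF T l] avg_le[OF T(1) gibbs_nonneg[OF T l] sum_gibbs[OF T l]]])
    (use D in \<open>simp add: power2_commute\<close>)

text \<open>A convex function minus one with a quadratic upper expansion is convex up to a
  quadratic. This is why the Poincare inequality was proved beyond convex functions.\<close>

lemma lse_diff_poincare:
  fixes n :: nat and S T :: "(nat \<Rightarrow> real) set" and b b' :: "(nat \<Rightarrow> real) \<Rightarrow> real"
  assumes S: "finite S" "S \<noteq> {}" and T: "finite T" "T \<noteq> {}" and l: "l > 0"
  defines "h \<equiv> \<lambda>g. lse n S l b' g - lse n T l b g"
  shows "(l2 n (\<lambda>g. h g - (\<integral>g. h g \<partial>std_gaussian n)))\<^sup>2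
    \<le> (\<integral>g. (\<Sum>i<n. (gmean n S l b' g i - gmean n T l b g i)\<^sup>2) \<partial>std_gaussian n)"
proof -
  define B where "B = (\<Sum>t\<in>T. \<Sum>i<n. (t i)\<^sup>2)"
  have B: "(\<Sum>i<n. (t i)\<^sup>2) \<le> B" if "t \<in> T" for t
    unfolding B_def by (rule member_le_sum[OF that, of "\<lambda>t. \<Sum>i<n. (t i)\<^sup>2"]) (use T in \<open>auto intro: sum_nonneg\<close>)
  have B0: "B \<ge> 0" unfolding B_def by (intro sum_nonneg) auto
  show ?thesis
  proof (rule gaussian_poincare[where L="4 * l * B"])
    show "tame n h" unfolding h_def by (intro tame_diff tame_lse S T l)
    show "tame n (\<lambda>g. \<Sum>i<n. (gmean n S l b' g i - gmean n T l b g i)\<^sup>2)"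
      by (intro tame_sum tame_power tame_diff tame_gmean S T l)
    show "4 * l * B \<ge> 0" using l B0 by simp
    fix x y
    show "h x + (\<Sum>i<n. (gmean n S l b' x i - gmean n T l b x i) * (y i - x i)) - 4 * l * B * (\<Sum>i<n. (y i - x i)\<^sup>2) \<le> h y"
      using lse_subgradient[OF S l, of n b' x y] lse_upper_quadratic[OF T l B, of b y x]
      unfolding h_def left_diff_distrib sum_subtractf by linarith
  qed
qed

lemma sum_list_map_eq_sum_count_real:
  fixes f :: "'a \<Rightarrow> real"
  shows "sum_list (map f xs) = (\<Sum>s\<in>set xs. count_list xs s * f s)"
proof (induction xs)
  case (Cons x xs)
  have "(\<Sum>s\<in>set (x # xs). count_list (x # xs) s * f s)
      = (\<Sum>s\<in>insert x (set xs). count_list xs s * f s + (if s = x then f s else 0))"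
    by (intro sum.cong) (auto simp: distrib_right)
  also have "\<dots> = (\<Sum>s\<in>insert x (set xs). count_list xs s * f s) + f x"
    by (simp add: sum.distrib)
  also have "(\<Sum>s\<in>insert x (set xs). count_list xs s * f s) = (\<Sum>s\<in>set xs. count_list xs s * f s)"
    by (rule sum.mono_neutral_right) (auto simp: count_list_0_iff)
  finally show ?case using Cons.IH by simp
qed simp

lemma sparsify_sampling:
  fixes n :: nat and T :: "(nat \<Rightarrow> real) set" and b :: "(nat \<Rightarrow> real) \<Rightarrow> real"
  assumes T: "finite T" "T \<noteq> {}" and l: "l > 0" and N: "N > 0" and W: "W > 0"
    and width: "(\<integral>g. hmax n T (\<lambda>_. 0) g \<partial>std_gaussian n) \<le> W"
    and D: "\<And>s t. s \<in> T \<Longrightarrow> t \<in> T \<Longrightarrow> (\<Sum>i<n. (s i - t i)\<^sup>2) \<le> D"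
  defines "R \<equiv> exp (l * ((\<integral>g. lse n T l b g \<partial>std_gaussian n) + W))"
  obtains S b' where "S \<subseteq> T" "S \<noteq> {}" "card S \<le> N"
    "(l2 n (\<lambda>g. (lse n S l b' g - lse n T l b g) - (\<integral>g. lse n S l b' g - lse n T l b g \<partial>std_gaussian n)))\<^sup>2
      \<le> 4 * D * R / N + 2 * W / l + D * (l2 n (\<lambda>g. hmax n T (\<lambda>_. 0) g - lse n T l b g) / W)\<^sup>2"
proof -
  let ?G = "lse n T l b" and ?F = "hmax n T (\<lambda>_. 0)"
  define p where "p s = (\<integral>g. gibbs n T l b g s \<partial>std_gaussian n)" for s
  have p: "p s > 0" if "s \<in> T" for s unfolding p_def by (rule gibbs_mass_pos[OF T l that])
  have p1: "(\<Sum>s\<in>T. p s) = 1"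
  proof -
    have "(\<Sum>s\<in>T. p s) = (\<integral>g. (\<Sum>s\<in>T. gibbs n T l b g s) \<partial>std_gaussian n)"
      unfolding p_def
      by (intro Bochner_Integration.integral_sum[symmetric] tame_integrable tame_gibbs[OF T l])
    then show ?thesis by (simp add: sum_gibbs[OF T l])
  qed
  note wp = T(1) less_imp_le[OF p] p1
  define \<rho> where "\<rho> g s = gibbs n T l b g s / p s" for g s
  have \<rho>: "\<rho> g s > 0" "p s * \<rho> g s = gibbs n T l b g s" if "s \<in> T" for g s
    using p[OF that] gibbs_pos[OF T l, of n b g s] by (auto simp: \<rho>_def)
  define q where "q g s = (\<Sum>i<n. (gmean n T l b g i - s i)\<^sup>2)" for g s
  have q0: "q g s \<ge> 0" for g s by (simp add: q_def sum_nonneg)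
  obtain t0 where t0: "t0 \<in> T" using T by auto
  have D0: "D \<ge> 0" using D[OF t0 t0] by simp
  \<comment> \<open>Repeated samples count with multiplicity, so the partition sum of the sample is
    that of \<open>T\<close> times the total of \<open>\<rho> g s\<close> over the list.\<close>
  define bb where "bb xs s = ln (count_list xs s * exp (b s) / p s)" for xs s
  define gap where "gap xs g = (\<Sum>i<n. (gmean n (set xs) l (bb xs) g i - gmean n T l b g i)\<^sup>2)" for xs g
  have gapt: "tame n (gap xs)" if "set xs \<subseteq> T" for xs
  proof (cases "xs = []")
    case True
    then show ?thesis unfolding gap_def
      by (intro tame_sum tame_power tame_diff tame_gmean[OF T l]) (simp add: gmean_def)
  next
    case False
    then show ?thesis unfolding gap_def[abs_def]
      by (intro tame_sum tame_power tame_diff tame_gmean T l) auto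
  qed
  \<comment> \<open>If the total weight \<open>M\<close> is at least \<open>N / 2\<close>, replacing
    it by \<open>N / 2\<close> gives the second term. Otherwise \<open>M / N\<close> differs from 1
    by at least 1/2, and the trivial bound \<open>D\<close> is at most
    \<open>4 * D * (M / N - 1)\<^sup>2\<close>.\<close>
  have gap: "gap xs g \<le> D"
      "gap xs g \<le> 4 * D * ((sum_list (map (\<lambda>s. \<rho> g s - 1) xs)) / N)\<^sup>2 + 2 * (sum_list (map (\<lambda>s. \<rho> g s * q g s) xs) / N)"
    if xs: "set xs \<subseteq> T" "length xs = N" for xs g
  proof -
    let ?S = "set xs"
    have S: "finite ?S" "?S \<noteq> {}" using xs N by auto
    show gD: "gap xs g \<le> D" unfolding gap_def
    proof (rule gmean_dist_le[OF S l])
      fix s assume "s \<in> ?S"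
      then have s: "s \<in> T" using xs by auto
      have "(\<Sum>i<n. (gmean n T l b g i - s i)\<^sup>2) \<le> D"
        by (rule gmean_dist_le[OF T l]) (rule D[OF _ s])
      then show "(\<Sum>i<n. (s i - gmean n T l b g i)\<^sup>2) \<le> D" by (simp add: power2_commute)
    qed
    define Z where "Z = (\<Sum>r\<in>T. exp (l * dot n g r + b r))"
    have Z: "Z > 0" unfolding Z_def by (rule partition_pos[OF T l])
    have wt: "exp (l * dot n g s + bb xs s) = Z * (count_list xs s * \<rho> g s)" if "s \<in> ?S" for s
    proof -
      have s: "s \<in> T" using that xs by auto
      have "count_list xs s > 0" using that by (simp add: count_list_0_iff neq0_conv[symmetric] del: neq0_conv)
      then have "exp (bb xs s) = count_list xs s * exp (b s) / p s" using p[OF s] by (simp add: bb_def)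
      then show ?thesis using Z
        by (simp add: \<rho>_def gibbs_def Z_def[symmetric]) (simp add: exp_add)
    qed
    define M where "M = sum_list (map (\<rho> g) xs)"
    have M: "M = (\<Sum>s\<in>?S. count_list xs s * \<rho> g s)"
      unfolding M_def by (rule sum_list_map_eq_sum_count_real)
    have M0: "M > 0" unfolding M using S xs \<rho>(1)
      by (intro sum_pos) (auto simp: count_list_0_iff neq0_conv[symmetric] simp del: neq0_conv)
    have gi: "gibbs n ?S l (bb xs) g s = count_list xs s * \<rho> g s / M" if "s \<in> ?S" for s
    proof -
      have "(\<Sum>r\<in>?S. exp (l * dot n g r + bb xs r)) = Z * M"
        unfolding M sum_distrib_left by (intro sum.cong refl wt)
      then show ?thesis using Z wt[OF that] by (simp add: gibbs_def)
    qed
    have "gap xs g \<le> (\<Sum>s\<in>?S. gibbs n ?S l (bb xs) g s * q g s)"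
      unfolding gap_def q_def by (rule gmean_dist_le_avg[OF S l])
    also have "\<dots> = (\<Sum>s\<in>?S. count_list xs s * (\<rho> g s * q g s)) / M"
      unfolding sum_divide_distrib by (intro sum.cong refl) (simp add: gi)
    also have "\<dots> = sum_list (map (\<lambda>s. \<rho> g s * q g s) xs) / M"
      by (simp add: sum_list_map_eq_sum_count_real)
    finally have gQ: "gap xs g \<le> sum_list (map (\<lambda>s. \<rho> g s * q g s) xs) / M" .
    have Q0: "sum_list (map (\<lambda>s. \<rho> g s * q g s) xs) \<ge> 0"
      using xs \<rho>(1) q0 by (intro sum_list_nonneg) (auto intro!: mult_nonneg_nonneg intro: less_imp_le)
    have MN: "sum_list (map (\<lambda>s. \<rho> g s - 1) xs) = M - N"
      using xs(2) by (simp add: M_def sum_list_subtractf sum_list_triv)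
    show "gap xs g \<le> 4 * D * ((sum_list (map (\<lambda>s. \<rho> g s - 1) xs)) / N)\<^sup>2 + 2 * (sum_list (map (\<lambda>s. \<rho> g s * q g s) xs) / N)"
    proof (cases "M \<ge> N / 2")
      case True
      have "gap xs g \<le> sum_list (map (\<lambda>s. \<rho> g s * q g s) xs) / M" by (rule gQ)
      also have "\<dots> \<le> sum_list (map (\<lambda>s. \<rho> g s * q g s) xs) / (N / 2)"
        using True Q0 M0 N by (intro divide_left_mono) auto
      also have "\<dots> = 2 * (sum_list (map (\<lambda>s. \<rho> g s * q g s) xs) / N)"
        by simp
      finally show ?thesis using D0 by (intro add_increasing) auto
    next
      case False
      define y where "y = (M - N) / N"
      have "1 / 2 \<le> \<bar>y\<bar>" using False N by (simp add: y_def field_simps abs_if)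
      then have "(1 / 2)\<^sup>2 \<le> \<bar>y\<bar>\<^sup>2" by (rule power_mono) simp
      then have "D * 1 \<le> D * (4 * y\<^sup>2)" using D0 by (intro mult_left_mono) (auto simp: power2_eq_square)
      moreover have "2 * (sum_list (map (\<lambda>s. \<rho> g s * q g s) xs) / N) \<ge> 0" using Q0 by simp
      ultimately show ?thesis using gD unfolding MN y_def[symmetric] by simp
    qed
  qed
  have avg: "wavg T p N (\<lambda>xs. gap xs g) \<le> 4 * D * R / N + (2 * spread n T l b g + D / W\<^sup>2 * (?F g - ?G g)\<^sup>2)" for g
  proof (cases "?F g - ?G g \<le> W")
    case True
    have \<rho>R: "\<rho> g s \<le> R" if s: "s \<in> T" for s
    proof -
      have "\<rho> g s \<le> exp (l * ((\<integral>g. ?G g \<partial>std_gaussian n) + ?F g - ?G g))"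
        using density_le[OF T l s, of n b g] p[OF s] by (simp add: \<rho>_def p_def[symmetric] field_simps)
      also have "\<dots> \<le> R" unfolding R_def using l True by simp
      finally show ?thesis .
    qed
    have m0: "(\<Sum>s\<in>T. p s * (\<rho> g s - 1)) = 0"
      using \<rho>(2) sum_gibbs[OF T l, of n b g] p1 by (simp add: right_diff_distrib sum_subtractf)
    \<comment> \<open>The second moment of \<open>\<rho> g\<close> under \<open>p\<close> is its
      first moment under the Gibbs weights, hence at most \<open>R\<close> rather than
      \<open>R\<^sup>2\<close>.\<close>
    have "(\<Sum>s\<in>T. p s * (\<rho> g s - 1)\<^sup>2) = (\<Sum>s\<in>T. gibbs n T l b g s * \<rho> g s - 2 * gibbs n T l b g s + p s)"
    proof (intro sum.cong refl)
      fix s assume "s \<in> T"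
      from \<rho>(2)[OF this, of g, symmetric]
      show "p s * (\<rho> g s - 1)\<^sup>2 = gibbs n T l b g s * \<rho> g s - 2 * gibbs n T l b g s + p s"
        by (simp add: power2_eq_square algebra_simps)
    qed
    also have "\<dots> = (\<Sum>s\<in>T. gibbs n T l b g s * \<rho> g s) - 1"
      by (simp add: sum.distrib sum_subtractf sum_distrib_left[symmetric] sum_gibbs[OF T l] p1)
    also have "(\<Sum>s\<in>T. gibbs n T l b g s * \<rho> g s) \<le> R"
      by (rule avg_le[OF T(1) gibbs_nonneg[OF T l] sum_gibbs[OF T l] \<rho>R])
    finally have var: "(\<Sum>s\<in>T. p s * (\<rho> g s - 1)\<^sup>2) \<le> R" by simp
    have "wavg T p N (\<lambda>xs. gap xs g) \<le> wavg T p N (\<lambda>xs. 4 * D / (real N)\<^sup>2 * (0 + sum_list (map (\<lambda>s. \<rho> g s - 1) xs))\<^sup>2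
        + 2 / N * sum_list (map (\<lambda>s. \<rho> g s * q g s) xs))"
    proof (rule wavg_mono[OF wp])
      fix xs assume "set xs \<subseteq> T" "length xs = N"
      from gap(2)[OF this, of g]
      show "gap xs g \<le> 4 * D / (real N)\<^sup>2 * (0 + sum_list (map (\<lambda>s. \<rho> g s - 1) xs))\<^sup>2
        + 2 / N * sum_list (map (\<lambda>s. \<rho> g s * q g s) xs)"
        by (simp only: power_divide times_divide_eq_left times_divide_eq_right add_0)
    qed
    also have "\<dots> = 4 * D / (real N)\<^sup>2 * (N * (\<Sum>s\<in>T. p s * (\<rho> g s - 1)\<^sup>2)) + 2 / N * (N * (\<Sum>s\<in>T. p s * (\<rho> g s * q g s)))"
      by (simp only: wavg_add[OF wp] wavg_cmult[OF wp] wavg_sum_list[OF wp] wavg_sum_list_power2[OF wp m0]) simp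
    also have "(\<Sum>s\<in>T. p s * (\<rho> g s * q g s)) = spread n T l b g"
      unfolding spread_def q_def by (intro sum.cong refl) (simp add: \<rho>(2)[symmetric])
    also have "4 * D / (real N)\<^sup>2 * (N * (\<Sum>s\<in>T. p s * (\<rho> g s - 1)\<^sup>2)) + 2 / N * (N * spread n T l b g)
        = 4 * D / N * (\<Sum>s\<in>T. p s * (\<rho> g s - 1)\<^sup>2) + 2 * spread n T l b g"
      using N by (simp add: power2_eq_square)
    also have "\<dots> \<le> 4 * D / N * R + 2 * spread n T l b g"
      using D0 by (intro add_mono mult_left_mono var) auto
    finally have "wavg T p N (\<lambda>xs. gap xs g) \<le> 4 * D * R / N + 2 * spread n T l b g" by simp
    moreover have "D / W\<^sup>2 * (?F g - ?G g)\<^sup>2 \<ge> 0" using D0 by simp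
    ultimately show ?thesis by linarith
  next
    \<comment> \<open>As in Markov's inequality, the trivial bound \<open>D\<close> is charged to
      the squared distance of \<open>hmax\<close> and \<open>lse\<close>, which exceeds
      \<open>W\<^sup>2\<close> here.\<close>
    case False
    then have "W\<^sup>2 \<le> (?F g - ?G g)\<^sup>2" using W by (intro power_mono) auto
    then have "D * 1 \<le> D * ((?F g - ?G g)\<^sup>2 / W\<^sup>2)" using D0 W by (intro mult_left_mono) auto
    moreover have "wavg T p N (\<lambda>xs. gap xs g) \<le> wavg T p N (\<lambda>xs. D)"
      by (rule wavg_mono[OF wp]) (use gap(1) in auto)
    moreover have "4 * D * R / N \<ge> 0" using D0 by (simp add: R_def)
    moreover have "spread n T l b g \<ge> 0" unfolding spread_def
      by (intro sum_nonneg mult_nonneg_nonneg gibbs_nonneg[OF T l]) auto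
    ultimately show ?thesis by (simp add: wavg_const[OF wp])
  qed
  have t1: "tame n (\<lambda>g. wavg T p N (\<lambda>xs. gap xs g))"
    and w1: "(\<integral>g. wavg T p N (\<lambda>xs. gap xs g) \<partial>std_gaussian n) = wavg T p N (\<lambda>xs. \<integral>g. gap xs g \<partial>std_gaussian n)"
    using wavg_integral[OF T(1) gapt] by auto
  have t2: "tame n (\<lambda>g. (?F g - ?G g)\<^sup>2)" by (intro tame_power tame_diff tame_hmax tame_lse T l)
  have "wavg T p N (\<lambda>xs. \<integral>g. gap xs g \<partial>std_gaussian n)
      \<le> (\<integral>g. 4 * D * R / N + (2 * spread n T l b g + D / W\<^sup>2 * (?F g - ?G g)\<^sup>2) \<partial>std_gaussian n)"
    unfolding w1[symmetric]
    by (rule integral_mono_tame[OF t1 _ avg]) (intro tame_add tame_mult tame_const tame_spread[OF T l] t2)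
  also have "\<dots> = 4 * D * R / N + (2 * (\<integral>g. spread n T l b g \<partial>std_gaussian n) + D / W\<^sup>2 * (l2 n (\<lambda>g. ?F g - ?G g))\<^sup>2)"
    using tame_integrable[OF tame_spread[OF T l, of n b]] tame_integrable[OF t2] unfolding l2_power2 by simp
  also have "\<dots> \<le> 4 * D * R / N + (2 * (W / l) + D / W\<^sup>2 * (l2 n (\<lambda>g. ?F g - ?G g))\<^sup>2)"
    using spread_integral_le[OF T l, of n b] width l by (simp add: field_simps)
  finally have fin: "wavg T p N (\<lambda>xs. \<integral>g. gap xs g \<partial>std_gaussian n)
      \<le> 4 * D * R / N + 2 * W / l + D * (l2 n (\<lambda>g. ?F g - ?G g) / W)\<^sup>2"
    by (simp add: power_divide)
  obtain xs where xs: "set xs \<subseteq> T" "length xs = N"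
      "(\<integral>g. gap xs g \<partial>std_gaussian n) \<le> wavg T p N (\<lambda>xs. \<integral>g. gap xs g \<partial>std_gaussian n)"
    using wavg_exists[OF wp, of N "\<lambda>xs. \<integral>g. gap xs g \<partial>std_gaussian n"] by blast
  have S: "finite (set xs)" "set xs \<noteq> {}" using xs N by auto
  show thesis
  proof (rule that)
    show "set xs \<subseteq> T" "set xs \<noteq> {}" using xs S by auto
    show "card (set xs) \<le> N" using xs(2) card_length[of xs] by simp
    show "(l2 n (\<lambda>g. (lse n (set xs) l (bb xs) g - ?G g) - (\<integral>g. lse n (set xs) l (bb xs) g - ?G g \<partial>std_gaussian n)))\<^sup>2
      \<le> 4 * D * R / N + 2 * W / l + D * (l2 n (\<lambda>g. ?F g - ?G g) / W)\<^sup>2"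
      using lse_diff_poincare[OF S T l, of n "bb xs" b] xs(3) fin unfolding gap_def by linarith
  qed
qed

section \<open>Sparsification of bounded sets\<close>

lemma hmax_zero_integral_mono:
  fixes S T :: "(nat \<Rightarrow> real) set"
  assumes "finite T" "S \<subseteq> T" "S \<noteq> {}"
  shows "(\<integral>g. hmax n S (\<lambda>_. 0) g \<partial>std_gaussian n) \<le> (\<integral>g. hmax n T (\<lambda>_. 0) g \<partial>std_gaussian n)"
proof (rule integral_mono_tame)
  have fin: "finite S" "finite T" "T \<noteq> {}" using assms by (auto intro: finite_subset)
  show "tame n (hmax n S (\<lambda>_. 0))" "tame n (hmax n T (\<lambda>_. 0))" using fin assms by (auto intro: tame_hmax)
  show "hmax n S (\<lambda>_. 0) g \<le> hmax n T (\<lambda>_. 0) g" for g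
    using hmax_ge[OF fin(2,3), of _ n g "\<lambda>_. 0"] assms
    unfolding hmax_le_iff[OF fin(1) assms(3)] by auto
qed

text \<open>Applies \<open>spread_integral_le\<close> to the two-point set \<open>{s, t}\<close> at inverse temperature
  \<open>1 / (2 |s - t|)\<close>, where both Gibbs weights stay bounded below.\<close>

lemma dist_le_width:
  fixes T :: "(nat \<Rightarrow> real) set"
  assumes T: "finite T" and st: "s \<in> T" "t \<in> T"
  shows "sqrt (\<Sum>i<n. (s i - t i)\<^sup>2) \<le> 16 * (\<integral>g. hmax n T (\<lambda>_. 0) g \<partial>std_gaussian n)"
proof -
  let ?w = "\<lambda>S. \<integral>g. hmax n S (\<lambda>_. 0) g \<partial>std_gaussian n"
  define v where "v i = s i - t i" for i
  define r where "r = sqrt (\<Sum>i<n. (v i)\<^sup>2)"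
  have r2: "r\<^sup>2 = (\<Sum>i<n. (v i)\<^sup>2)" by (simp add: r_def sum_nonneg)
  show ?thesis
  proof (cases "r = 0")
    case True
    have "?w {s} = 0" by (simp add: hmax_def)
    then have "?w T \<ge> 0" using hmax_zero_integral_mono[of T "{s}" n] st T by simp
    then show ?thesis using True by (simp add: r_def v_def)
  next
    case False
    then have r: "r > 0" by (simp add: r_def less_le sum_nonneg)
    then have ne: "s \<noteq> t" by (auto simp: r_def v_def)
    define l where "l = 1 / (2 * r)"
    have l: "l > 0" using r by (simp add: l_def)
    define S where "S = {s, t}"
    have S: "finite S" "S \<noteq> {}" by (auto simp: S_def)
    let ?\<pi> = "gibbs n S l (\<lambda>_. 0)"
    have sp: "r\<^sup>2 / 4 * (1 - l * \<bar>dot n g v\<bar>) \<le> spread n S l (\<lambda>_. 0) g" for g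
    proof -
      have 1: "?\<pi> g s + ?\<pi> g t = 1" using sum_gibbs[OF S l, of n "\<lambda>_. 0" g] ne by (simp add: S_def)
      define P where "P = ?\<pi> g s"
      have Q: "?\<pi> g t = 1 - P" using 1 by (simp add: P_def)
      have "spread n S l (\<lambda>_. 0) g = (\<Sum>i<n. P * (gmean n S l (\<lambda>_. 0) g i - s i)\<^sup>2 + (1 - P) * (gmean n S l (\<lambda>_. 0) g i - t i)\<^sup>2)"
        using ne by (simp add: spread_def S_def sum.distrib sum_distrib_left Q[unfolded S_def] P_def[unfolded S_def])
      also have "\<dots> = (\<Sum>i<n. P * (1 - P) * (v i)\<^sup>2)"
      proof (intro sum.cong refl)
        fix i
        have gm: "gmean n S l (\<lambda>_. 0) g i = P * s i + (1 - P) * t i"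
          using ne by (simp add: gmean_def S_def Q[unfolded S_def] P_def[unfolded S_def])
        show "P * (gmean n S l (\<lambda>_. 0) g i - s i)\<^sup>2 + (1 - P) * (gmean n S l (\<lambda>_. 0) g i - t i)\<^sup>2 = P * (1 - P) * (v i)\<^sup>2"
          unfolding gm v_def by (simp add: power2_eq_square algebra_simps)
      qed
      also have "\<dots> = P * (1 - P) * r\<^sup>2" by (simp add: r2 sum_distrib_left)
      finally have eq: "spread n S l (\<lambda>_. 0) g = P * (1 - P) * r\<^sup>2" .
      define a b where "a = exp (l * dot n g s)" and "b = exp (l * dot n g t)"
      have ab: "a > 0" "b > 0" by (auto simp: a_def b_def)
      have X: "dot n g v = dot n g s - dot n g t"
        by (simp add: dot_def v_def right_diff_distrib sum_subtractf)
      have "P = a / (a + b)" "1 - P = b / (a + b)"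
        using ne unfolding Q[symmetric] by (simp_all add: P_def gibbs_def S_def a_def b_def)
      then have PP: "P * (1 - P) = a * b / (a + b)\<^sup>2" by (simp add: power2_eq_square)
      have mx: "exp (- (l * \<bar>dot n g v\<bar>)) * (max a b)\<^sup>2 = a * b"
      proof (cases "dot n g t \<le> dot n g s")
        case True
        have "b \<le> a" using l True by (simp add: a_def b_def)
        then have m: "max a b = a" by simp
        have "\<bar>dot n g v\<bar> = dot n g s - dot n g t" using X True by simp
        moreover have "exp (- (l * (dot n g s - dot n g t))) * a = b"
          unfolding a_def b_def exp_add[symmetric] by (simp add: right_diff_distrib)
        ultimately show ?thesis unfolding m by (metis mult.commute mult.left_commute power2_eq_square)
      next
        case False
        have "a \<le> b" using l False by (simp add: a_def b_def)
        then have m: "max a b = b" by simp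
        have "\<bar>dot n g v\<bar> = dot n g t - dot n g s" using X False by simp
        moreover have "exp (- (l * (dot n g t - dot n g s))) * b = a"
          unfolding a_def b_def exp_add[symmetric] by (simp add: right_diff_distrib)
        ultimately show ?thesis unfolding m by (metis mult.commute mult.left_commute power2_eq_square)
      qed
      have "(a + b)\<^sup>2 \<le> (2 * max a b)\<^sup>2" using ab by (intro power_mono) auto
      then have "(a + b)\<^sup>2 * exp (- (l * \<bar>dot n g v\<bar>)) \<le> 4 * (max a b)\<^sup>2 * exp (- (l * \<bar>dot n g v\<bar>))"
        by (intro mult_right_mono) (auto simp: power_mult_distrib)
      also have "\<dots> = 4 * (a * b)" using mx by (simp add: mult_ac)
      finally have "exp (- (l * \<bar>dot n g v\<bar>)) / 4 \<le> P * (1 - P)"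
        unfolding PP using ab by (simp add: field_simps)
      moreover have "1 - l * \<bar>dot n g v\<bar> \<le> exp (- (l * \<bar>dot n g v\<bar>))"
        using exp_ge_add_one_self[of "- (l * \<bar>dot n g v\<bar>)"] by simp
      then have "(1 - l * \<bar>dot n g v\<bar>) / 4 \<le> exp (- (l * \<bar>dot n g v\<bar>)) / 4"
        by (rule divide_right_mono) simp
      ultimately have "(1 - l * \<bar>dot n g v\<bar>) / 4 \<le> P * (1 - P)" by (meson order_trans)
      then have "(1 - l * \<bar>dot n g v\<bar>) / 4 * r\<^sup>2 \<le> P * (1 - P) * r\<^sup>2" by (intro mult_right_mono) auto
      then show ?thesis unfolding eq by (simp add: mult_ac)
    qed
    \<comment> \<open>The mean of \<open>\<bar>dot n g v\<bar>\<close> is at most \<open>r\<close>,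
      and \<open>l * r = 1 / 2\<close>. So the mean spread is at least \<open>r\<^sup>2 / 8\<close>,
      and \<open>l\<close> times this is \<open>r / 16\<close>.\<close>
    have "(\<integral>g. \<bar>dot n g v\<bar> \<partial>std_gaussian n) \<le> l2 n (\<lambda>g. \<bar>dot n g v\<bar>)"
      using abs_integral_le_l2[OF tame_abs[OF tame_dot[of n v]]] by linarith
    also have "\<dots> = r" by (simp add: l2_def integral_dot_power2 r_def)
    finally have "r\<^sup>2 / 4 * (1 - l * r) \<le> r\<^sup>2 / 4 * (1 - l * (\<integral>g. \<bar>dot n g v\<bar> \<partial>std_gaussian n))"
      using l by (intro mult_left_mono) auto
    also have "\<dots> = (\<integral>g. r\<^sup>2 / 4 * (1 - l * \<bar>dot n g v\<bar>) \<partial>std_gaussian n)"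
      using tame_integrable[OF tame_abs[OF tame_dot[of n v]]] by simp
    also have "\<dots> \<le> (\<integral>g. spread n S l (\<lambda>_. 0) g \<partial>std_gaussian n)"
      by (rule integral_mono_tame[OF _ tame_spread[OF S l] sp])
        (intro tame_mult tame_diff tame_const tame_abs tame_dot)
    finally have "l * (r\<^sup>2 / 4 * (1 - l * r)) \<le> l * (\<integral>g. spread n S l (\<lambda>_. 0) g \<partial>std_gaussian n)"
      using l by (intro mult_left_mono) auto
    also have "\<dots> \<le> ?w S" by (rule spread_integral_le[OF S l])
    also have "\<dots> \<le> ?w T" by (rule hmax_zero_integral_mono) (use T st S in \<open>auto simp: S_def\<close>)
    finally have "r / 16 \<le> ?w T" using r by (simp add: l_def power2_eq_square field_simps)
    then show ?thesis by (simp add: r_def v_def)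
  qed
qed

text \<open>The Poincare inequality controls the sampled soft maximum only up to an additive
  constant. This is how the constant is absorbed into the weights.\<close>

lemma lse_shift:
  fixes S :: "(nat \<Rightarrow> real) set"
  assumes S: "finite S" "S \<noteq> {}" and l: "l > 0"
  shows "lse n S l (\<lambda>s. b s + l * k) g = lse n S l b g + k"
proof -
  have "(\<Sum>s\<in>S. exp (l * dot n g s + (b s + l * k))) = (\<Sum>s\<in>S. exp (l * dot n g s + b s)) * exp (l * k)"
    by (simp only: add.assoc[symmetric] exp_add[of _ "l * k"] sum_distrib_right)
  then show ?thesis using partition_pos[OF S, of l n g b] l
    by (simp add: lse_def ln_mult add_divide_distrib)
qed

lemma l2_hmax_lse_le:
  fixes S :: "(nat \<Rightarrow> real) set"
  assumes S: "finite S" "S \<noteq> {}" and l: "l > 0" and r: "ln (card S) / l \<le> r"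
  shows "l2 n (\<lambda>g. hmax n S (\<lambda>s. b s / l) g - lse n S l b g) \<le> r"
proof -
  have "card S \<ge> 1" using S by (simp add: Suc_leI card_gt_0_iff)
  then have "ln (card S) \<ge> 0" by simp
  then have r0: "r \<ge> 0" using l r by (meson divide_nonneg_pos order_trans)
  have "l2 n (\<lambda>g. hmax n S (\<lambda>s. b s / l) g - lse n S l b g) \<le> l2 n (\<lambda>_. r)"
  proof (rule l2_mono)
    show "tame n (\<lambda>g. hmax n S (\<lambda>s. b s / l) g - lse n S l b g)"
      by (intro tame_diff tame_hmax tame_lse S l)
    show "\<bar>hmax n S (\<lambda>s. b s / l) g - lse n S l b g\<bar> \<le> \<bar>r\<bar>" for g
      using hmax_le_lse[OF S l, of n b g] lse_le_hmax[OF S l, of n b g] r by linarith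
  qed simp
  then show ?thesis using r0 by simp
qed

lemma large_temperature:
  fixes l0 r :: real and k :: nat
  assumes "l0 > 0" "r > 0"
  obtains l where "l \<ge> l0" "ln k / l \<le> r"
proof -
  have "ln k / max l0 (\<bar>ln k\<bar> / r) \<le> r"
  proof -
    have "ln k \<le> \<bar>ln k\<bar> / r * r" using assms by simp
    also have "\<dots> \<le> max l0 (\<bar>ln k\<bar> / r) * r" using assms by (intro mult_right_mono) auto
    finally show ?thesis using assms by (simp add: pos_divide_le_eq mult.commute less_max_iff_disj)
  qed
  then show thesis using that[of "max l0 (\<bar>ln k\<bar> / r)"] by simp
qed

lemma inverse_sqrt_diff_le:
  assumes "0 < l" "l \<le> (l' :: real)"
  shows "\<bar>1 / sqrt l - 1 / sqrt l'\<bar> \<le> 1 / sqrt l" "\<bar>1 / sqrt l' - 1 / sqrt l\<bar> \<le> 1 / sqrt l"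
proof -
  have "1 / sqrt l' \<le> 1 / sqrt l" using assms by (intro divide_left_mono) auto
  moreover have "1 / sqrt l' \<ge> 0" using assms by simp
  ultimately show "\<bar>1 / sqrt l - 1 / sqrt l'\<bar> \<le> 1 / sqrt l" "\<bar>1 / sqrt l' - 1 / sqrt l\<bar> \<le> 1 / sqrt l" by linarith+
qed

text \<open>The chain runs from \<open>hmax\<close> on \<open>T\<close> to \<open>lse\<close> at
  \<open>L\<close>, down to \<open>l\<close>, over to the sample \<open>S\<close>, up to
  \<open>L'\<close>, and back to a hard maximum. In units of \<open>a = W / sqrt x\<close>, which is
  also \<open>sqrt (W / l)\<close>, the costs are 1 + 3 + 72 + 3 + 1 = 80.\<close>

lemma sparsify_finite_small_eps:
  fixes n :: nat and T :: "(nat \<Rightarrow> real) set"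
  assumes T: "finite T" "T \<noteq> {}" and x: "x \<ge> 16"
  defines "W \<equiv> \<integral>g. hmax n T (\<lambda>_. 0) g \<partial>std_gaussian n"
  assumes W: "W > 0"
  obtains S c where "S \<subseteq> T" "S \<noteq> {}" "card S \<le> x * exp (3 * x) + 1"
    "l2 n (\<lambda>g. hmax n T (\<lambda>_. 0) g - hmax n S c g) \<le> 80 * (W / sqrt x)"
proof -
  let ?F = "hmax n T (\<lambda>_. 0)"
  have Ft: "tame n ?F" by (rule tame_hmax[OF T])
  define l where "l = x / W"
  have l: "l > 0" using x W by (simp add: l_def)
  define a where "a = W / sqrt x"
  have a: "a > 0" using x W by (simp add: a_def)
  have a2: "a\<^sup>2 = W\<^sup>2 / x" using x by (simp add: a_def power_divide)
  have sl: "sqrt W * (1 / sqrt l) = a"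
    using W x by (simp add: l_def a_def real_sqrt_divide)
  \<comment> \<open>Here \<open>x \<ge> 16\<close> enters. It puts the mean of \<open>lse\<close>
    below \<open>2 * W\<close>, so that the exponent in the density bound is at most
    \<open>l * (3 * W) = 3 * x\<close>.\<close>
  have a4: "4 * a \<le> W"
  proof -
    have "4 \<le> sqrt x" using x by (intro real_le_rsqrt) simp
    then show ?thesis using W x by (simp add: a_def field_simps)
  qed
  obtain L where L: "L \<ge> l" "ln (card T) / L \<le> a" using large_temperature[OF l a] by blast
  have L0: "L > 0" using L l by simp
  have "l2 n (\<lambda>g. hmax n T (\<lambda>_. 0 / L) g - lse n T L (\<lambda>_. 0) g) \<le> a"
    using l2_hmax_lse_le[OF T L0 L(2), of n "\<lambda>_. 0"] .
  then have s1: "l2 n (\<lambda>g. ?F g - lse n T L (\<lambda>_. 0) g) \<le> a" by simp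
  have flow: "3 * sqrt W * \<bar>1 / sqrt l1 - 1 / sqrt l2\<bar> \<le> 3 * a" if "\<bar>1 / sqrt l1 - 1 / sqrt l2\<bar> \<le> 1 / sqrt l" for l1 l2
    using mult_left_mono[OF that, of "3 * sqrt W"] W sl by simp
  obtain b where b: "l2 n (\<lambda>g. lse n T l b g - lse n T L (\<lambda>_. 0) g) \<le> 3 * sqrt W * \<bar>1 / sqrt L - 1 / sqrt l\<bar>"
    using lse_flow[OF T L0 l, of n W "\<lambda>_. 0"] W unfolding W_def by auto
  have s2: "l2 n (\<lambda>g. lse n T L (\<lambda>_. 0) g - lse n T l b g) \<le> 3 * a"
    using order_trans[OF b flow[OF inverse_sqrt_diff_le(2)[OF l L(1)]]]
    unfolding l2_diff_commute[of n "lse n T L (\<lambda>_. 0)" "lse n T l b"] .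
  let ?G = "lse n T l b"
  have Gt: "tame n ?G" "tame n (lse n T L (\<lambda>_. 0))" by (rule tame_lse[OF T l] tame_lse[OF T L0])+
  have FG: "l2 n (\<lambda>g. ?F g - ?G g) \<le> 4 * a"
    using l2_diff_triangle[OF Ft Gt(2,1)] s1 s2 by linarith
  have EG: "(\<integral>g. ?G g \<partial>std_gaussian n) \<le> 2 * W"
  proof -
    have "\<bar>\<integral>g. ?F g - ?G g \<partial>std_gaussian n\<bar> \<le> 4 * a"
      using abs_integral_le_l2[OF tame_diff[OF Ft Gt(1)]] FG by linarith
    then have "\<bar>W - (\<integral>g. ?G g \<partial>std_gaussian n)\<bar> \<le> 4 * a"
      using tame_integrable[OF Ft] tame_integrable[OF Gt(1)] by (simp add: W_def)
    then show ?thesis using a4 by linarith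
  qed
  \<comment> \<open>Chosen so that the density bound over \<open>N\<close> is at most
    \<open>1 / x\<close>, which makes the sampling error of order \<open>a\<^sup>2\<close>.\<close>
  define N where "N = nat \<lceil>x * exp (3 * x)\<rceil>"
  have N: "real N \<ge> x * exp (3 * x)" "real N \<le> x * exp (3 * x) + 1" "N > 0"
  proof -
    have "x * exp (3 * x) > 0" using x by simp
    then show "real N \<ge> x * exp (3 * x)" "real N \<le> x * exp (3 * x) + 1" "N > 0"
      unfolding N_def by linarith+
  qed
  have D: "(\<Sum>i<n. (s i - t i)\<^sup>2) \<le> (16 * W)\<^sup>2" if "s \<in> T" "t \<in> T" for s t
  proof -
    have "(sqrt (\<Sum>i<n. (s i - t i)\<^sup>2))\<^sup>2 \<le> (16 * W)\<^sup>2"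
      using dist_le_width[OF T(1) that, of n] by (intro power_mono) (auto simp: W_def sum_nonneg)
    then show ?thesis by (simp add: sum_nonneg)
  qed
  let ?R = "exp (l * ((\<integral>g. ?G g \<partial>std_gaussian n) + W))"
  obtain S b' where S: "S \<subseteq> T" "S \<noteq> {}" "card S \<le> N" and
    sb: "(l2 n (\<lambda>g. (lse n S l b' g - ?G g) - (\<integral>g. lse n S l b' g - ?G g \<partial>std_gaussian n)))\<^sup>2
      \<le> 4 * (16 * W)\<^sup>2 * ?R / N + 2 * W / l + (16 * W)\<^sup>2 * (l2 n (\<lambda>g. ?F g - ?G g) / W)\<^sup>2"
    by (rule sparsify_sampling[OF T l N(3) W _ D, of b]) (use W_def in auto)
  have Sf: "finite S" using S T finite_subset by blast
  have R: "?R \<le> exp (3 * x)"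
  proof -
    have "l * ((\<integral>g. ?G g \<partial>std_gaussian n) + W) \<le> l * (3 * W)" using EG l by (intro mult_left_mono) auto
    then show ?thesis using W by (simp add: l_def)
  qed
  have e1: "4 * (16 * W)\<^sup>2 * ?R / N \<le> 1024 * a\<^sup>2"
  proof -
    have "?R / N \<le> exp (3 * x) / (x * exp (3 * x))"
      using R N x by (intro frac_le) auto
    also have "\<dots> = 1 / x" by simp
    finally have "4 * (16 * W)\<^sup>2 * (?R / N) \<le> 4 * (16 * W)\<^sup>2 * (1 / x)" by (intro mult_left_mono) auto
    then show ?thesis by (simp add: a2 power_mult_distrib)
  qed
  have e2: "2 * W / l = 2 * a\<^sup>2" using W x by (simp add: l_def a2) (simp add: power2_eq_square)
  have e3: "(16 * W)\<^sup>2 * (l2 n (\<lambda>g. ?F g - ?G g) / W)\<^sup>2 \<le> 4096 * a\<^sup>2"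
  proof -
    have "(16 * W)\<^sup>2 * (l2 n (\<lambda>g. ?F g - ?G g) / W)\<^sup>2 = 256 * (l2 n (\<lambda>g. ?F g - ?G g))\<^sup>2"
      using W by (simp add: power_mult_distrib power_divide)
    also have "\<dots> \<le> 256 * (4 * a)\<^sup>2" by (intro mult_left_mono power_mono FG) (auto simp: l2_nonneg)
    finally show ?thesis by (simp add: power_mult_distrib)
  qed
  define dev where "dev = l2 n (\<lambda>g. (lse n S l b' g - ?G g) - (\<integral>g. lse n S l b' g - ?G g \<partial>std_gaussian n))"
  have "dev\<^sup>2 \<le> 4 * (16 * W)\<^sup>2 * ?R / N + 2 * W / l + (16 * W)\<^sup>2 * (l2 n (\<lambda>g. ?F g - ?G g) / W)\<^sup>2"
    unfolding dev_def by (rule sb)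
  also have "\<dots> \<le> 1024 * a\<^sup>2 + 2 * a\<^sup>2 + 4096 * a\<^sup>2"
    by (intro add_mono e1 e3 eq_refl[OF e2])
  \<comment> \<open>The coefficients sum to 5122, and 72 squared is 5184.\<close>
  also have "\<dots> \<le> (72 * a)\<^sup>2" by (simp add: power_mult_distrib)
  finally have "dev \<le> 72 * a" by (rule power2_le_imp_le) (use a in simp)
  then have s3: "l2 n (\<lambda>g. (lse n S l b' g - ?G g) - (\<integral>g. lse n S l b' g - ?G g \<partial>std_gaussian n)) \<le> 72 * a"
    unfolding dev_def .
  define k where "k = - (\<integral>g. lse n S l b' g - ?G g \<partial>std_gaussian n)"
  define b2 where "b2 s = b' s + l * k" for s
  have b2: "lse n S l b2 g = lse n S l b' g + k" for g
    unfolding b2_def by (rule lse_shift[OF Sf S(2) l])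
  have "lse n S l b2 g - ?G g = (lse n S l b' g - ?G g) - (\<integral>g. lse n S l b' g - ?G g \<partial>std_gaussian n)" for g
    unfolding b2 k_def by simp
  then have s3': "l2 n (\<lambda>g. ?G g - lse n S l b2 g) \<le> 72 * a"
    unfolding l2_diff_commute[of n ?G "lse n S l b2"] using s3 by presburger
  obtain L' where L': "L' \<ge> l" "ln (card S) / L' \<le> a" using large_temperature[OF l a] by blast
  have L'0: "L' > 0" using L' l by simp
  have wS: "(\<integral>g. hmax n S (\<lambda>_. 0) g \<partial>std_gaussian n) \<le> W"
    unfolding W_def by (rule hmax_zero_integral_mono[OF T(1) S(1,2)])
  obtain b3 where b3: "l2 n (\<lambda>g. lse n S L' b3 g - lse n S l b2 g) \<le> 3 * sqrt W * \<bar>1 / sqrt l - 1 / sqrt L'\<bar>"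
    using lse_flow[OF Sf S(2) l L'0 wS W] by blast
  have s4: "l2 n (\<lambda>g. lse n S l b2 g - lse n S L' b3 g) \<le> 3 * a"
    using order_trans[OF b3 flow[OF inverse_sqrt_diff_le(1)[OF l L'(1)]]]
    unfolding l2_diff_commute[of n "lse n S l b2" "lse n S L' b3"] .
  define c where "c s = b3 s / L'" for s
  have s5: "l2 n (\<lambda>g. lse n S L' b3 g - hmax n S c g) \<le> a"
    using l2_hmax_lse_le[OF Sf S(2) L'0 L'(2), of n b3]
    unfolding c_def[abs_def] l2_diff_commute[of n "lse n S L' b3"] .
  have t: "tame n (lse n S l b2)" "tame n (lse n S L' b3)" "tame n (hmax n S c)"
    by (rule tame_lse[OF Sf S(2) l] tame_lse[OF Sf S(2) L'0] tame_hmax[OF Sf S(2)])+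
  have "l2 n (\<lambda>g. ?F g - hmax n S c g) \<le> 80 * a"
    using l2_diff_triangle[OF Ft Gt(1) t(3)] l2_diff_triangle[OF Gt(1) t(1) t(3)]
      l2_diff_triangle[OF t(1) t(2) t(3)] FG s3' s4 s5 a by linarith
  moreover have "card S \<le> x * exp (3 * x) + 1" using S(3) N(2) by (meson of_nat_le_iff order_trans)
  ultimately show thesis using that S by (simp add: a_def)
qed

text \<open>A single point has to do when the cardinality bound falls below 2. The diameter is at
  most \<open>16 * W\<close>, so the Poincare inequality bounds the fluctuation by
  \<open>16 * W\<close>. Passing through a soft maximum, which has a gradient, costs
  \<open>W\<close>, and correcting the mean another \<open>W\<close>.\<close>

lemma sparsify_finite_large_eps:
  fixes n :: nat and T :: "(nat \<Rightarrow> real) set"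
  assumes T: "finite T" and s: "s \<in> T"
  defines "W \<equiv> \<integral>g. hmax n T (\<lambda>_. 0) g \<partial>std_gaussian n"
  assumes W: "W > 0"
  shows "l2 n (\<lambda>g. hmax n T (\<lambda>_. 0) g - (dot n g s + W)) \<le> 18 * W"
proof -
  let ?F = "hmax n T (\<lambda>_. 0)"
  have Te: "T \<noteq> {}" using s by auto
  have Ft: "tame n ?F" by (rule tame_hmax[OF T Te])
  obtain L where L: "L \<ge> 1" "ln (card T) / L \<le> W" using large_temperature[of 1 W] W by auto
  have L0: "L > 0" using L by simp
  let ?G = "lse n T L (\<lambda>_. 0)" and ?D = "lse n {s} L (\<lambda>_. 0)"
  have Gt: "tame n ?G" "tame n ?D" by (auto intro!: tame_lse T Te L0)
  have D: "?D g = dot n g s" for g using L0 by (simp add: lse_def)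
  have "l2 n (\<lambda>g. hmax n T (\<lambda>_. 0 / L) g - ?G g) \<le> W"
    using l2_hmax_lse_le[OF T Te L0 L(2), of n "\<lambda>_. 0"] .
  then have FG: "l2 n (\<lambda>g. ?F g - ?G g) \<le> W" by simp
  define k where "k = (\<integral>g. ?D g - ?G g \<partial>std_gaussian n)"
  have "(l2 n (\<lambda>g. (?D g - ?G g) - k))\<^sup>2
      \<le> (\<integral>g. (\<Sum>i<n. (gmean n {s} L (\<lambda>_. 0) g i - gmean n T L (\<lambda>_. 0) g i)\<^sup>2) \<partial>std_gaussian n)"
    unfolding k_def by (rule lse_diff_poincare) (use T Te L0 in auto)
  also have "\<dots> \<le> (\<integral>g. (16 * W)\<^sup>2 \<partial>std_gaussian n)"
  proof (rule integral_mono_tame)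
    show "tame n (\<lambda>g. \<Sum>i<n. (gmean n {s} L (\<lambda>_. 0) g i - gmean n T L (\<lambda>_. 0) g i)\<^sup>2)"
      by (intro tame_sum tame_power tame_diff tame_gmean T Te L0) auto
    fix g
    have "(\<Sum>i<n. (gmean n T L (\<lambda>_. 0) g i - s i)\<^sup>2) \<le> (16 * W)\<^sup>2"
    proof (rule gmean_dist_le[OF T Te L0])
      fix t assume "t \<in> T"
      have "(sqrt (\<Sum>i<n. (t i - s i)\<^sup>2))\<^sup>2 \<le> (16 * W)\<^sup>2"
        using dist_le_width[OF T \<open>t \<in> T\<close> s, of n] by (intro power_mono) (auto simp: W_def sum_nonneg)
      then show "(\<Sum>i<n. (t i - s i)\<^sup>2) \<le> (16 * W)\<^sup>2" by (simp add: sum_nonneg)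
    qed
    then show "(\<Sum>i<n. (gmean n {s} L (\<lambda>_. 0) g i - gmean n T L (\<lambda>_. 0) g i)\<^sup>2) \<le> (16 * W)\<^sup>2"
      by (simp add: gmean_def[of n "{s}"] gibbs_def[of n "{s}"] power2_commute)
  qed simp
  finally have "(l2 n (\<lambda>g. (?D g - ?G g) - k))\<^sup>2 \<le> (16 * W)\<^sup>2" by simp
  then have "l2 n (\<lambda>g. (?D g - ?G g) - k) \<le> 16 * W"
    by (rule power2_le_imp_le) (use W in simp)
  moreover have "(\<lambda>g. ?D g - k - ?G g) = (\<lambda>g. ?D g - ?G g - k)" by (rule ext) simp
  ultimately have 1: "l2 n (\<lambda>g. ?G g - (?D g - k)) \<le> 16 * W"
    unfolding l2_diff_commute[of n ?G "\<lambda>g. ?D g - k"] by (simp only:)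
  have EF: "\<bar>W + k\<bar> \<le> W"
  proof -
    have "\<bar>\<integral>g. ?F g - ?G g \<partial>std_gaussian n\<bar> \<le> W"
      using abs_integral_le_l2[OF tame_diff[OF Ft Gt(1)]] FG by linarith
    moreover have "(\<integral>g. ?F g - ?G g \<partial>std_gaussian n) = W + k"
      using tame_integrable[OF Ft] tame_integrable[OF Gt(1)] tame_integrable[OF tame_dot[of n s]]
      by (simp add: W_def k_def D)
    ultimately show ?thesis by simp
  qed
  have "(?D g - k) - (dot n g s + W) = - (W + k)" for g by (simp add: D)
  then have "l2 n (\<lambda>g. (?D g - k) - (dot n g s + W)) = \<bar>W + k\<bar>"
    by (simp only: l2_const abs_minus_cancel)
  then have 2: "l2 n (\<lambda>g. (?D g - k) - (dot n g s + W)) \<le> W" using EF by simp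
  have t: "tame n (\<lambda>g. ?D g - k)" "tame n (\<lambda>g. dot n g s + W)"
    by (intro tame_diff tame_add tame_dot tame_const Gt)+
  show ?thesis
    using l2_diff_triangle[OF Ft Gt(1) t(2)] l2_diff_triangle[OF Gt(1) t(1) t(2)] FG 1 2 by linarith
qed

text \<open>Since \<open>dot n g s\<close> never exceeds the supremum, raising a negative constant to 0 cannot
  increase the error.\<close>

lemma abs_hmax_clamp_le:
  fixes S T :: "(nat \<Rightarrow> real) set"
  assumes "finite T" "S \<subseteq> T" "S \<noteq> {}"
  shows "\<bar>hmax n T (\<lambda>_. 0) g - hmax n S (\<lambda>s. max 0 (c s)) g\<bar> \<le> \<bar>hmax n T (\<lambda>_. 0) g - hmax n S c g\<bar>"
proof -
  have S: "finite S" "S \<noteq> {}" and T: "finite T" "T \<noteq> {}" using assms by (auto intro: finite_subset)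
  obtain s where s: "s \<in> S" "hmax n S (\<lambda>s. max 0 (c s)) g = dot n g s + max 0 (c s)"
    using hmax_attained[OF S] by blast
  have le: "hmax n S c g \<le> hmax n S (\<lambda>s. max 0 (c s)) g"
    unfolding hmax_le_iff[OF S]
  proof
    fix r assume "r \<in> S"
    then show "dot n g r + c r \<le> hmax n S (\<lambda>s. max 0 (c s)) g"
      using hmax_ge[OF S, of r n g "\<lambda>s. max 0 (c s)"] by linarith
  qed
  show ?thesis
  proof (cases "c s \<ge> 0")
    case True
    then have "hmax n S (\<lambda>s. max 0 (c s)) g \<le> hmax n S c g"
      using s hmax_ge[OF S s(1), of n g c] by simp
    then show ?thesis using le by simp
  next
    case False
    then have "hmax n S (\<lambda>s. max 0 (c s)) g \<le> hmax n T (\<lambda>_. 0) g"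
      using s hmax_ge[OF T, of s n g "\<lambda>_. 0"] assms by auto
    then show ?thesis using le by simp
  qed
qed

lemma dist_Rn_pos:
  assumes "s \<in> Rn n" "t \<in> Rn n" "s \<noteq> t"
  shows "0 < sqrt (\<Sum>i<n. (s i - t i)\<^sup>2)"
proof -
  have "\<exists>i<n. s i \<noteq> t i"
  proof (rule ccontr)
    assume "\<not> ?thesis"
    then have "s = t" using assms(1,2) unfolding Rn_def by (intro PiE_ext) auto
    then show False using assms(3) by simp
  qed
  then obtain i where "i < n" "s i \<noteq> t i" by blast
  then have "(\<Sum>i<n. (s i - t i)\<^sup>2) > 0" by (intro sum_pos2[of _ i]) auto
  then show ?thesis by simp
qed

lemma sparsify_finite:
  fixes T :: "(nat \<Rightarrow> real) set" and \<epsilon> :: real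
  assumes T: "finite T" "T \<noteq> {}" "T \<subseteq> Rn n" and \<epsilon>: "\<epsilon> > 0"
  obtains S c where "S \<subseteq> T" "S \<noteq> {}" "\<And>s. s \<in> S \<Longrightarrow> c s \<ge> 0" "card S \<le> exp (32000 / \<epsilon>\<^sup>2)"
    "l2 n (\<lambda>g. hmax n T (\<lambda>_. 0) g - hmax n S c g) \<le> \<epsilon> * (\<integral>g. hmax n T (\<lambda>_. 0) g \<partial>std_gaussian n)"
proof -
  let ?F = "hmax n T (\<lambda>_. 0)"
  let ?W = "\<integral>g. ?F g \<partial>std_gaussian n"
  obtain s where s: "s \<in> T" using T by auto
  show thesis
  proof (cases "T = {s}")
    case True
    then have "?W = 0" by (simp add: hmax_def)
    then show thesis using True that[of T "\<lambda>_. 0"] by simp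
  next
    case False
    then obtain t where t: "t \<in> T" "t \<noteq> s" using s by auto
    have W: "?W > 0"
    proof -
      have "0 < sqrt (\<Sum>i<n. (s i - t i)\<^sup>2)" using T(3) s t by (intro dist_Rn_pos) auto
      then show ?thesis using dist_le_width[OF T(1) s t(1), of n] by linarith
    qed
    show thesis
    proof (cases "\<epsilon> \<ge> 18")
      case True
      have "l2 n (\<lambda>g. ?F g - (dot n g s + ?W)) \<le> 18 * ?W"
        using sparsify_finite_large_eps[OF T(1) s] W by blast
      also have "\<dots> \<le> \<epsilon> * ?W" using True W by simp
      finally show thesis
        using W s by (intro that[of "{s}" "\<lambda>_. ?W"]) (auto simp: hmax_def[of n "{s}"])
    next
      case False
      \<comment> \<open>This makes the error \<open>80 * (?W / sqrt x)\<close> equal to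
        \<open>\<epsilon> * ?W\<close>. The cardinality bound \<open>x * exp (3 * x) + 1\<close> is
        at most \<open>exp (5 * x)\<close>, and 5 * 6400 = 32000.\<close>
      define x where "x = 6400 / \<epsilon>\<^sup>2"
      have "\<epsilon>\<^sup>2 \<le> 18\<^sup>2" using False \<epsilon> by (intro power_mono) auto
      then have x: "x \<ge> 16" using \<epsilon> by (simp add: x_def pos_le_divide_eq)
      have sx: "sqrt x = 80 / \<epsilon>"
        unfolding x_def using \<epsilon> by (intro real_sqrt_unique) (auto simp: power_divide)
      obtain S c where S: "S \<subseteq> T" "S \<noteq> {}" "card S \<le> x * exp (3 * x) + 1"
        "l2 n (\<lambda>g. ?F g - hmax n S c g) \<le> 80 * (?W / sqrt x)"
        using sparsify_finite_small_eps[OF T(1,2) x W] by blast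
      have Sf: "finite S" using S T finite_subset by blast
      have xe: "x \<le> exp x" "2 \<le> exp x" using exp_ge_add_one_self[of x] x by linarith+
      have "x * exp (3 * x) + 1 \<le> exp x * exp (3 * x) + exp (4 * x)"
        using xe x by (intro add_mono mult_right_mono) auto
      also have "\<dots> = 2 * exp (4 * x)" by (simp add: exp_add[symmetric])
      also have "\<dots> \<le> exp x * exp (4 * x)"
        using xe by (intro mult_right_mono) auto
      also have "\<dots> = exp (32000 / \<epsilon>\<^sup>2)" by (simp add: exp_add[symmetric] x_def)
      finally have card: "card S \<le> exp (32000 / \<epsilon>\<^sup>2)" using S(3) by linarith
      have "l2 n (\<lambda>g. ?F g - hmax n S (\<lambda>s. max 0 (c s)) g) \<le> l2 n (\<lambda>g. ?F g - hmax n S c g)"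
        by (intro l2_mono tame_diff tame_hmax T Sf S abs_hmax_clamp_le)
      also have "\<dots> \<le> \<epsilon> * ?W" using S(4) \<epsilon> by (simp add: sx mult.commute)
      finally show thesis using that[of S "\<lambda>s. max 0 (c s)"] S card by auto
    qed
  qed
qed

section \<open>Passage from finite to bounded sets\<close>

text \<open>One representative is chosen in each occupied grid cell, and chosen from
  \<open>T\<close> itself, so that the final \<open>S\<close> is a subset of \<open>T\<close>. The
  net may be large, since the bound for finite sets does not depend on their size.\<close>

lemma coordinate_net:
  fixes T :: "(nat \<Rightarrow> real) set"
  assumes bound: "\<forall>t\<in>T. \<forall>i<n. \<bar>t i\<bar> \<le> B" and "T \<noteq> {}" and \<delta>: "\<delta> > 0"
  obtains T0 where "finite T0" "T0 \<subseteq> T" "T0 \<noteq> {}" "\<forall>t\<in>T. \<exists>s\<in>T0. \<forall>i<n. \<bar>t i - s i\<bar> \<le> \<delta>"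
proof -
  define cell where "cell t = (\<lambda>i\<in>{..<n}. \<lfloor>t i / \<delta>\<rfloor>)" for t :: "nat \<Rightarrow> real"
  have "cell ` T \<subseteq> (\<Pi>\<^sub>E i\<in>{..<n}. {\<lfloor>- B / \<delta>\<rfloor>..\<lfloor>B / \<delta>\<rfloor>})"
  proof
    fix k assume "k \<in> cell ` T"
    then obtain t where t: "t \<in> T" "k = cell t" by auto
    show "k \<in> (\<Pi>\<^sub>E i\<in>{..<n}. {\<lfloor>- B / \<delta>\<rfloor>..\<lfloor>B / \<delta>\<rfloor>})"
      unfolding t(2) cell_def
    proof (rule restrict_PiE_iff[THEN iffD2], rule ballI)
      fix i assume "i \<in> {..<n}"
      then have "\<bar>t i\<bar> \<le> B" using bound t by auto
      then have "- B / \<delta> \<le> t i / \<delta>" "t i / \<delta> \<le> B / \<delta>"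
        using \<delta> divide_right_mono[of "- B" "t i" \<delta>] divide_right_mono[of "t i" B \<delta>] by auto
      then show "\<lfloor>t i / \<delta>\<rfloor> \<in> {\<lfloor>- B / \<delta>\<rfloor>..\<lfloor>B / \<delta>\<rfloor>}" by (auto intro: floor_mono)
    qed
  qed
  then have fin: "finite (cell ` T)" by (rule finite_subset) (auto intro: finite_PiE)
  define rep where "rep k = (SOME t. t \<in> T \<and> cell t = k)" for k
  have rep: "rep (cell t) \<in> T" "cell (rep (cell t)) = cell t" if "t \<in> T" for t
    using someI[of "\<lambda>s. s \<in> T \<and> cell s = cell t" t] that unfolding rep_def by auto
  show thesis
  proof (rule that[of "rep ` cell ` T"])
    show "\<forall>t\<in>T. \<exists>s\<in>rep ` cell ` T. \<forall>i<n. \<bar>t i - s i\<bar> \<le> \<delta>"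
    proof
      fix t assume t: "t \<in> T"
      have "\<bar>t i - rep (cell t) i\<bar> \<le> \<delta>" if i: "i < n" for i
      proof -
        have "\<lfloor>t i / \<delta>\<rfloor> = \<lfloor>rep (cell t) i / \<delta>\<rfloor>"
          using fun_cong[OF rep(2)[OF t], of i] i by (simp add: cell_def)
        then have "\<bar>t i / \<delta> - rep (cell t) i / \<delta>\<bar> \<le> 1" by linarith
        then have "\<bar>(t i - rep (cell t) i) / \<delta>\<bar> \<le> 1" by (simp add: diff_divide_distrib)
        then show ?thesis using \<delta> by (simp add: abs_divide)
      qed
      then show "\<exists>s\<in>rep ` cell ` T. \<forall>i<n. \<bar>t i - s i\<bar> \<le> \<delta>" using t by blast
    qed
  qed (use fin rep \<open>T \<noteq> {}\<close> in auto)
qed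

context
  fixes n :: nat and T :: "(nat \<Rightarrow> real) set" and B :: real
  assumes ne: "T \<noteq> {}" and bound: "\<forall>t\<in>T. \<forall>i<n. \<bar>t i\<bar> \<le> B"
begin

lemma dot_le_SUP: "t \<in> T \<Longrightarrow> dot n g t \<le> (SUP t\<in>T. dot n g t)"
proof (rule cSUP_upper)
  show "bdd_above ((\<lambda>t. dot n g t) ` T)"
  proof (rule bdd_aboveI)
    fix y assume "y \<in> (\<lambda>t. dot n g t) ` T"
    then obtain t where "t \<in> T" "y = dot n g t" by auto
    then show "y \<le> B * l1 n g" using abs_dot_le_l1[of n t B g] bound by (auto simp: abs_le_iff)
  qed
qed

lemma SUP_minus_hmax:
  assumes T0: "finite T0" "T0 \<subseteq> T" "T0 \<noteq> {}"
    and net: "\<forall>t\<in>T. \<exists>s\<in>T0. \<forall>i<n. \<bar>t i - s i\<bar> \<le> \<delta>"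
  shows "0 \<le> (SUP t\<in>T. dot n g t) - hmax n T0 (\<lambda>_. 0) g"
    "(SUP t\<in>T. dot n g t) - hmax n T0 (\<lambda>_. 0) g \<le> \<delta> * l1 n g"
proof -
  have "hmax n T0 (\<lambda>_. 0) g \<le> (SUP t\<in>T. dot n g t)"
    unfolding hmax_le_iff[OF T0(1,3)] using T0 dot_le_SUP by auto
  then show "0 \<le> (SUP t\<in>T. dot n g t) - hmax n T0 (\<lambda>_. 0) g" by simp
  have "(SUP t\<in>T. dot n g t) \<le> hmax n T0 (\<lambda>_. 0) g + \<delta> * l1 n g"
  proof (rule cSUP_least[OF ne])
    fix t assume "t \<in> T"
    then obtain s where s: "s \<in> T0" "\<And>i. i < n \<Longrightarrow> \<bar>t i - s i\<bar> \<le> \<delta>" using net by blast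
    have "dot n g t = dot n g s + dot n g (\<lambda>i. t i - s i)"
      by (simp add: dot_def right_diff_distrib sum_subtractf)
    moreover have "\<bar>dot n g (\<lambda>i. t i - s i)\<bar> \<le> \<delta> * l1 n g" by (rule abs_dot_le_l1) (rule s(2))
    ultimately show "dot n g t \<le> hmax n T0 (\<lambda>_. 0) g + \<delta> * l1 n g"
      using hmax_ge[OF T0(1,3) s(1), of n g "\<lambda>_. 0"] by linarith
  qed
  then show "(SUP t\<in>T. dot n g t) - hmax n T0 (\<lambda>_. 0) g \<le> \<delta> * l1 n g" by simp
qed

text \<open>\<open>T\<close> may be uncountable, so measurability is the issue: the supremum is the
  pointwise limit of finite maxima over nets of mesh \<open>1 / real (Suc k)\<close>.\<close>

lemma tame_SUP: "tame n (\<lambda>g. SUP t\<in>T. dot n g t)"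
proof -
  have "\<exists>T0. finite T0 \<and> T0 \<subseteq> T \<and> T0 \<noteq> {} \<and> (\<forall>t\<in>T. \<exists>s\<in>T0. \<forall>i<n. \<bar>t i - s i\<bar> \<le> 1 / real (Suc k))" for k
  proof -
    have "1 / real (Suc k) > 0" by simp
    from coordinate_net[OF bound ne this] show ?thesis by metis
  qed
  then obtain T0 where T0: "\<And>k. finite (T0 k)" "\<And>k. T0 k \<subseteq> T" "\<And>k. T0 k \<noteq> {}"
    "\<And>k. \<forall>t\<in>T. \<exists>s\<in>T0 k. \<forall>i<n. \<bar>t i - s i\<bar> \<le> 1 / real (Suc k)" by metis
  note diff = SUP_minus_hmax[OF T0]
  have meas: "(\<lambda>g. SUP t\<in>T. dot n g t) \<in> borel_measurable (std_gaussian n)"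
  proof (rule borel_measurable_LIMSEQ_real)
    fix g
    have "(\<lambda>k. (SUP t\<in>T. dot n g t) - hmax n (T0 k) (\<lambda>_. 0) g) \<longlonglongrightarrow> 0"
    proof (rule Lim_null_comparison[OF always_eventually])
      show "\<forall>k. norm ((SUP t\<in>T. dot n g t) - hmax n (T0 k) (\<lambda>_. 0) g) \<le> 1 / real (Suc k) * l1 n g"
        using diff by simp
      show "(\<lambda>k. 1 / real (Suc k) * l1 n g) \<longlonglongrightarrow> 0"
        by (rule tendsto_mult_left_zero[OF LIMSEQ_Suc[OF lim_1_over_n]])
    qed
    from tendsto_diff[OF tendsto_const[of "SUP t\<in>T. dot n g t"] this]
    show "(\<lambda>k. hmax n (T0 k) (\<lambda>_. 0) g) \<longlonglongrightarrow> (SUP t\<in>T. dot n g t)" by simp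
  next
    show "hmax n (T0 k) (\<lambda>_. 0) \<in> borel_measurable (std_gaussian n)" for k
      using tame_measurable[OF tame_hmax[OF T0(1,3)]] .
  qed
  have "tame n (\<lambda>g. \<bar>hmax n (T0 0) (\<lambda>_. 0) g\<bar> + 1 * l1 n g)"
    by (intro tame_add tame_abs tame_mult tame_hmax T0) auto
  then show ?thesis
  proof (rule tame_mono[OF _ meas])
    show "\<bar>SUP t\<in>T. dot n g t\<bar> \<le> \<bar>\<bar>hmax n (T0 0) (\<lambda>_. 0) g\<bar> + 1 * l1 n g\<bar>" for g
      using diff[of g 0] by simp
  qed
qed

end

text \<open>Half of \<open>\<epsilon>\<close> is spent on the net and half on sparsifying it, which
  turns 32000 into 128000.\<close>

theorem sparsify_bounded:
  fixes T :: "(nat \<Rightarrow> real) set" and \<epsilon> :: real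
  assumes T: "T \<subseteq> Rn n" "T \<noteq> {}" and bd: "bounded_Rn n T" and \<epsilon>: "\<epsilon> > 0"
  obtains S c where "finite S" "S \<subseteq> T" "S \<noteq> {}" "\<And>s. s \<in> S \<Longrightarrow> c s \<ge> 0" "card S \<le> exp (128000 / \<epsilon>\<^sup>2)"
    "tame n (\<lambda>g. (SUP t\<in>T. dot n g t) - hmax n S c g)"
    "l2 n (\<lambda>g. (SUP t\<in>T. dot n g t) - hmax n S c g) \<le> \<epsilon> * gaussian_width n T"
proof -
  obtain B where B: "\<And>t. t \<in> T \<Longrightarrow> L2_set t {..<n} \<le> B" using bd unfolding bounded_Rn_def by blast
  have bound: "\<forall>t\<in>T. \<forall>i<n. \<bar>t i\<bar> \<le> B"
  proof (intro ballI allI impI)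
    fix t i assume "t \<in> T" "i < n"
    then show "\<bar>t i\<bar> \<le> B"
      using member_le_L2_set[of "{..<n}" i "\<lambda>i. \<bar>t i\<bar>"] B[of t] by (simp add: L2_set_def)
  qed
  let ?F = "\<lambda>g. SUP t\<in>T. dot n g t"
  have Ft: "tame n ?F" by (rule tame_SUP[OF T(2) bound])
  let ?W = "gaussian_width n T"
  obtain s where s: "s \<in> T" using T by auto
  have widths: "(\<integral>g. hmax n T0 (\<lambda>_. 0) g \<partial>std_gaussian n) \<le> ?W" if T0: "finite T0" "T0 \<subseteq> T" "T0 \<noteq> {}" for T0
    unfolding gaussian_width_def
  proof (rule integral_mono_tame[OF tame_hmax[OF T0(1,3)] Ft])
    show "hmax n T0 (\<lambda>_. 0) g \<le> ?F g" for g
      unfolding hmax_le_iff[OF T0(1,3)] using T0 dot_le_SUP[OF T(2) bound] by auto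
  qed
  obtain T0 where T0: "finite T0" "T0 \<subseteq> T" "T0 \<noteq> {}"
    and close: "l2 n (\<lambda>g. ?F g - hmax n T0 (\<lambda>_. 0) g) \<le> \<epsilon> / 2 * ?W"
  proof (cases "?W > 0")
    case True
    \<comment> \<open>The added 1 keeps the divisor positive, also for \<open>n = 0\<close>.\<close>
    define X where "X = l2 n (l1 n) + 1"
    define \<delta> where "\<delta> = \<epsilon> / 2 * ?W / X"
    have L: "X > 0" using l2_nonneg[of n "l1 n"] by (simp add: X_def)
    have \<delta>: "\<delta> > 0" unfolding \<delta>_def using True \<epsilon> L by simp
    obtain T0 where T0: "finite T0" "T0 \<subseteq> T" "T0 \<noteq> {}"
      "\<forall>t\<in>T. \<exists>s\<in>T0. \<forall>i<n. \<bar>t i - s i\<bar> \<le> \<delta>" using coordinate_net[OF bound T(2) \<delta>] by blast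
    note diff = SUP_minus_hmax[OF T(2) bound T0]
    have "l2 n (\<lambda>g. ?F g - hmax n T0 (\<lambda>_. 0) g) \<le> l2 n (\<lambda>g. \<delta> * l1 n g)"
    proof (rule l2_mono)
      show "tame n (\<lambda>g. ?F g - hmax n T0 (\<lambda>_. 0) g)" by (intro tame_diff Ft tame_hmax T0)
      show "\<bar>?F g - hmax n T0 (\<lambda>_. 0) g\<bar> \<le> \<bar>\<delta> * l1 n g\<bar>" for g using diff[of g] by linarith
    qed (intro tame_mult tame_const tame_l1)
    also have "\<dots> = \<delta> * l2 n (l1 n)" using \<delta> by (simp add: l2_cmult)
    also have "\<dots> \<le> \<delta> * X" using \<delta> by (simp add: X_def)
    also have "\<dots> = \<epsilon> / 2 * ?W" using L by (simp add: \<delta>_def)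
    finally show thesis using that[OF T0(1-3)] by simp
  next
    case False
    \<comment> \<open>The allowed error is not positive here, so the supremum must be met exactly.
      Two distinct points would already give a positive width.\<close>
    have "T = {s}"
    proof (rule ccontr)
      assume "T \<noteq> {s}"
      then obtain t where t: "t \<in> T" "t \<noteq> s" using s by auto
      then have "0 < sqrt (\<Sum>i<n. (s i - t i)\<^sup>2)" using T(1) s by (intro dist_Rn_pos) auto
      moreover have "sqrt (\<Sum>i<n. (s i - t i)\<^sup>2) \<le> 16 * (\<integral>g. hmax n {s, t} (\<lambda>_. 0) g \<partial>std_gaussian n)"
        by (rule dist_le_width) auto
      moreover have "(\<integral>g. hmax n {s, t} (\<lambda>_. 0) g \<partial>std_gaussian n) \<le> ?W"
        using s t by (intro widths) auto
      ultimately show False using False by linarith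
    qed
    then have eq: "?F g = hmax n {s} (\<lambda>_. 0) g" for g by (simp add: hmax_def)
    have "?W = 0" using \<open>T = {s}\<close> by (simp add: gaussian_width_def)
    then have "l2 n (\<lambda>g. ?F g - hmax n {s} (\<lambda>_. 0) g) \<le> \<epsilon> / 2 * ?W" unfolding eq by simp
    then show thesis using that[of "{s}"] s by simp
  qed
  have \<epsilon>2: "\<epsilon> / 2 > 0" using \<epsilon> by simp
  have T0n: "T0 \<subseteq> Rn n" using T0 T by auto
  obtain S c where S: "S \<subseteq> T0" "S \<noteq> {}" "\<And>s. s \<in> S \<Longrightarrow> c s \<ge> 0" "card S \<le> exp (32000 / (\<epsilon> / 2)\<^sup>2)"
    "l2 n (\<lambda>g. hmax n T0 (\<lambda>_. 0) g - hmax n S c g) \<le> \<epsilon> / 2 * (\<integral>g. hmax n T0 (\<lambda>_. 0) g \<partial>std_gaussian n)"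
    using sparsify_finite[OF T0(1,3) T0n \<epsilon>2] by blast
  have Sf: "finite S" using S T0 finite_subset by blast
  have t: "tame n (hmax n T0 (\<lambda>_. 0))" "tame n (hmax n S c)" by (rule tame_hmax[OF T0(1,3)] tame_hmax[OF Sf S(2)])+
  have "\<epsilon> / 2 * (\<integral>g. hmax n T0 (\<lambda>_. 0) g \<partial>std_gaussian n) \<le> \<epsilon> / 2 * ?W"
    using \<epsilon> widths[OF T0] by (intro mult_left_mono) auto
  then have "l2 n (\<lambda>g. ?F g - hmax n S c g) \<le> \<epsilon> / 2 * ?W + \<epsilon> / 2 * ?W"
    using l2_diff_triangle[OF Ft t] close S(5) by linarith
  also have "\<dots> = \<epsilon> * ?W" by simp
  finally have "l2 n (\<lambda>g. ?F g - hmax n S c g) \<le> \<epsilon> * ?W" .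
  moreover have "card S \<le> exp (128000 / \<epsilon>\<^sup>2)" using S(4) by (simp add: power_divide)
  moreover have "S \<subseteq> T" using S(1) T0(2) by blast
  ultimately show thesis
    by (intro that[of S c] Sf S(2,3) tame_diff[OF Ft t(2)])
qed

lemma L2_norm_eq_l2:
  assumes "tame n f"
  shows "L2_norm (std_gaussian n) f = ennreal (l2 n f)"
  unfolding l2_def using L2_norm_eq_integral[of "std_gaussian n" f] tame_integrable[OF tame_power[OF assms, of 2]]
  by simp

theorem theorem1:
  shows "\<exists>C::real. C > 0 \<and>
    (\<forall>(n::nat) (T :: (nat \<Rightarrow> real) set) (\<epsilon>::real).
       n \<ge> 1 \<longrightarrow> T \<subseteq> Rn n \<longrightarrow> T \<noteq> {} \<longrightarrow> bounded_Rn n T \<longrightarrow> \<epsilon> > 0 \<longrightarrow>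
       (\<exists>(S :: (nat \<Rightarrow> real) set) (c :: (nat \<Rightarrow> real) \<Rightarrow> real).
          finite S \<and> S \<noteq> {} \<and> S \<subseteq> T \<and> (\<forall>s\<in>S. c s \<ge> 0) \<and>
          real (card S) \<le> exp (C / \<epsilon>\<^sup>2) \<and>
          L2_norm (std_gaussian n)
              (\<lambda>g. (SUP t\<in>T. dot n g t) - Max ((\<lambda>s. dot n g s + c s) ` S))
            \<le> ennreal (\<epsilon> * gaussian_width n T)))"
proof (intro exI[of _ 128000] conjI allI impI)
  fix n :: nat and T :: "(nat \<Rightarrow> real) set" and \<epsilon> :: real
  assume T: "T \<subseteq> Rn n" "T \<noteq> {}" "bounded_Rn n T" and \<epsilon>: "\<epsilon> > 0"
  obtain S c where S: "finite S" "S \<subseteq> T" "S \<noteq> {}" "\<And>s. s \<in> S \<Longrightarrow> c s \<ge> 0" "card S \<le> exp (128000 / \<epsilon>\<^sup>2)"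
    "tame n (\<lambda>g. (SUP t\<in>T. dot n g t) - hmax n S c g)"
    "l2 n (\<lambda>g. (SUP t\<in>T. dot n g t) - hmax n S c g) \<le> \<epsilon> * gaussian_width n T"
    by (rule sparsify_bounded[OF T \<epsilon>]) blast
  have "L2_norm (std_gaussian n) (\<lambda>g. (SUP t\<in>T. dot n g t) - Max ((\<lambda>s. dot n g s + c s) ` S))
      \<le> ennreal (\<epsilon> * gaussian_width n T)"
    using L2_norm_eq_l2[OF S(6)] S(7) by (simp add: hmax_def ennreal_leI)
  with S(1-5) show "\<exists>(S :: (nat \<Rightarrow> real) set) (c :: (nat \<Rightarrow> real) \<Rightarrow> real).
          finite S \<and> S \<noteq> {} \<and> S \<subseteq> T \<and> (\<forall>s\<in>S. c s \<ge> 0) \<and>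
          real (card S) \<le> exp (128000 / \<epsilon>\<^sup>2) \<and>
          L2_norm (std_gaussian n)
              (\<lambda>g. (SUP t\<in>T. dot n g t) - Max ((\<lambda>s. dot n g s + c s) ` S))
            \<le> ennreal (\<epsilon> * gaussian_width n T)"
    by blast
qed simp

end
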